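(* Let $k\in\mathbb{N}$. If $Y\subseteq\mathbb{R}^k$ is gap-rich, then $\operatorname{spec}(H_{\boldsymbol{y}})$ is a Cantor set of zero Hausdorff dimension for generic $\boldsymbol{y}\in\mathrm{LP}(\mathbb{Z},Y)$ (that is, for all $\boldsymbol{y}$ in some dense $G_\delta$ subset of $\mathrm{LP}(\mathbb{Z},Y)$).
   Context: $\mathbb{N}=\{1,2,\ldots\}$; $Y\subseteq\mathbb{R}^k$ carries the metric $d$ induced by a norm on $\mathbb{R}^k$. $Y^{\mathbb{Z}}$ carries the uniform metric $d(\boldsymbol{y},\boldsymbol{z})=\sup_j d(y_j,z_j)$. $\mathrm{Per}(\mathbb{Z},Y)$ is the set of periodic elements of $Y^{\mathbb{Z}}$ ($y_{j+q}=y_j$ for all $j$, for some $q\in\mathbb{N}$), and $\mathrm{LP}(\mathbb{Z},Y)$ is its closure in the uniform metric, a complete metric space when $Y$ is closed. Words: $Y^\star=\bigcup_{p\ge1}Y^p$. For $\boldsymbol{x}\in Y^p$, $\boldsymbol{x}^{\sharp\mathbb{Z}}\in\mathrm{Per}(\mathbb{Z},Y)$ is the $p$-periodic sequence coinciding with $\boldsymbol{x}$ on $\{1,\ldots,p\}$. For words $\boldsymbol{x},\boldsymbol{y}\in Y^\star$ of possibly different lengths, $d(\boldsymbol{x},\boldsymbol{y}):=d(\boldsymbol{x}^{\sharp\mathbb{Z}},\boldsymbol{y}^{\sharp\mathbb{Z}})$. Operators: for bounded $\boldsymbol{y}=(y_j)_{j\in\mathbb{Z}}\in(\mathbb{R}^k)^{\mathbb{Z}}$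 with $y_j=(y_j(1),\ldots,y_j(k))$, define $\boldsymbol{y}^\natural:\mathbb{Z}\to\mathbb{R}$ by $\boldsymbol{y}^\natural(jk+\ell)=y_j(\ell)$, $j\in\mathbb{Z}$, $1\le\ell\le k$, and let $H_{\boldsymbol{y}}$ be the discrete Schr\"odinger operator on $\ell^2(\mathbb{Z})$, $[H_{\boldsymbol{y}}\psi](n)=\psi(n-1)+\psi(n+1)+\boldsymbol{y}^\natural(n)\psi(n)$. For a word $\boldsymbol{x}\in Y^p$, $H_{\boldsymbol{x}}:=H_{\boldsymbol{x}^{\sharp\mathbb{Z}}}$. $\operatorname{spec}$ denotes the spectrum. Gap-rich set: a closed set $Y\subseteq\mathbb{R}^k$ without isolated points is gap-rich with exceptional set $S\subseteq\mathbb{R}$ if $S$ is discrete and for every $E\in\mathbb{R}\setminus S$, $\boldsymbol{x}\in Y^\star$ and $\varepsilon>0$ there exists $\boldsymbol{y}\in Y^\star$ with $d(\boldsymbol{x},\boldsymbol{y})<\varepsilon$ and $E\notin\operatorname{spec}(H_{\boldsymbol{y}})$. $Y$ is gap-rich if it is gap-rich with some exceptional set. A Cantor set in $\mathbb{R}$ here is a nonempty compact set without isolated points and with empty interior. *)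

theory Defs
  imports "HOL-Analysis.Analysis"
begin

section \<open>Sequences and words over a subset of \<open>\<real>\<^sup>k\<close>\<close>

text \<open>
  The space \<open>\<real>\<^sup>k\<close> is \<^typ>\<open>real ^ 'k\<close> for a finite linearly ordered index type \<open>'k\<close> with
  \<open>k = CARD('k)\<close>; the order on \<open>'k\<close> tells which coordinate is the first, the second, and so on.
\<close>

definition is_norm :: "('a::real_vector \<Rightarrow> real) \<Rightarrow> bool" where
  "is_norm N \<longleftrightarrow> (\<forall>v. 0 \<le> N v) \<and> (\<forall>v. N v = 0 \<longleftrightarrow> v = 0) \<and>
     (\<forall>c v. N (c *\<^sub>R v) = \<bar>c\<bar> * N v) \<and> (\<forall>v w. N (v + w) \<le> N v + N w)"

lemma is_norm_Metric_space:
  assumes "is_norm N"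
  shows "Metric_space Y (\<lambda>v w. N (v - w))"
proof
  fix x y z
  show "0 \<le> N (x - y)" and "N (x - y) = 0 \<longleftrightarrow> x = y"
    using assms by (auto simp: is_norm_def)
  show "N (x - y) = N (y - x)"
  proof -
    have "N ((- 1) *\<^sub>R (y - x)) = \<bar>- 1\<bar> * N (y - x)"
      using assms unfolding is_norm_def by blast
    then show ?thesis by simp
  qed
  have "N ((x - y) + (y - z)) \<le> N (x - y) + N (y - z)"
    using assms unfolding is_norm_def by blast
  then show "N (x - z) \<le> N (x - y) + N (y - z)" by simp
qed

text \<open>
  Bounded \<open>Y\<close>-valued sequences with the uniform metric. For unbounded \<open>Y\<close> the uniform metric is
  infinite for some pairs in \<open>Y\<^sup>\<int>\<close>, but sequences at finite distance from a periodic one are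
  bounded, so closures of sets of periodic sequences do not change under this restriction.
\<close>

definition seq_metric :: "('a::real_vector \<Rightarrow> real) \<Rightarrow> 'a set \<Rightarrow> (int \<Rightarrow> 'a) metric" where
  "seq_metric N Y = funspace UNIV (metric (Y, \<lambda>v w. N (v - w)))"

definition Per :: "'a set \<Rightarrow> (int \<Rightarrow> 'a) set" where
  "Per Y = {y. range y \<subseteq> Y \<and> (\<exists>q::nat. q \<ge> 1 \<and> (\<forall>j. y (j + int q) = y j))}"

definition LP :: "('a::real_vector \<Rightarrow> real) \<Rightarrow> 'a set \<Rightarrow> (int \<Rightarrow> 'a) set" where
  "LP N Y = mtopology_of (seq_metric N Y) closure_of Per Y"

definition LP_metric :: "('a::real_vector \<Rightarrow> real) \<Rightarrow> 'a set \<Rightarrow> (int \<Rightarrow> 'a) metric" where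
  "LP_metric N Y = submetric (seq_metric N Y) (LP N Y)"

definition words :: "'a set \<Rightarrow> 'a list set" where
  "words Y = {x. x \<noteq> [] \<and> set x \<subseteq> Y}"

text \<open>The letters of a word of length \<open>p\<close> occupy the positions \<open>1, \<dots>, p\<close>.\<close>

definition periodize :: "'a list \<Rightarrow> int \<Rightarrow> 'a" where
  "periodize x j = x ! nat ((j - 1) mod int (length x))"

definition word_dist :: "('a::real_vector \<Rightarrow> real) \<Rightarrow> 'a set \<Rightarrow> 'a list \<Rightarrow> 'a list \<Rightarrow> real" where
  "word_dist N Y x y = mdist (seq_metric N Y) (periodize x) (periodize y)"

lemma Per_subset_seq_metric:
  assumes "is_norm N"
  shows "Per Y \<subseteq> mspace (seq_metric N Y)"
proof
  fix y assume "y \<in> Per Y"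
  then obtain q :: nat where y: "range y \<subseteq> Y" "q \<ge> 1" and q: "\<And>j. y (j + int q) = y j"
    by (auto simp: Per_def)
  interpret Metric_space Y "\<lambda>v w. N (v - w)"
    by (rule is_norm_Metric_space[OF assms])
  have shift: "y (j + int q * int m) = y j" for j m
  proof (induction m)
    case (Suc m)
    have "y (j + int q * int (Suc m)) = y ((j + int q * int m) + int q)"
      by (simp add: algebra_simps)
    with q Suc show ?case by metis
  qed simp
  have "y j = y (j mod int q)" for j
  proof (cases "j div int q \<ge> 0")
    case True
    then show ?thesis
      using shift[of "j mod int q" "nat (j div int q)"] by simp
  next
    case False
    then have "j + int q * int (nat (- (j div int q))) = j mod int q"
      by (simp add: minus_mult_div_eq_mod)
    then show ?thesis using shift[of j "nat (- (j div int q))"] by simp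
  qed
  then have "range y \<subseteq> y ` {0..<int q}"
  proof -
    have "j mod int q \<in> {0..<int q}" for j using y(2) by simp
    then show ?thesis using \<open>\<And>j. y j = y (j mod int q)\<close> by (metis image_subsetI imageI)
  qed
  then have "finite (range y)" by (rule finite_subset) simp
  then have "mbounded (range y)"
    using y(1) by (intro compactin_imp_mbounded finite_imp_compactin) auto
  with y(1) show "y \<in> mspace (seq_metric N Y)"
    by (simp add: seq_metric_def fspace_def)
qed

lemma periodize_in_Per:
  assumes "x \<in> words Y"
  shows "periodize x \<in> Per Y"
proof -
  have "nat ((j - 1) mod int (length x)) < length x" for j
    using assms by (simp add: words_def nat_less_iff)
  then have "range (periodize x) \<subseteq> Y"
    using assms by (auto simp: words_def periodize_def subset_iff)
  moreover have "periodize x (j + int (length x)) = periodize x j" for j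
  proof -
    have "(j + int (length x) - 1) mod int (length x) = (j - 1) mod int (length x)"
      by (metis add_diff_eq diff_add_eq mod_add_self2)
    then show ?thesis by (simp add: periodize_def)
  qed
  moreover have "length x \<ge> 1" using assms by (cases x) (auto simp: words_def)
  ultimately show ?thesis unfolding Per_def by blast
qed

lemma word_dist_eq_Sup:
  assumes "is_norm N" "x \<in> words Y" "y \<in> words Y"
  shows "word_dist N Y x y = (SUP j. N (periodize x j - periodize y j))"
proof -
  interpret Metric_space Y "\<lambda>v w. N (v - w)"
    by (rule is_norm_Metric_space[OF assms(1)])
  have "periodize x \<in> fspace UNIV" "periodize y \<in> fspace UNIV"
    using Per_subset_seq_metric[OF assms(1), of Y] periodize_in_Per assms
    by (auto simp: seq_metric_def)
  then show ?thesis by (simp add: word_dist_def seq_metric_def fdist_def)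
qed

section \<open>Discrete Schroedinger operators and their spectra\<close>

text \<open>
  The one-based indexing \<open>n = j k + l\<close> with \<open>1 \<le> l \<le> k\<close> gives \<open>j = (n - 1) div k\<close>;
  the \<open>l\<close>-th element of \<open>'k\<close> is the entry at list position \<open>l - 1 = (n - 1) mod k\<close>.
\<close>

definition interleave :: "(int \<Rightarrow> real ^ 'k::{finite,linorder}) \<Rightarrow> int \<Rightarrow> real" where
  "interleave y n = y ((n - 1) div int CARD('k)) $
     (sorted_list_of_set (UNIV :: 'k set) ! nat ((n - 1) mod int CARD('k)))"

lemma interleave_nth:
  fixes y :: "int \<Rightarrow> real ^ 'k::{finite,linorder}"
  assumes "1 \<le> l" "l \<le> CARD('k)"
  shows "interleave y (j * int CARD('k) + int l) = y j $ (sorted_list_of_set UNIV ! (l - 1))"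
proof -
  let ?k = "int CARD('k)"
  have eq: "j * ?k + int l - 1 = int (l - 1) + j * ?k" using assms by simp
  have "int (l - 1) div ?k = 0" "int (l - 1) mod ?k = int (l - 1)" "?k \<noteq> 0"
    using assms by (auto intro: div_pos_pos_trivial mod_pos_pos_trivial)
  then have "(j * ?k + int l - 1) div ?k = j" "(j * ?k + int l - 1) mod ?k = int (l - 1)"
    unfolding eq by simp_all
  then show ?thesis by (simp add: interleave_def)
qed

definition schroedinger :: "(int \<Rightarrow> real) \<Rightarrow> (int \<Rightarrow> complex) \<Rightarrow> int \<Rightarrow> complex" where
  "schroedinger V \<psi> n = \<psi> (n - 1) + \<psi> (n + 1) + of_real (V n) * \<psi> n"

definition ell2 :: "(int \<Rightarrow> complex) set" where
  "ell2 = {\<psi>. (\<lambda>n. (cmod (\<psi> n))\<^sup>2) summable_on UNIV}"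

definition ell2_norm :: "(int \<Rightarrow> complex) \<Rightarrow> real" where
  "ell2_norm \<psi> = sqrt (\<Sum>\<^sub>\<infinity>n. (cmod (\<psi> n))\<^sup>2)"

definition bounded_op_ell2 :: "((int \<Rightarrow> complex) \<Rightarrow> int \<Rightarrow> complex) \<Rightarrow> bool" where
  "bounded_op_ell2 R \<longleftrightarrow>
     (\<forall>\<psi>\<in>ell2. R \<psi> \<in> ell2) \<and>
     (\<forall>\<psi>\<in>ell2. \<forall>\<phi>\<in>ell2. R (\<lambda>n. \<psi> n + \<phi> n) = (\<lambda>n. R \<psi> n + R \<phi> n)) \<and>
     (\<forall>c. \<forall>\<psi>\<in>ell2. R (\<lambda>n. c * \<psi> n) = (\<lambda>n. c * R \<psi> n)) \<and>
     (\<exists>C. \<forall>\<psi>\<in>ell2. ell2_norm (R \<psi>) \<le> C * ell2_norm \<psi>)"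

text \<open>The spectrum of a bounded operator on \<open>\<ell>\<^sup>2(\<int>)\<close>: those \<open>z\<close> for which \<open>A - z\<close> has no
  bounded two-sided inverse on \<open>\<ell>\<^sup>2(\<int>)\<close>.\<close>

definition op_spectrum :: "((int \<Rightarrow> complex) \<Rightarrow> int \<Rightarrow> complex) \<Rightarrow> complex set" where
  "op_spectrum A = {z. \<not> (\<exists>R. bounded_op_ell2 R \<and>
     (\<forall>\<psi>\<in>ell2. R (\<lambda>n. A \<psi> n - z * \<psi> n) = \<psi> \<and> (\<lambda>n. A (R \<psi>) n - z * R \<psi> n) = \<psi>))}"

definition spec_H :: "(int \<Rightarrow> real ^ 'k::{finite,linorder}) \<Rightarrow> complex set" where
  "spec_H y = op_spectrum (schroedinger (interleave y))"

section \<open>Gap-rich sets\<close>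

definition gap_rich_with ::
    "(real ^ 'k::{finite,linorder} \<Rightarrow> real) \<Rightarrow> (real ^ 'k::{finite,linorder}) set \<Rightarrow> real set \<Rightarrow> bool" where
  "gap_rich_with N Y S \<longleftrightarrow>
     closed Y \<and> (\<forall>v\<in>Y. \<not> v isolated_in Y) \<and> discrete S \<and>
     (\<forall>E. E \<notin> S \<longrightarrow> (\<forall>x\<in>words Y. \<forall>\<epsilon>>0. \<exists>y\<in>words Y.
        word_dist N Y x y < \<epsilon> \<and> complex_of_real E \<notin> spec_H (periodize y)))"

definition gap_rich :: "(real ^ 'k::{finite,linorder} \<Rightarrow> real) \<Rightarrow> (real ^ 'k::{finite,linorder}) set \<Rightarrow> bool" where
  "gap_rich N Y \<longleftrightarrow> (\<exists>S. gap_rich_with N Y S)"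

section \<open>Cantor sets and Hausdorff dimension\<close>

definition cantor_set :: "real set \<Rightarrow> bool" where
  "cantor_set K \<longleftrightarrow> K \<noteq> {} \<and> compact K \<and> (\<forall>x\<in>K. \<not> x isolated_in K) \<and> interior K = {}"

text \<open>The size \<open>(diam U)\<^sup>s\<close>, with \<open>(diam U)\<^sup>0 = 1\<close> for nonempty \<open>U\<close> (\<^term>\<open>0 powr 0 = (0::real)\<close>
  would not give this) and value \<open>0\<close> for the empty set.\<close>

definition diam_pow :: "real \<Rightarrow> 'a::metric_space set \<Rightarrow> ennreal" where
  "diam_pow s U = (if U = {} then 0 else if s = 0 then 1 else ennreal (diameter U powr s))"

definition hausdorff_premeasure :: "real \<Rightarrow> real \<Rightarrow> 'a::metric_space set \<Rightarrow> ennreal" where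
  "hausdorff_premeasure s \<delta> A =
     (INF U \<in> {U :: nat \<Rightarrow> 'a set. A \<subseteq> (\<Union>i. U i) \<and> (\<forall>i. bounded (U i) \<and> diameter (U i) \<le> \<delta>)}.
        \<Sum>i. diam_pow s (U i))"

definition hausdorff_measure :: "real \<Rightarrow> 'a::metric_space set \<Rightarrow> ennreal" where
  "hausdorff_measure s A = (SUP \<delta>\<in>{0<..}. hausdorff_premeasure s \<delta> A)"

definition hausdorff_dim :: "'a::metric_space set \<Rightarrow> ennreal" where
  "hausdorff_dim A = (INF s\<in>{s. 0 \<le> s \<and> hausdorff_measure s A = 0}. ennreal s)"

end

(* A bounded discrete Schroedinger operator is symmetric, so its spectrum consists of the real E for
   which H - E is not bounded below, and an approximate eigenvector with relative error theta puts a
   spectral point within theta of E. All spectral estimates come from these two facts.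

   Genericity: for s, eps > 0 the set of y whose spectrum has a countable cover by intervals with
   sum of radius^s < eps is open, and it suffices to show that it is dense; then Baire's theorem
   applies. Given a periodic x, cover the countable exceptional set by tiny intervals. The remaining
   energies in the relevant compact interval are covered by gaps of finitely many periodic
   perturbations y_1, ..., y_m of x. Let z repeat the concatenation of y_1, ..., y_m, each on a block
   of length l. If E lies in a gap of y_i, generalised eigenfunctions of z at E are exponentially
   small in the middle of each y_i-block (a Combes-Thomas estimate), so cutting the chain there
   moves E by at most exp(-c l). The cut operator is a direct sum of copies of one finite matrix of
   size m l, so the spectrum of z outside the exceptional intervals lies in O(l) intervals of
   exponentially small length.

   Isolated points: an isolated E would be an eigenvalue with eigenvector psi. Translates of psi by
   almost periods are nearly eigenvectors, hence close to multiples of psi, since the eigenspace is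
   one-dimensional; so psi would not decay. *)

theory Submission
  imports Defs "HOL-Computational_Algebra.Polynomial" "HOL-Real_Asymp.Real_Asymp"
begin

section \<open>Symmetric operators on real Hilbert spaces\<close>

text \<open>The order of choices makes the density argument close. Removing open exceptional
  intervals from a bounded energy range leaves a compact set, so finitely many words and one common
  lower bound \<open>\<eta>\<close> suffice before the repetition number \<open>L\<close> is chosen;
  the number of words, their common period and the decay rate stay fixed as \<open>L\<close> grows.
  Enlarging \<open>L\<close> lets exponential decay beat two polynomial losses: the number of
  eigenvalues of the cut pieces, and the overlap of the windows over which local estimates are
  summed. Cuts are made only in blocks whose gap contains the energy, one per full period, so their
  places depend on the energy only through the index of a word.

  An approximate eigenvector spreads over infinitely many blocks, and at a cut it is small only
  relative to its mass near that cut. Hence the bounded weights living on a window and the square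
  sums over all windows, instead of pointwise decay of a solution. Complex sequences are treated as
  a real Hilbert space on which multiplication by a complex number is an operator.\<close>

definition approx_spec :: "('a::real_normed_vector \<Rightarrow> 'a) \<Rightarrow> real set" where
  "approx_spec T = {E. \<forall>\<epsilon>>0. \<exists>x. x \<noteq> 0 \<and> norm (T x - E *\<^sub>R x) \<le> \<epsilon> * norm x}"

lemma not_approx_spec_iff:
  "E \<notin> approx_spec T \<longleftrightarrow> (\<exists>c>0. \<forall>x. c * norm x \<le> norm (T x - E *\<^sub>R x))"
proof
  assume "E \<notin> approx_spec T"
  then obtain \<epsilon> where "\<epsilon> > 0" "\<And>x. x \<noteq> 0 \<Longrightarrow> \<epsilon> * norm x < norm (T x - E *\<^sub>R x)"
    unfolding approx_spec_def by force
  then have "\<epsilon> * norm x \<le> norm (T x - E *\<^sub>R x)" for x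
    by (cases "x = 0") (auto intro: less_imp_le)
  with \<open>\<epsilon> > 0\<close> show "\<exists>c>0. \<forall>x. c * norm x \<le> norm (T x - E *\<^sub>R x)" by blast
next
  assume "\<exists>c>0. \<forall>x. c * norm x \<le> norm (T x - E *\<^sub>R x)"
  then obtain c where c: "c > 0" "\<And>x. c * norm x \<le> norm (T x - E *\<^sub>R x)" by blast
  show "E \<notin> approx_spec T"
  proof
    assume "E \<in> approx_spec T"
    then obtain x where "x \<noteq> 0" "norm (T x - E *\<^sub>R x) \<le> (c/2) * norm x"
      using c(1) unfolding approx_spec_def by (auto dest: spec[of _ "c/2"])
    with c(2)[of x] have "c * norm x \<le> (c/2) * norm x" by linarith
    with \<open>x \<noteq> 0\<close> c(1) show False by simp
  qed
qed

lemma bounded_linear_shift: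
  "bounded_linear T \<Longrightarrow> bounded_linear (\<lambda>x. T x - E *\<^sub>R x)"
  by (intro bounded_linear_sub bounded_linear_scaleR_right)

lemma closed_approx_spec: "closed (approx_spec T)"
proof -
  have "\<exists>e>0. ball E e \<subseteq> - approx_spec T" if E: "E \<notin> approx_spec T" for E
  proof -
    obtain c where c: "c > 0" "\<And>x. c * norm x \<le> norm (T x - E *\<^sub>R x)"
      using E by (auto simp: not_approx_spec_iff)
    have "E' \<notin> approx_spec T" if "\<bar>E - E'\<bar> < c / 2" for E'
    proof -
      have "c / 2 * norm x \<le> norm (T x - E' *\<^sub>R x)" for x
      proof -
        have "T x - E *\<^sub>R x = (T x - E' *\<^sub>R x) - (E - E') *\<^sub>R x"
          by (simp add: algebra_simps)
        then have "norm (T x - E *\<^sub>R x) \<le> norm (T x - E' *\<^sub>R x) + \<bar>E - E'\<bar> * norm x"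
          by (metis norm_triangle_ineq4 norm_scaleR)
        moreover have "\<bar>E - E'\<bar> * norm x \<le> c / 2 * norm x"
          using that by (intro mult_right_mono) auto
        ultimately show ?thesis using c(2)[of x] by (simp add: field_simps)
      qed
      with c(1) show ?thesis unfolding not_approx_spec_iff by (meson half_gt_zero)
    qed
    then have "ball E (c/2) \<subseteq> - approx_spec T" by (auto simp: dist_real_def)
    with c(1) show ?thesis by (meson half_gt_zero)
  qed
  then show ?thesis unfolding closed_def open_contains_ball by blast
qed

lemma approx_spec_norm_le:
  assumes T: "\<And>x. norm (T x) \<le> K * norm x" and E: "E \<in> approx_spec T"
  shows "\<bar>E\<bar> \<le> K"
proof (rule field_le_epsilon)
  fix e :: real assume "e > 0"
  then obtain x where x: "x \<noteq> 0" "norm (T x - E *\<^sub>R x) \<le> e * norm x"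
    using E unfolding approx_spec_def by blast
  have "\<bar>E\<bar> * norm x = norm (T x - (T x - E *\<^sub>R x))" by simp
  also have "\<dots> \<le> K * norm x + e * norm x"
    using norm_triangle_ineq4[of "T x" "T x - E *\<^sub>R x"] T[of x] x(2) by linarith
  finally show "\<bar>E\<bar> \<le> K + e" using x(1) by (simp flip: distrib_right)
qed

lemma compact_approx_spec:
  assumes "bounded_linear T"
  shows "compact (approx_spec T)"
proof -
  obtain K where K: "\<And>x. norm (T x) \<le> norm x * K"
    using bounded_linear.bounded[OF assms] by blast
  have "\<bar>E\<bar> \<le> K" if "E \<in> approx_spec T" for E
    using approx_spec_norm_le[OF _ that] K by (simp add: mult.commute)
  then have "bounded (approx_spec T)" by (auto simp: bounded_iff)
  then show ?thesis using closed_approx_spec compact_eq_bounded_closed by blast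
qed

lemma norm_add_scaleR_square:
  fixes x y :: "'a::real_inner"
  shows "(norm (x + t *\<^sub>R y))\<^sup>2 = (norm x)\<^sup>2 + 2 * t * (x \<bullet> y) + t\<^sup>2 * (norm y)\<^sup>2"
  unfolding power2_norm_eq_inner
  by (simp add: inner_add_left inner_add_right inner_commute[of y x] algebra_simps power2_eq_square)

lemma norm_diff_scaleR_square:
  fixes x y :: "'a::real_inner"
  shows "(norm (x - t *\<^sub>R y))\<^sup>2 = (norm x)\<^sup>2 - 2 * t * (x \<bullet> y) + t\<^sup>2 * (norm y)\<^sup>2"
  using norm_add_scaleR_square[of x "- t" y] by simp

text \<open>Expand the nonnegative quantity \<open>P (x - t P x) \<bullet> (x - t P x)\<close> with \<open>t = 1 / K\<close>.\<close>

lemma norm_square_le_form: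
  fixes P :: "'a::real_inner \<Rightarrow> 'a"
  assumes P: "linear P" and sym: "\<And>x y. P x \<bullet> y = x \<bullet> P y" and pos: "\<And>x. 0 \<le> P x \<bullet> x"
    and K: "\<And>x. norm (P x) \<le> K * norm x" "K > 0"
  shows "(norm (P x))\<^sup>2 \<le> K * (P x \<bullet> x)"
proof -
  let ?t = "1 / K"
  have "0 \<le> P (x - ?t *\<^sub>R P x) \<bullet> (x - ?t *\<^sub>R P x)" by (rule pos)
  also have "\<dots> = P x \<bullet> x - 2 * ?t * (norm (P x))\<^sup>2 + ?t\<^sup>2 * (P (P x) \<bullet> P x)"
  proof -
    have lin: "P (x - ?t *\<^sub>R P x) = P x - ?t *\<^sub>R P (P x)"
      by (simp add: linear_diff[OF P] linear_scale[OF P])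
    have "P (P x) \<bullet> x = (norm (P x))\<^sup>2" "P x \<bullet> P x = (norm (P x))\<^sup>2"
      unfolding power2_norm_eq_inner by (simp_all only: sym)
    then show ?thesis
      unfolding lin by (simp add: inner_diff_left inner_diff_right power2_eq_square algebra_simps)
  qed
  also have "P (P x) \<bullet> P x \<le> K * (norm (P x))\<^sup>2"
  proof -
    have "P (P x) \<bullet> P x \<le> norm (P (P x)) * norm (P x)" by (rule norm_cauchy_schwarz)
    also have "\<dots> \<le> K * norm (P x) * norm (P x)" by (intro mult_right_mono K) simp
    finally show ?thesis by (simp add: power2_eq_square algebra_simps)
  qed
  finally have "0 \<le> P x \<bullet> x - 2 * ?t * (norm (P x))\<^sup>2 + ?t\<^sup>2 * (K * (norm (P x))\<^sup>2)"
    by (simp add: mult_left_mono)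
  also have "\<dots> = P x \<bullet> x - ?t * (norm (P x))\<^sup>2"
    using K(2) by (simp add: power2_eq_square field_simps)
  finally show ?thesis using K(2) by (simp add: field_simps)
qed

text \<open>With \<open>B = T - E\<close> and \<open>m\<close> the lower bound of \<open>B\<close>, the operator \<open>B\<^sup>2 - m\<^sup>2 = (B - m) (B + m)\<close> is
  nonnegative with vanishing lower bound, so one of the two factors has vanishing lower bound.\<close>

lemma approx_spec_near:
  fixes T :: "'a::real_inner \<Rightarrow> 'a"
  assumes T: "bounded_linear T" and sym: "\<And>x y. T x \<bullet> y = x \<bullet> T y"
    and x: "x \<noteq> 0" "norm (T x - E *\<^sub>R x) \<le> \<theta> * norm x"
  obtains E' where "E' \<in> approx_spec T" "\<bar>E - E'\<bar> \<le> \<theta>"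
proof -
  define B where "B = (\<lambda>x. T x - E *\<^sub>R x)"
  have B: "bounded_linear B" unfolding B_def by (rule bounded_linear_shift[OF T])
  have Bsym: "B x \<bullet> y = x \<bullet> B y" for x y
    by (simp add: B_def inner_diff_left inner_diff_right sym)
  define Q where "Q = (\<lambda>x. norm (B x) / norm x) ` (- {0})"
  define m where "m = Inf Q"
  have Q: "Q \<noteq> {}" "bdd_below Q" using x(1) by (auto simp: Q_def intro!: bdd_belowI[of _ 0])
  have m0: "0 \<le> m" unfolding m_def using Q by (intro cInf_greatest) (auto simp: Q_def)
  have mB: "m * norm y \<le> norm (B y)" for y
  proof (cases "y = 0")
    case False
    then have "m \<le> norm (B y) / norm y"
      unfolding m_def using Q by (intro cInf_lower) (auto simp: Q_def)
    with False show ?thesis by (simp add: field_simps)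
  qed simp
  have "m \<le> norm (B x) / norm x"
    unfolding m_def using Q x by (intro cInf_lower) (auto simp: Q_def)
  also have "\<dots> \<le> \<theta>" using x by (simp add: B_def field_simps)
  finally have m\<theta>: "m \<le> \<theta>" .
  define P where "P = (\<lambda>x. B (B x) - (m\<^sup>2) *\<^sub>R x)"
  have P: "bounded_linear P" unfolding P_def
    by (rule bounded_linear_shift[OF bounded_linear_compose[OF B B, unfolded o_def]])
  have linB: "B (x + y) = B x + B y" "B (x - y) = B x - B y" "B (c *\<^sub>R x) = c *\<^sub>R B x" for x y c
    using B by (simp_all add: linear_simps)
  have Psym: "P x \<bullet> y = x \<bullet> P y" for x y
    by (simp add: P_def inner_diff_left inner_diff_right Bsym)
  have Pform: "P x \<bullet> x = (norm (B x))\<^sup>2 - m\<^sup>2 * (norm x)\<^sup>2" for x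
    by (simp add: P_def inner_diff_left Bsym power2_norm_eq_inner)
  have Ppos: "0 \<le> P x \<bullet> x" for x
    unfolding Pform using power_mono[OF mB, of x 2] m0 by (simp add: power_mult_distrib)
  obtain K where K: "K > 0" "\<And>x. norm (P x) \<le> K * norm x"
    using bounded_linear.pos_bounded[OF P] by (metis mult.commute)
  \<comment> \<open>The infimum \<open>m\<close> is nearly attained, which makes only the form of
    \<open>P\<close> small; \<open>norm_square_le_form\<close> turns this into smallness of
    \<open>P y\<close> itself.\<close>
  have small: "\<exists>y. y \<noteq> 0 \<and> norm (P y) < \<epsilon> * norm y" if "\<epsilon> > 0" for \<epsilon>
  proof -
    have "m < sqrt (m\<^sup>2 + \<epsilon>\<^sup>2 / K)"
      using that K(1) m0 by (intro real_less_rsqrt) simp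
    then obtain y where y: "y \<noteq> 0" "norm (B y) / norm y < sqrt (m\<^sup>2 + \<epsilon>\<^sup>2 / K)"
      using cInf_lessD[OF Q(1), of "sqrt (m\<^sup>2 + \<epsilon>\<^sup>2 / K)"] unfolding m_def[symmetric]
      by (auto simp: Q_def)
    then have "(norm (B y) / norm y)\<^sup>2 < m\<^sup>2 + \<epsilon>\<^sup>2 / K"
      by (smt (verit) divide_nonneg_nonneg norm_ge_zero real_less_lsqrt real_less_rsqrt
          real_sqrt_less_iff real_sqrt_abs abs_of_nonneg)
    then have "P y \<bullet> y < \<epsilon>\<^sup>2 / K * (norm y)\<^sup>2"
      using y(1) unfolding Pform by (simp add: field_simps power_divide)
    then have "K * (P y \<bullet> y) < (\<epsilon> * norm y)\<^sup>2"
      using K(1) by (simp add: field_simps power_mult_distrib)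
    moreover have "(norm (P y))\<^sup>2 \<le> K * (P y \<bullet> y)"
      by (rule norm_square_le_form[OF bounded_linear.linear[OF P] Psym Ppos K(2,1)])
    ultimately have "(norm (P y))\<^sup>2 < (\<epsilon> * norm y)\<^sup>2" by linarith
    then have "norm (P y) < \<epsilon> * norm y"
      by (rule power_less_imp_less_base) (use that in simp)
    with y(1) show ?thesis by blast
  qed
  have "E + m \<in> approx_spec T \<or> E - m \<in> approx_spec T"
  proof (rule ccontr)
    assume "\<not> ?thesis"
    then obtain c1 c2 where c: "c1 > 0" "c2 > 0"
      "\<And>x. c1 * norm x \<le> norm (T x - (E + m) *\<^sub>R x)" "\<And>x. c2 * norm x \<le> norm (T x - (E - m) *\<^sub>R x)"
      by (auto simp: not_approx_spec_iff)
    obtain y where y: "y \<noteq> 0" "norm (P y) < (c1 * c2) * norm y"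
      using small[of "c1 * c2"] c by auto
    let ?z = "T y - (E - m) *\<^sub>R y"
    have "P y = T ?z - (E + m) *\<^sub>R ?z"
      using linB(2)[of "B y" "- (m *\<^sub>R y)"] T
      by (simp add: P_def B_def linear_simps algebra_simps power2_eq_square)
    then have "norm (P y) \<ge> c1 * norm ?z" using c(3)[of ?z] by simp
    moreover have "c1 * norm ?z \<ge> c1 * (c2 * norm y)" using c by (intro mult_left_mono) auto
    ultimately show False using y(2) by simp
  qed
  then show ?thesis using that m\<theta> m0 by (auto intro: that[of "E + m"] that[of "E - m"])
qed

lemma approx_spec_nonempty:
  fixes T :: "'a::real_inner \<Rightarrow> 'a"
  assumes T: "bounded_linear T" and "\<And>x y. T x \<bullet> y = x \<bullet> T y" and x: "(x::'a) \<noteq> 0"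
  shows "approx_spec T \<noteq> {}"
proof -
  have "norm (T x - 0 *\<^sub>R x) \<le> (norm (T x) / norm x) * norm x" using x by simp
  from approx_spec_near[OF T assms(2) x this] show ?thesis by blast
qed

text \<open>The spectral distance at \<open>E \<plusminus> r\<close> bounds the form of \<open>B = T - E\<close> by \<open>\<parallel>B x\<parallel>\<^sup>2 / 2 r\<close>; polarising
  this bound at \<open>x\<close> and \<open>B x\<close> shows that \<open>B\<close> is bounded below on its range.\<close>

lemma isolated_approx_spec_bound:
  fixes T :: "'a::real_inner \<Rightarrow> 'a"
  assumes T: "bounded_linear T" and sym: "\<And>x y. T x \<bullet> y = x \<bullet> T y"
    and r: "r > 0" and iso: "approx_spec T \<inter> {E - 2 * r<..<E + 2 * r} \<subseteq> {E}"
  defines "B \<equiv> \<lambda>x. T x - E *\<^sub>R x"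
  shows "2 * r * norm (B x) \<le> norm (B (B x))"
proof -
  have B: "bounded_linear B" unfolding B_def by (rule bounded_linear_shift[OF T])
  have Bsym: "B x \<bullet> y = x \<bullet> B y" for x y
    by (simp add: B_def inner_diff_left inner_diff_right sym)
  \<comment> \<open>A smaller value would put a spectral point at distance less than
    \<open>r\<close> from \<open>E + s\<close>, hence within \<open>2 * r\<close> of
    \<open>E\<close> but different from \<open>E\<close>.\<close>
  have near: "r * norm x \<le> norm (B x - s *\<^sub>R x)" if "\<bar>s\<bar> = r" for x s
  proof (rule ccontr)
    assume *: "\<not> ?thesis"
    then have x: "x \<noteq> 0" by (auto simp: linear_simps(3)[OF B])
    define \<theta> where "\<theta> = norm (B x - s *\<^sub>R x) / norm x"
    have "\<theta> < r" using * x by (simp add: \<theta>_def field_simps)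
    have "norm (T x - (E + s) *\<^sub>R x) \<le> \<theta> * norm x"
      using x by (simp add: \<theta>_def B_def algebra_simps)
    then obtain E' where E': "E' \<in> approx_spec T" "\<bar>E + s - E'\<bar> \<le> \<theta>"
      using approx_spec_near[OF T sym x] by metis
    then have "E' \<in> approx_spec T \<inter> {E - 2 * r<..<E + 2 * r}" "E' \<noteq> E"
      using \<open>\<theta> < r\<close> that by auto
    then show False using iso by blast
  qed
  have form: "\<bar>2 * r * (B x \<bullet> x)\<bar> \<le> (norm (B x))\<^sup>2" for x
  proof -
    have "0 \<le> (norm (B x))\<^sup>2 - 2 * s * (B x \<bullet> x)" if "\<bar>s\<bar> = r" for s
    proof -
      have "s\<^sup>2 * (norm x)\<^sup>2 \<le> (norm (B x - s *\<^sub>R x))\<^sup>2"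
        using power_mono[OF near[OF that, of x], of 2] r that
        by (simp add: power_mult_distrib) (metis power2_abs)
      also have "\<dots> = (norm (B x))\<^sup>2 - 2 * s * (B x \<bullet> x) + s\<^sup>2 * (norm x)\<^sup>2"
        by (simp add: norm_diff_scaleR_square)
      finally show ?thesis by simp
    qed
    from this[of r] this[of "- r"] r show ?thesis by simp
  qed
  have pol: "4 * r * t * (norm (B x))\<^sup>2 \<le> (norm (B x))\<^sup>2 + t\<^sup>2 * (norm (B (B x)))\<^sup>2" if "t > 0" for t
  proof -
    let ?y = "t *\<^sub>R B x"
    have lin: "B (x + ?y) = B x + t *\<^sub>R B (B x)" "B (x - ?y) = B x - t *\<^sub>R B (B x)"
      using B by (simp_all add: linear_simps)
    have "B (x + ?y) \<bullet> (x + ?y) - B (x - ?y) \<bullet> (x - ?y) = 4 * t * (norm (B x))\<^sup>2"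
      unfolding lin by (simp add: inner_add inner_diff power2_norm_eq_inner algebra_simps
          inner_commute Bsym)
    moreover have "(norm (B (x + ?y)))\<^sup>2 + (norm (B (x - ?y)))\<^sup>2
        = 2 * (norm (B x))\<^sup>2 + 2 * t\<^sup>2 * (norm (B (B x)))\<^sup>2"
      unfolding lin norm_add_scaleR_square norm_diff_scaleR_square by simp
    ultimately have "2 * r * (4 * t * (norm (B x))\<^sup>2)
        \<le> 2 * (norm (B x))\<^sup>2 + 2 * t\<^sup>2 * (norm (B (B x)))\<^sup>2"
      using form[of "x + ?y"] form[of "x - ?y"] by (smt (verit) right_diff_distrib)
    then show ?thesis by simp
  qed
  define u v where "u = norm (B x)" and "v = norm (B (B x))"
  have uv: "u \<ge> 0" "v \<ge> 0" by (simp_all add: u_def v_def)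
  have pol': "4 * r * t * u\<^sup>2 \<le> u\<^sup>2 + t\<^sup>2 * v\<^sup>2" if "t > 0" for t
    using pol[OF that] by (simp add: u_def v_def)
  have "2 * r * u \<le> v"
  proof (rule ccontr)
    assume "\<not> ?thesis"
    then have lt: "v < 2 * r * u" by simp
    then have u: "u > 0" using uv r by (cases "u = 0") auto
    \<comment> \<open>The value \<open>t = 1 / (2 * r)\<close> maximises
      \<open>(4 * r * t - 1) / t\<^sup>2\<close> and so extracts the best constant from
      \<open>pol'\<close>.\<close>
    have "4 * r * (1 / (2 * r)) * u\<^sup>2 \<le> u\<^sup>2 + (1 / (2 * r))\<^sup>2 * v\<^sup>2" using r by (intro pol') simp
    then have "(2 * r * u)\<^sup>2 \<le> v\<^sup>2"
      using r by (simp add: power_mult_distrib field_simps power2_eq_square)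
    then have "2 * r * u \<le> v" using uv by (rule_tac power2_le_imp_le) auto
    with lt show False by simp
  qed
  then show ?thesis by (simp add: u_def v_def)
qed

text \<open>The iteration \<open>x \<mapsto> x - c B (B x)\<close> contracts \<open>B x\<close> geometrically and so converges to
  an element of the kernel.\<close>

lemma kernel_near:
  fixes B :: "'a::{real_inner,banach} \<Rightarrow> 'a"
  assumes B: "bounded_linear B" and sym: "\<And>x y. B x \<bullet> y = x \<bullet> B y"
    and \<rho>: "\<rho> > 0" "\<And>x. \<rho> * norm (B x) \<le> norm (B (B x))"
  obtains C where "C > 0" "\<And>x. \<exists>y. B y = 0 \<and> norm (x - y) \<le> C * norm (B x)"
proof -
  obtain K0 where K0: "K0 > 0" "\<And>x. norm (B x) \<le> norm x * K0"
    using bounded_linear.pos_bounded[OF B] by blast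
  \<comment> \<open>Taking \<open>K\<close> at least \<open>\<rho>\<close> keeps
    \<open>1 - c * \<rho>\<^sup>2\<close> nonnegative, and \<open>c = 1 / K\<^sup>2\<close> makes
    the quadratic term of the expansion in \<open>step\<close> cost at most half of the negative
    cross term.\<close>
  define K where "K = max K0 \<rho>"
  have K: "K > 0" "\<And>x. norm (B x) \<le> K * norm x" "\<rho> \<le> K"
    using K0 by (auto simp: K_def intro!: order_trans[OF K0(2)]) 
      (metis max.cobounded1 mult.commute mult_right_mono norm_ge_zero)
  define c where "c = 1 / K\<^sup>2"
  define q where "q = sqrt (1 - c * \<rho>\<^sup>2)"
  have c: "c > 0" using K by (simp add: c_def)
  have c\<rho>: "c * \<rho>\<^sup>2 \<le> 1" using K \<rho> by (simp add: c_def power_mono divide_le_eq)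
  have q: "0 \<le> q" "q < 1" using c c\<rho> \<rho> by (auto simp: q_def)
  have step: "norm (B (x - c *\<^sub>R B (B x))) \<le> q * norm (B x)" for x
  proof -
    have "(norm (B (x - c *\<^sub>R B (B x))))\<^sup>2
        = (norm (B x))\<^sup>2 - 2 * c * (norm (B (B x)))\<^sup>2 + c\<^sup>2 * (norm (B (B (B x))))\<^sup>2"
    proof -
      have "B x \<bullet> B (B (B x)) = (norm (B (B x)))\<^sup>2"
        unfolding power2_norm_eq_inner by (simp only: sym)
      moreover have "B (x - c *\<^sub>R B (B x)) = B x - c *\<^sub>R B (B (B x))"
        using B by (simp add: linear_simps)
      ultimately show ?thesis by (simp add: norm_diff_scaleR_square)
    qed
    also have "c\<^sup>2 * (norm (B (B (B x))))\<^sup>2 \<le> c\<^sup>2 * (K\<^sup>2 * (norm (B (B x)))\<^sup>2)"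
      using power_mono[OF K(2)[of "B (B x)"], of 2] by (simp add: power_mult_distrib mult_left_mono)
    also have "\<dots> = c * (norm (B (B x)))\<^sup>2" using K by (simp add: c_def power2_eq_square)
    finally have "(norm (B (x - c *\<^sub>R B (B x))))\<^sup>2 \<le> (norm (B x))\<^sup>2 - c * (norm (B (B x)))\<^sup>2"
      by simp
    also have "\<dots> \<le> (norm (B x))\<^sup>2 - c * (\<rho> * norm (B x))\<^sup>2"
      using c \<rho> by (simp add: power_mono)
    also have "\<dots> = (q * norm (B x))\<^sup>2"
      using c\<rho> by (simp add: q_def power_mult_distrib algebra_simps)
    finally show ?thesis using q by (rule_tac power2_le_imp_le) auto
  qed
  define C where "C = c * K / (1 - q)"
  have "C > 0" using c K q by (simp add: C_def)
  moreover have "\<exists>y. B y = 0 \<and> norm (x - y) \<le> C * norm (B x)" for x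
  proof -
    define X where "X n = ((\<lambda>x. x - c *\<^sub>R B (B x)) ^^ n) x" for n
    have X: "X 0 = x" "X (Suc n) = X n - c *\<^sub>R B (B (X n))" for n by (simp_all add: X_def)
    have BX: "norm (B (X n)) \<le> q ^ n * norm (B x)" for n
    proof (induction n)
      case (Suc n)
      have "norm (B (X (Suc n))) \<le> q * norm (B (X n))" unfolding X by (rule step)
      also have "\<dots> \<le> q * (q ^ n * norm (B x))" using Suc q by (intro mult_left_mono)
      finally show ?case by simp
    qed (simp add: X)
    define f where "f n = c *\<^sub>R B (B (X n))" for n
    have f: "norm (f n) \<le> (c * K * norm (B x)) * q ^ n" for n
    proof -
      have "norm (f n) = c * norm (B (B (X n)))" using c by (simp add: f_def)
      also have "\<dots> \<le> c * (K * (q ^ n * norm (B x)))"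
        using c K(1) by (intro mult_left_mono order_trans[OF K(2)] BX) auto
      finally show ?thesis by (simp add: algebra_simps)
    qed
    have geo: "summable (\<lambda>n. (c * K * norm (B x)) * q ^ n)"
      using q by (intro summable_mult summable_geometric) simp
    have sf: "summable f" using f by (intro summable_comparison_test[OF _ geo]) auto
    have Xs: "X n = x - (\<Sum>i<n. f i)" for n by (induction n) (simp_all add: X f_def)
    define y where "y = x - suminf f"
    have Xy: "X \<longlonglongrightarrow> y" unfolding Xs y_def
      by (intro tendsto_intros summable_LIMSEQ sf)
    have "(\<lambda>n. B (X n)) \<longlonglongrightarrow> B y" by (rule bounded_linear.tendsto[OF B Xy])
    moreover have "(\<lambda>n. B (X n)) \<longlonglongrightarrow> 0"
    proof (rule Lim_null_comparison)
      show "\<forall>\<^sub>F n in sequentially. norm (B (X n)) \<le> q ^ n * norm (B x)" using BX by simp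
      show "(\<lambda>n. q ^ n * norm (B x)) \<longlonglongrightarrow> 0"
        using q by (intro tendsto_mult_left_zero LIMSEQ_power_zero) simp
    qed
    ultimately have "B y = 0" using LIMSEQ_unique by blast
    have "norm (x - y) = norm (suminf f)" by (simp add: y_def)
    also have "\<dots> \<le> (\<Sum>n. (c * K * norm (B x)) * q ^ n)"
      by (rule norm_suminf_le[OF f geo])
    also have "\<dots> = (c * K * norm (B x)) * (1 / (1 - q))"
      using q by (subst suminf_mult) (auto simp: suminf_geometric)
    also have "\<dots> = C * norm (B x)" by (simp add: C_def)
    finally show ?thesis using \<open>B y = 0\<close> by blast
  qed
  ultimately show ?thesis using that by blast
qed

text \<open>A Lax-Milgram argument: the relaxation \<open>x - t *\<^sub>R (T x - f)\<close> is a
  contraction, and its fixed point solves the equation. The step \<open>t = c / K\<^sup>2\<close>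
  minimises the bound \<open>1 - 2 * t * c + t\<^sup>2 * K\<^sup>2\<close>.\<close>

lemma coercive_surj:
  fixes T :: "'a::{real_inner,banach} \<Rightarrow> 'a"
  assumes T: "bounded_linear T" and c: "c > 0" "\<And>x. c * (norm x)\<^sup>2 \<le> T x \<bullet> x"
  obtains x where "T x = f"
proof -
  obtain K0 where K0: "K0 > 0" "\<And>x. norm (T x) \<le> norm x * K0"
    using bounded_linear.pos_bounded[OF T] by blast
  define K where "K = max K0 c"
  have K: "K > 0" "norm (T x) \<le> K * norm x" "c \<le> K" for x
    using K0 by (auto simp: K_def intro!: order_trans[OF K0(2)]) 
      (metis max.cobounded1 mult.commute mult_right_mono norm_ge_zero)
  define t where "t = c / K\<^sup>2"
  have t: "t > 0" using c K by (simp add: t_def)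
  define q where "q = sqrt (1 - c\<^sup>2 / K\<^sup>2)"
  have cK: "c\<^sup>2 / K\<^sup>2 \<le> 1" using K c by (simp add: power_mono divide_le_eq)
  have q: "0 \<le> q" "q < 1" using cK c K by (auto simp: q_def)
  have con: "norm (x - t *\<^sub>R T x) \<le> q * norm x" for x
  proof -
    have "(norm (x - t *\<^sub>R T x))\<^sup>2 = (norm x)\<^sup>2 - 2 * t * (T x \<bullet> x) + t\<^sup>2 * (norm (T x))\<^sup>2"
      by (simp add: norm_diff_scaleR_square inner_commute)
    also have "\<dots> \<le> (norm x)\<^sup>2 - 2 * t * (c * (norm x)\<^sup>2) + t\<^sup>2 * (K * norm x)\<^sup>2"
      using c(2)[of x] t K by (intro add_mono diff_mono mult_left_mono power_mono) auto
    also have "\<dots> = (q * norm x)\<^sup>2"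
      using cK K by (simp add: q_def t_def power_mult_distrib field_simps power2_eq_square)
    finally show ?thesis using q by (rule_tac power2_le_imp_le) auto
  qed
  define g where "g x = x - t *\<^sub>R (T x - f)" for x
  have "dist (g x) (g y) \<le> q * dist x y" for x y
  proof -
    have "g x - g y = (x - y) - t *\<^sub>R T (x - y)"
      using T by (simp add: g_def linear_simps algebra_simps)
    then show ?thesis using con[of "x - y"] by (simp add: dist_norm)
  qed
  then obtain x where "g x = x" using banach_fix_type[OF q, of g] by blast
  then have "T x = f" using t by (simp add: g_def)
  with that show ?thesis by blast
qed

section \<open>The Hilbert space of square-summable sequences\<close>

lemma ell2_iff: "f \<in> ell2 \<longleftrightarrow> (\<lambda>n. (cmod (f n))\<^sup>2) summable_on UNIV"
  by (simp add: ell2_def)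

lemma cmod_add_square_le: "(cmod (x + y))\<^sup>2 \<le> 2 * (cmod x)\<^sup>2 + 2 * (cmod y)\<^sup>2"
proof -
  have "(cmod (x + y))\<^sup>2 \<le> (cmod x + cmod y)\<^sup>2"
    by (intro power_mono norm_triangle_ineq) simp
  also have "\<dots> \<le> 2 * (cmod x)\<^sup>2 + 2 * (cmod y)\<^sup>2"
    using sum_squares_ge_zero[of "cmod x - cmod y" 0] by (simp add: power2_eq_square algebra_simps)
  finally show ?thesis .
qed

lemma ell2_add: "f \<in> ell2 \<Longrightarrow> g \<in> ell2 \<Longrightarrow> (\<lambda>n. f n + g n) \<in> ell2"
  unfolding ell2_iff
  by (rule summable_on_comparison_test
      [where f = "\<lambda>n. 2 * (cmod (f n))\<^sup>2 + 2 * (cmod (g n))\<^sup>2"])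
    (auto intro!: summable_on_add summable_on_cmult_right cmod_add_square_le)

lemma ell2_mult:
  assumes "bounded (range v)" "f \<in> ell2"
  shows "(\<lambda>n. v n * f n) \<in> ell2"
proof -
  obtain C where C: "\<And>n. cmod (v n) \<le> C" using assms(1) by (auto simp: bounded_iff)
  show ?thesis unfolding ell2_iff
    by (rule summable_on_comparison_test[where f = "\<lambda>n. C\<^sup>2 * (cmod (f n))\<^sup>2"])
      (use assms(2) C in \<open>auto simp: ell2_iff norm_mult power_mult_distrib
        intro!: summable_on_cmult_right mult_right_mono power_mono\<close>)
qed

lemma bij_int_shift: "bij (\<lambda>n::int. n + k)"
  by (rule o_bij[of "\<lambda>n. n - k"]) auto

lemma infsum_int_shift: "(\<Sum>\<^sub>\<infinity>n. f (n + k :: int)) = (\<Sum>\<^sub>\<infinity>n. f n)"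
  by (rule infsum_reindex_bij_betw[OF bij_int_shift])

lemma summable_on_int_shift: "(\<lambda>n. f (n + k :: int)) summable_on UNIV \<longleftrightarrow> f summable_on UNIV"
  by (rule summable_on_reindex_bij_betw[OF bij_int_shift])

lemma ell2_shift: "f \<in> ell2 \<Longrightarrow> (\<lambda>n. f (n + k)) \<in> ell2"
  unfolding ell2_iff using summable_on_int_shift[of "\<lambda>n. (cmod (f n))\<^sup>2" k] by simp

lemma ell2_inner_summable:
  assumes "f \<in> ell2" "g \<in> ell2"
  shows "(\<lambda>n. f n \<bullet> g n) summable_on UNIV"
proof -
  have "\<bar>f n \<bullet> g n\<bar> \<le> (cmod (f n))\<^sup>2 + (cmod (g n))\<^sup>2" for n
  proof -
    have "\<bar>f n \<bullet> g n\<bar> \<le> cmod (f n) * cmod (g n)" by (rule Cauchy_Schwarz_ineq2)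
    also have "\<dots> \<le> (cmod (f n))\<^sup>2 + (cmod (g n))\<^sup>2"
      using sum_squares_bound[of "cmod (f n)" "cmod (g n)"]
        mult_nonneg_nonneg[OF norm_ge_zero[of "f n"] norm_ge_zero[of "g n"]] by linarith
    finally show ?thesis .
  qed
  then have "(\<lambda>n. \<bar>f n \<bullet> g n\<bar>) summable_on UNIV"
    using summable_on_add[OF assms[unfolded ell2_iff]]
    by (rule_tac summable_on_comparison_test) auto
  then show ?thesis using summable_on_iff_abs_summable_on_real by force
qed

text \<open>The type receives only a real structure: its inner product is the real part of the
  hermitian one, and multiplication by a complex number becomes \<open>mulop\<close> with a constant
  multiplier.\<close>

typedef l2 = ell2 morphisms coord l2_of
  by (rule exI[of _ "\<lambda>_. 0"]) (simp add: ell2_iff)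

setup_lifting type_definition_l2

lemma coord_ell2 [simp]: "coord x \<in> ell2" by (rule coord)

lemma coord_l2_of [simp]: "f \<in> ell2 \<Longrightarrow> coord (l2_of f) = f" by (rule l2_of_inverse)

lemma l2_eqI: "(\<And>n. coord x n = coord y n) \<Longrightarrow> x = y"
  by (metis coord_inject ext)

instantiation l2 :: real_vector
begin

lift_definition zero_l2 :: l2 is "\<lambda>_. 0" by (simp add: ell2_iff)
lift_definition plus_l2 :: "l2 \<Rightarrow> l2 \<Rightarrow> l2" is "\<lambda>f g n. f n + g n" by (rule ell2_add)
lift_definition uminus_l2 :: "l2 \<Rightarrow> l2" is "\<lambda>f n. - f n" by (simp add: ell2_iff)
lift_definition minus_l2 :: "l2 \<Rightarrow> l2 \<Rightarrow> l2" is "\<lambda>f g n. f n - g n"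
proof -
  fix f g assume "f \<in> ell2" "g \<in> ell2"
  then have "(\<lambda>n. f n + - g n) \<in> ell2" by (intro ell2_add) (simp_all add: ell2_iff)
  then show "(\<lambda>n. f n - g n) \<in> ell2" by simp
qed
lift_definition scaleR_l2 :: "real \<Rightarrow> l2 \<Rightarrow> l2" is "\<lambda>c f n. c *\<^sub>R f n"
proof -
  fix c f assume "f \<in> ell2"
  then have "(\<lambda>n. complex_of_real c * f n) \<in> ell2" by (intro ell2_mult) auto
  then show "(\<lambda>n. c *\<^sub>R f n) \<in> ell2" by (simp add: scaleR_conv_of_real)
qed

instance
  by (standard; transfer; simp add: algebra_simps)

end

instantiation l2 :: real_inner
begin

lift_definition inner_l2 :: "l2 \<Rightarrow> l2 \<Rightarrow> real" is "\<lambda>f g. \<Sum>\<^sub>\<infinity>n. f n \<bullet> g n" .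

definition norm_l2 :: "l2 \<Rightarrow> real" where "norm_l2 x = sqrt (x \<bullet> x)"
definition dist_l2 :: "l2 \<Rightarrow> l2 \<Rightarrow> real" where "dist_l2 x y = norm (x - y)"
definition sgn_l2 :: "l2 \<Rightarrow> l2" where "sgn_l2 x = x /\<^sub>R norm x"
definition uniformity_l2 :: "(l2 \<times> l2) filter" where
  "uniformity_l2 = (INF e\<in>{0<..}. principal {(x, y). dist x y < e})"
definition open_l2 :: "l2 set \<Rightarrow> bool" where
  "open_l2 U = (\<forall>x\<in>U. \<forall>\<^sub>F (x', y) in uniformity. x' = x \<longrightarrow> y \<in> U)"

instance
proof
  fix x y z :: l2 and a :: real
  show "dist x y = norm (x - y)" by (rule dist_l2_def)
  show "sgn x = x /\<^sub>R norm x" by (rule sgn_l2_def)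
  show "uniformity = (INF e\<in>{0<..}. principal {(x::l2, y). dist x y < e})"
    by (rule uniformity_l2_def)
  show "open U \<longleftrightarrow> (\<forall>x\<in>U. \<forall>\<^sub>F (x', y) in uniformity. x' = x \<longrightarrow> y \<in> U)" for U :: "l2 set"
    by (rule open_l2_def)
  show "x \<bullet> y = y \<bullet> x" by transfer (simp add: inner_commute)
  show "(x + y) \<bullet> z = x \<bullet> z + y \<bullet> z"
    by transfer (simp add: inner_add_left infsum_add ell2_inner_summable)
  show "(a *\<^sub>R x) \<bullet> y = a * (x \<bullet> y)"
    by transfer (simp only: inner_scaleR_left infsum_cmult_right')
  show "0 \<le> x \<bullet> x" by transfer (simp add: infsum_nonneg)
  show "x \<bullet> x = 0 \<longleftrightarrow> x = 0"
  proof transfer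
    fix f assume f: "f \<in> ell2"
    have "f n = 0" if "(\<Sum>\<^sub>\<infinity>n. f n \<bullet> f n) = 0" for n
    proof -
      have "f n \<bullet> f n = 0"
        by (rule nonneg_infsum_le_0D[OF eq_refl[OF that] ell2_inner_summable[OF f f]]) simp_all
      then show ?thesis by simp
    qed
    then have "(\<Sum>\<^sub>\<infinity>n. f n \<bullet> f n) = 0 \<Longrightarrow> f = (\<lambda>_. 0)" by blast
    then show "(\<Sum>\<^sub>\<infinity>n. f n \<bullet> f n) = 0 \<longleftrightarrow> f = (\<lambda>_. 0)"
    proof
      assume "f = (\<lambda>_. 0)"
      then have "f n \<bullet> f n = 0" for n by (simp only: inner_zero_left)
      then show "(\<Sum>\<^sub>\<infinity>n. f n \<bullet> f n) = 0" by (intro infsum_0)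
    qed
  qed
  show "norm x = sqrt (x \<bullet> x)" by (rule norm_l2_def)
qed

end

lemma coord_simps [simp]:
  "coord 0 n = 0" "coord (x + y) n = coord x n + coord y n" "coord (- x) n = - coord x n"
  "coord (x - y) n = coord x n - coord y n" "coord (c *\<^sub>R x) n = c *\<^sub>R coord x n"
  by (transfer; simp)+

lemma norm_l2_square: "(norm x)\<^sup>2 = (\<Sum>\<^sub>\<infinity>n. (cmod (coord x n))\<^sup>2)"
  unfolding power2_norm_eq_inner by transfer simp

lemma ell2_norm_coord: "ell2_norm (coord x) = norm x"
  unfolding ell2_norm_def norm_l2_square[symmetric] by simp

lemma coord_square_summable: "(\<lambda>n. (cmod (coord x n))\<^sup>2) summable_on A"
  using coord_ell2[of x] unfolding ell2_iff by (rule summable_on_subset) simp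

lemma sum_coord_le_norm: "finite F \<Longrightarrow> (\<Sum>n\<in>F. (cmod (coord x n))\<^sup>2) \<le> (norm x)\<^sup>2"
  unfolding norm_l2_square by (intro finite_sum_le_infsum coord_square_summable) auto

lemma coord_le_norm: "cmod (coord x n) \<le> norm x"
  using sum_coord_le_norm[of "{n}" x] by (rule_tac power2_le_imp_le) auto

lemma l2_boundI:
  assumes "\<And>F. finite F \<Longrightarrow> (\<Sum>n\<in>F. (cmod (f n))\<^sup>2) \<le> C"
  shows "f \<in> ell2" "(\<Sum>\<^sub>\<infinity>n. (cmod (f n))\<^sup>2) \<le> C"
proof -
  show "f \<in> ell2" unfolding ell2_iff
    by (intro nonneg_bdd_above_summable_on) (use assms in \<open>auto intro!: bdd_aboveI[of _ C]\<close>)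
  then show "(\<Sum>\<^sub>\<infinity>n. (cmod (f n))\<^sup>2) \<le> C" unfolding ell2_iff
    by (intro infsum_le_finite_sums) (use assms in auto)
qed

text \<open>Coordinates converge since \<open>coord_le_norm\<close> makes them Cauchy. The norm
  estimate is proved on finite partial sums, where the limit can be taken, and
  \<open>l2_boundI\<close> returns to the whole sequence.\<close>

instance l2 :: banach
proof
  fix X :: "nat \<Rightarrow> l2" assume X: "Cauchy X"
  have "Cauchy (\<lambda>k. coord (X k) n)" for n
  proof (rule metric_CauchyI)
    fix e :: real assume "e > 0"
    then obtain M where "\<And>i j. i \<ge> M \<Longrightarrow> j \<ge> M \<Longrightarrow> dist (X i) (X j) < e"
      using metric_CauchyD[OF X] by blast
    then have "dist (coord (X i) n) (coord (X j) n) < e" if "i \<ge> M" "j \<ge> M" for i j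
      using coord_le_norm[of "X i - X j" n] that by (force simp: dist_norm)
    then show "\<exists>M. \<forall>i\<ge>M. \<forall>j\<ge>M. dist (coord (X i) n) (coord (X j) n) < e" by blast
  qed
  then have "\<exists>l. (\<lambda>k. coord (X k) n) \<longlonglongrightarrow> l" for n
    using Cauchy_convergent convergent_def by blast
  then obtain f where f: "\<And>n. (\<lambda>k. coord (X k) n) \<longlonglongrightarrow> f n" by metis
  have close: "\<exists>M. \<forall>k\<ge>M. \<forall>F. finite F \<longrightarrow> (\<Sum>n\<in>F. (cmod (coord (X k) n - f n))\<^sup>2) \<le> e\<^sup>2"
    if e: "e > 0" for e :: real
  proof -
    obtain M where M: "\<And>i j. i \<ge> M \<Longrightarrow> j \<ge> M \<Longrightarrow> dist (X i) (X j) < e"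
      using metric_CauchyD[OF X e] by blast
    have "(\<Sum>n\<in>F. (cmod (coord (X k) n - f n))\<^sup>2) \<le> e\<^sup>2" if "k \<ge> M" "finite F" for k F
    proof (rule tendsto_upperbound)
      show "(\<lambda>j. \<Sum>n\<in>F. (cmod (coord (X k) n - coord (X j) n))\<^sup>2)
          \<longlonglongrightarrow> (\<Sum>n\<in>F. (cmod (coord (X k) n - f n))\<^sup>2)"
        by (intro tendsto_intros f)
      have "(\<Sum>n\<in>F. (cmod (coord (X k) n - coord (X j) n))\<^sup>2) \<le> e\<^sup>2" if "j \<ge> M" for j
      proof -
        have "(\<Sum>n\<in>F. (cmod (coord (X k - X j) n))\<^sup>2) \<le> (norm (X k - X j))\<^sup>2"
          by (rule sum_coord_le_norm) fact
        also have "\<dots> \<le> e\<^sup>2"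
          using M[OF \<open>k \<ge> M\<close> that] by (intro power_mono) (auto simp: dist_norm)
        finally show ?thesis by simp
      qed
      then show "\<forall>\<^sub>F j in sequentially. (\<Sum>n\<in>F. (cmod (coord (X k) n - coord (X j) n))\<^sup>2) \<le> e\<^sup>2"
        unfolding eventually_sequentially by blast
    qed simp
    then show ?thesis by blast
  qed
  obtain k where k: "\<And>F. finite F \<Longrightarrow> (\<Sum>n\<in>F. (cmod (coord (X k) n - f n))\<^sup>2) \<le> 1\<^sup>2"
    using close[of 1] by auto
  have "(\<lambda>n. coord (X k) n - f n) \<in> ell2" by (rule l2_boundI(1)[OF k])
  from ell2_add[OF coord_ell2[of "X k"] ell2_mult[OF _ this, of "\<lambda>_. - 1"]]
  have fell: "f \<in> ell2" by simp
  have "X \<longlonglongrightarrow> l2_of f"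
  proof (rule metric_LIMSEQ_I)
    fix e :: real assume "e > 0"
    then obtain M where M:
      "\<And>k F. k \<ge> M \<Longrightarrow> finite F \<Longrightarrow> (\<Sum>n\<in>F. (cmod (coord (X k) n - f n))\<^sup>2) \<le> (e / 2)\<^sup>2"
      using close[of "e / 2"] by auto
    have "dist (X k) (l2_of f) < e" if "k \<ge> M" for k
    proof -
      have "(norm (X k - l2_of f))\<^sup>2 \<le> (e / 2)\<^sup>2"
        unfolding norm_l2_square
        using l2_boundI(2)[OF M[OF that]] fell by simp
      then have "norm (X k - l2_of f) \<le> e / 2" using \<open>e > 0\<close> by (rule_tac power2_le_imp_le) auto
      then show ?thesis using \<open>e > 0\<close> by (simp add: dist_norm)
    qed
    then show "\<exists>M. \<forall>k\<ge>M. dist (X k) (l2_of f) < e" by blast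
  qed
  then show "convergent X" by (auto simp: convergent_def)
qed

section \<open>Shifts and multiplication operators\<close>

lift_definition shift :: "int \<Rightarrow> l2 \<Rightarrow> l2" is "\<lambda>k f n. f (n + k)" by (rule ell2_shift)

text \<open>The guard makes the operation total, since an unbounded multiplier can lead out of
  \<open>ell2\<close>; this is why \<open>coord_mulop\<close> carries a boundedness premise.\<close>

lift_definition mulop :: "(int \<Rightarrow> complex) \<Rightarrow> l2 \<Rightarrow> l2" is
  "\<lambda>v f n. if bounded (range v) then v n * f n else 0"
proof -
  fix v f assume "f \<in> ell2"
  then show "(\<lambda>n. if bounded (range v) then v n * f n else 0) \<in> ell2"
    by (cases "bounded (range v)") (auto simp: ell2_mult, simp add: ell2_iff)
qed

lemma coord_shift [simp]: "coord (shift k x) n = coord x (n + k)"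
  by transfer simp

lemma coord_mulop: "bounded (range v) \<Longrightarrow> coord (mulop v x) n = v n * coord x n"
  by transfer simp

lemma norm_shift [simp]: "norm (shift k x) = norm x"
proof -
  have "(norm (shift k x))\<^sup>2 = (norm x)\<^sup>2"
    unfolding norm_l2_square by (simp add: infsum_int_shift[of "\<lambda>n. (cmod (coord x n))\<^sup>2"])
  then show ?thesis by simp
qed

lemma inner_shift: "shift k x \<bullet> y = x \<bullet> shift (- k) y"
proof transfer
  fix k and f g :: "int \<Rightarrow> complex"
  show "(\<Sum>\<^sub>\<infinity>n. f (n + k) \<bullet> g n) = (\<Sum>\<^sub>\<infinity>n. f n \<bullet> g (n + - k))"
    using infsum_int_shift[of "\<lambda>n. f n \<bullet> g (n - k)" k] by simp
qed

lemma norm_mulop_le: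
  assumes "\<And>n. cmod (v n) \<le> C"
  shows "norm (mulop v x) \<le> C * norm x"
proof -
  have b: "bounded (range v)" using assms by (auto simp: bounded_iff)
  have C: "0 \<le> C" using assms norm_ge_zero order_trans by blast
  have "(norm (mulop v x))\<^sup>2 \<le> (\<Sum>\<^sub>\<infinity>n. C\<^sup>2 * (cmod (coord x n))\<^sup>2)"
    unfolding norm_l2_square
    by (intro infsum_mono coord_square_summable summable_on_cmult_right)
      (auto simp: coord_mulop[OF b] norm_mult power_mult_distrib intro!: mult_right_mono power_mono assms)
  also have "\<dots> = (C * norm x)\<^sup>2"
    by (simp add: infsum_cmult_right' norm_l2_square power_mult_distrib)
  finally show ?thesis using C by (rule_tac power2_le_imp_le) auto
qed

lemma inner_mulop:
  assumes "bounded (range v)"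
  shows "mulop v x \<bullet> y = x \<bullet> mulop (\<lambda>n. cnj (v n)) y"
proof -
  have "bounded (range (\<lambda>n. cnj (v n)))" using assms by (auto simp: bounded_iff)
  with assms show ?thesis
    by transfer (intro infsum_cong, auto simp: inner_complex_def algebra_simps)
qed

lemma bounded_linear_shift_l2 [bounded_linear]: "bounded_linear (shift k)"
  by (rule bounded_linear_intro[of _ 1]) (auto intro: l2_eqI)

lemma bounded_linear_mulop: 
  assumes b: "bounded (range v)"
  shows "bounded_linear (mulop v)"
proof -
  obtain C where "\<And>n. cmod (v n) \<le> C" using b by (auto simp: bounded_iff)
  then show ?thesis
    by (intro bounded_linear_intro[of _ C])
      (auto intro!: l2_eqI simp: coord_mulop[OF b] algebra_simps mult.commute[of _ C] norm_mulop_le)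
qed

section \<open>Jacobi operators\<close>

text \<open>Hopping amplitudes other than \<open>1\<close> are needed to cut the chain into finite pieces.\<close>

definition jacobi :: "(int \<Rightarrow> real) \<Rightarrow> (int \<Rightarrow> real) \<Rightarrow> l2 \<Rightarrow> l2" where
  "jacobi a V x = mulop (\<lambda>n. of_real (a (n - 1))) (shift (- 1) x)
     + mulop (\<lambda>n. of_real (a n)) (shift 1 x) + mulop (\<lambda>n. of_real (V n)) x"

lemma bounded_of_real:
  assumes "\<And>n. \<bar>v n\<bar> \<le> C"
  shows "bounded (range (\<lambda>n. complex_of_real (v n)))"
  using assms by (auto simp: bounded_iff)

lemma
  assumes a: "\<And>n. \<bar>a n\<bar> \<le> A" and V: "\<And>n. \<bar>V n\<bar> \<le> M"
  shows coord_jacobi: "coord (jacobi a V x) n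
      = of_real (a (n - 1)) * coord x (n - 1) + of_real (a n) * coord x (n + 1) + of_real (V n) * coord x n"
    and bounded_linear_jacobi: "bounded_linear (jacobi a V)"
    and norm_jacobi_le: "norm (jacobi a V x) \<le> (2 * A + M) * norm x"
    and inner_jacobi: "jacobi a V x \<bullet> y = x \<bullet> jacobi a V y"
    and jacobi_mulop_const: "jacobi a V (mulop (\<lambda>_. c) x) = mulop (\<lambda>_. c) (jacobi a V x)"
proof -
  have ba: "bounded (range (\<lambda>n. complex_of_real (a n)))"
    "bounded (range (\<lambda>n. complex_of_real (a (n - 1))))"
    and bV: "bounded (range (\<lambda>n. complex_of_real (V n)))"
    by (rule bounded_of_real[OF a] bounded_of_real[OF V])+
  show coord: "coord (jacobi a V x) n = of_real (a (n - 1)) * coord x (n - 1)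
      + of_real (a n) * coord x (n + 1) + of_real (V n) * coord x n" for x n
    by (simp add: jacobi_def coord_mulop ba bV)
  show "bounded_linear (jacobi a V)" unfolding jacobi_def
    by (intro bounded_linear_add bounded_linear_mulop ba bV
        bounded_linear_compose[OF bounded_linear_mulop bounded_linear_shift_l2, unfolded o_def])
  have "norm (mulop (\<lambda>n. of_real (a (n - 1))) (shift (- 1) x)) \<le> A * norm (shift (- 1) x)"
    "norm (mulop (\<lambda>n. of_real (a n)) (shift 1 x)) \<le> A * norm (shift 1 x)"
    "norm (mulop (\<lambda>n. of_real (V n)) x) \<le> M * norm x"
    using a V by (auto intro!: norm_mulop_le simp del: norm_shift)
  then show "norm (jacobi a V x) \<le> (2 * A + M) * norm x"
    unfolding jacobi_def
    by (intro order_trans[OF norm_triangle_ineq order_trans[OF add_mono[OF norm_triangle_ineq order_refl]]])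
      (simp add: algebra_simps)
  \<comment> \<open>Moving a multiplier across a shift translates it; this exchanges the two hopping
    terms under the adjoint and explains the index \<open>n - 1\<close> in the left one.\<close>
  have sw: "shift k (mulop (\<lambda>n. of_real (a n)) z) = mulop (\<lambda>n. of_real (a (n + k))) (shift k z)"
    "bounded (range (\<lambda>n. complex_of_real (a (n + k))))" for k z
    by (rule l2_eqI) (simp_all add: coord_mulop ba bounded_of_real[OF a])
  have "mulop (\<lambda>n. of_real (a (n - 1))) (shift (- 1) x) \<bullet> y = x \<bullet> mulop (\<lambda>n. of_real (a n)) (shift 1 y)"
    using inner_shift[of "- 1" "mulop (\<lambda>n. of_real (a n)) x" y] sw(1)[of "- 1" x]
      inner_mulop[OF ba(1), of x "shift 1 y"] by simp
  moreover have "mulop (\<lambda>n. of_real (a n)) (shift 1 x) \<bullet> y = x \<bullet> mulop (\<lambda>n. of_real (a (n - 1))) (shift (- 1) y)"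
    using inner_shift[of 1 x "mulop (\<lambda>n. of_real (a n)) y"] sw(1)[of "- 1" y]
      inner_mulop[OF ba(1), of "shift 1 x" y] by simp
  moreover have "mulop (\<lambda>n. of_real (V n)) x \<bullet> y = x \<bullet> mulop (\<lambda>n. of_real (V n)) y"
    using inner_mulop[OF bV, of x y] by simp
  ultimately show "jacobi a V x \<bullet> y = x \<bullet> jacobi a V y"
    unfolding jacobi_def by (simp add: inner_add_left inner_add_right)
  show "jacobi a V (mulop (\<lambda>_. c) x) = mulop (\<lambda>_. c) (jacobi a V x)"
    by (rule l2_eqI) (simp add: coord coord_mulop algebra_simps)
qed

definition schr :: "(int \<Rightarrow> real) \<Rightarrow> l2 \<Rightarrow> l2" where
  "schr V = jacobi (\<lambda>_. 1) V"

lemma coord_schr: "(\<And>n. \<bar>V n\<bar> \<le> M) \<Longrightarrow> coord (schr V x) = schroedinger V (coord x)"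
  unfolding schr_def by (rule ext) (subst coord_jacobi[of _ 1 _ M], auto simp: schroedinger_def)

lemma norm_jacobi_diff_le:
  assumes a: "\<And>n. \<bar>a n\<bar> \<le> A" and "\<And>n. \<bar>V n\<bar> \<le> M" and "\<And>n. \<bar>W n\<bar> \<le> M'" and "\<And>n. \<bar>V n - W n\<bar> \<le> \<delta>"
  shows "norm (jacobi a V x - jacobi a W x) \<le> \<delta> * norm x"
proof -
  have "jacobi a V x - jacobi a W x = mulop (\<lambda>n. of_real (V n - W n)) x"
    using bounded_of_real[of "\<lambda>n. V n - W n", OF assms(4)]
    by (intro l2_eqI) (simp add: coord_jacobi[OF a assms(2)] coord_jacobi[OF a assms(3)]
        coord_mulop algebra_simps)
  also have "norm \<dots> \<le> \<delta> * norm x"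
    by (rule norm_mulop_le) (metis assms(4) norm_of_real real_norm_def)
  finally show ?thesis .
qed

text \<open>Pythagoras in the real inner product: a symmetric operator commuting with multiplication
  by \<i> sends \<open>x\<close> to a vector orthogonal to \<i> times \<open>x\<close>, so the
  imaginary part of \<open>z\<close> contributes an orthogonal summand.\<close>

lemma norm_shift_complex:
  fixes T :: "l2 \<Rightarrow> l2"
  assumes sym: "\<And>x y. T x \<bullet> y = x \<bullet> T y"
    and lin: "\<And>x. T (mulop (\<lambda>_. \<i>) x) = mulop (\<lambda>_. \<i>) (T x)"
  shows "(norm (T x - mulop (\<lambda>_. z) x))\<^sup>2 = (norm (T x - Re z *\<^sub>R x))\<^sup>2 + (Im z)\<^sup>2 * (norm x)\<^sup>2"
proof -
  let ?J = "mulop (\<lambda>_. \<i>)"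
  have skew: "?J x \<bullet> y = - (x \<bullet> ?J y)" for x y
  proof -
    have "mulop (\<lambda>n. cnj \<i>) y = - ?J y" by (rule l2_eqI) (simp add: coord_mulop)
    then show ?thesis using inner_mulop[of "\<lambda>_. \<i>" x y] by simp
  qed
  have zero: "x \<bullet> ?J x = 0" for x using skew[of x x] by (simp add: inner_commute)
  have "T x \<bullet> ?J x = 0"
    using sym[of x "?J x"] lin[of x] skew[of x "T x"] by (simp add: inner_commute)
  then have orth: "(T x - Re z *\<^sub>R x) \<bullet> ?J x = 0" using zero by (simp add: inner_diff_left)
  have nJ: "norm (?J x) = norm x"
  proof -
    have "(norm (?J x))\<^sup>2 = (norm x)\<^sup>2"
      unfolding norm_l2_square by (simp add: coord_mulop norm_mult)
    then show ?thesis by simp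
  qed
  have eq: "T x - mulop (\<lambda>_. z) x = (T x - Re z *\<^sub>R x) - Im z *\<^sub>R ?J x"
    by (rule l2_eqI) (simp add: coord_mulop complex_eq_iff)
  show ?thesis
    unfolding eq norm_diff_scaleR_square[of "T x - Re z *\<^sub>R x" "Im z" "?J x"] orth nJ by simp
qed

text \<open>Off the approximate spectrum \<open>S z\<close> is bounded below, and so is its adjoint
  \<open>S (cnj z)\<close>; hence the product of the two is coercive and
  \<open>coercive_surj\<close> makes \<open>S z\<close> onto. Conversely a bounded inverse gives a
  lower bound.\<close>

lemma op_spectrum_schroedinger:
  assumes V: "\<And>n. \<bar>V n\<bar> \<le> M"
  shows "op_spectrum (schroedinger V) = complex_of_real ` approx_spec (schr V)"
proof -
  have one: "\<And>n::int. \<bar>1::real\<bar> \<le> 1" by simp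
  note J = bounded_linear_jacobi[OF one V] inner_jacobi[OF one V] jacobi_mulop_const[OF one V]
  let ?T = "schr V"
  define S where "S z x = ?T x - mulop (\<lambda>_. z) x" for z x
  have T: "bounded_linear ?T" "\<And>x y. ?T x \<bullet> y = x \<bullet> ?T y"
    "\<And>c x. ?T (mulop (\<lambda>_. c) x) = mulop (\<lambda>_. c) (?T x)"
    using J unfolding schr_def by auto
  have S: "bounded_linear (S z)" for z
    unfolding S_def by (intro bounded_linear_sub T bounded_linear_mulop) simp
  have Sadj: "S z x \<bullet> y = x \<bullet> S (cnj z) y" for z x y
    by (simp add: S_def inner_diff_left inner_diff_right T(2) inner_mulop)
  have Scoord: "coord (S z x) = (\<lambda>n. schroedinger V (coord x) n - z * coord x n)" for z x
    by (rule ext) (simp add: S_def coord_schr[OF V] coord_mulop)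
  have Snorm: "(norm (S z x))\<^sup>2 = (norm (?T x - Re z *\<^sub>R x))\<^sup>2 + (Im z)\<^sup>2 * (norm x)\<^sup>2" for z x
    unfolding S_def by (rule norm_shift_complex[OF T(2) T(3)])
  have low: "\<exists>c>0. \<forall>x. c * norm x \<le> norm (S z x)" if z: "z \<notin> complex_of_real ` approx_spec ?T" for z
  proof (cases "Im z = 0")
    case True
    then have "Re z \<notin> approx_spec ?T"
      using z by (metis complex_is_Real_iff image_iff of_real_Re)
    then obtain c where "c > 0" "\<And>x. c * norm x \<le> norm (?T x - Re z *\<^sub>R x)"
      by (auto simp: not_approx_spec_iff)
    moreover have "norm (S z x) = norm (?T x - Re z *\<^sub>R x)" for x
      using Snorm[of z x] True by simp
    ultimately show ?thesis by auto
  next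
    case False
    have "(\<bar>Im z\<bar> * norm x)\<^sup>2 \<le> (norm (S z x))\<^sup>2" for x
      by (simp add: Snorm power_mult_distrib)
    then have "\<bar>Im z\<bar> * norm x \<le> norm (S z x)" for x by (rule power2_le_imp_le) simp
    with False show ?thesis by (intro exI[of _ "\<bar>Im z\<bar>"]) auto
  qed
  have inv: "z \<notin> op_spectrum (schroedinger V)" if z: "z \<notin> complex_of_real ` approx_spec ?T" for z
  proof -
    obtain c where c: "c > 0" "\<And>x. c * norm x \<le> norm (S z x)" using low[OF z] by blast
    have ccnj: "c * norm x \<le> norm (S (cnj z) x)" for x
    proof -
      have "(norm (S (cnj z) x))\<^sup>2 = (norm (S z x))\<^sup>2" by (simp add: Snorm)
      then show ?thesis using c(2)[of x] by simp
    qed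
    have surj: "\<exists>x. S z x = f" for f
    proof -
      have "bounded_linear (\<lambda>x. S z (S (cnj z) x))"
        by (rule bounded_linear_compose[OF S S, unfolded o_def])
      moreover have "c\<^sup>2 * (norm x)\<^sup>2 \<le> S z (S (cnj z) x) \<bullet> x" for x
        using power_mono[OF ccnj, of x 2] c(1)
        by (simp add: Sadj power2_norm_eq_inner[of "S _ _"] power_mult_distrib)
      ultimately obtain x where "S z (S (cnj z) x) = f"
        using c(1) coercive_surj[of "\<lambda>x. S z (S (cnj z) x)" "c\<^sup>2" f] by auto
      then show ?thesis by blast
    qed
    have inj: "x = y" if "S z x = S z y" for x y
      using c(2)[of "x - y"] c(1) that bounded_linear.linear[OF S]
      by (simp add: linear_diff mult_le_0_iff)
    define R where "R \<psi> = coord (SOME x. S z x = l2_of \<psi>)" for \<psi>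
    have R: "R (coord (S z x)) = coord x" for x
    proof -
      have "S z (SOME y. S z y = S z x) = S z x" by (rule someI) simp
      then have "(SOME y. S z y = S z x) = x" by (rule inj)
      then show ?thesis by (simp add: R_def coord_inverse)
    qed
    have ex: "\<exists>x. \<psi> = coord (S z x)" if "\<psi> \<in> ell2" for \<psi>
      using surj[of "l2_of \<psi>"] that by (metis coord_l2_of)
    have "bounded_op_ell2 R"
      unfolding bounded_op_ell2_def
    proof (intro conjI ballI allI)
      show "R \<psi> \<in> ell2" if "\<psi> \<in> ell2" for \<psi> using ex[OF that] R by auto
      show "R (\<lambda>n. \<psi> n + \<phi> n) = (\<lambda>n. R \<psi> n + R \<phi> n)" if p: "\<psi> \<in> ell2" "\<phi> \<in> ell2" for \<psi> \<phi>
      proof -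
        obtain x y where xy: "\<psi> = coord (S z x)" "\<phi> = coord (S z y)" using ex[OF p(1)] ex[OF p(2)] by blast
        have "(\<lambda>n. \<psi> n + \<phi> n) = coord (S z (x + y))"
          using S[of z] by (auto simp: xy linear_simps)
        then show ?thesis by (auto simp: R xy)
      qed
      show "R (\<lambda>n. a * \<psi> n) = (\<lambda>n. a * R \<psi> n)" if p: "\<psi> \<in> ell2" for a \<psi>
      proof -
        obtain x where x: "\<psi> = coord (S z x)" using ex[OF p] by blast
        have "(\<lambda>n. a * \<psi> n) = coord (S z (mulop (\<lambda>_. a) x))"
          by (auto simp: x S_def T(3) coord_mulop algebra_simps)
        then show ?thesis by (auto simp: R x coord_mulop)
      qed
      show "\<exists>C. \<forall>\<psi>\<in>ell2. ell2_norm (R \<psi>) \<le> C * ell2_norm \<psi>"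
      proof (intro exI ballI)
        fix \<psi> :: "int \<Rightarrow> complex" assume "\<psi> \<in> ell2"
        then obtain x where x: "\<psi> = coord (S z x)" using ex by blast
        show "ell2_norm (R \<psi>) \<le> (1 / c) * ell2_norm \<psi>"
          using c(1) c(2)[of x] by (simp add: x R ell2_norm_coord field_simps)
      qed
    qed
    moreover have "R (\<lambda>n. schroedinger V \<psi> n - z * \<psi> n) = \<psi> \<and>
        (\<lambda>n. schroedinger V (R \<psi>) n - z * R \<psi> n) = \<psi>" if "\<psi> \<in> ell2" for \<psi>
    proof
      show "R (\<lambda>n. schroedinger V \<psi> n - z * \<psi> n) = \<psi>"
        using R[of "l2_of \<psi>"] that by (simp add: Scoord)
      obtain x where x: "\<psi> = coord (S z x)" using ex[OF \<open>\<psi> \<in> ell2\<close>] by blast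
      show "(\<lambda>n. schroedinger V (R \<psi>) n - z * R \<psi> n) = \<psi>"
        unfolding x R by (simp add: Scoord)
    qed
    ultimately show ?thesis unfolding op_spectrum_def by blast
  qed
  have "complex_of_real E \<in> op_spectrum (schroedinger V)" if E: "E \<in> approx_spec ?T" for E
  proof (rule ccontr)
    assume "\<not> ?thesis"
    then obtain R where R: "bounded_op_ell2 R"
      "\<And>\<psi>. \<psi> \<in> ell2 \<Longrightarrow> R (\<lambda>n. schroedinger V \<psi> n - of_real E * \<psi> n) = \<psi>"
      unfolding op_spectrum_def by blast
    obtain C0 where C0: "\<And>\<psi>. \<psi> \<in> ell2 \<Longrightarrow> ell2_norm (R \<psi>) \<le> C0 * ell2_norm \<psi>"
      using R(1) unfolding bounded_op_ell2_def by blast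
    \<comment> \<open>The bound \<open>C0\<close> is not known to be positive, while its reciprocal
      has to serve as a positive lower bound.\<close>
    define C where "C = max C0 1"
    have "norm x \<le> C * norm (?T x - E *\<^sub>R x)" for x
    proof -
      have "S (of_real E) x = ?T x - E *\<^sub>R x"
        by (rule l2_eqI) (simp add: S_def coord_mulop scaleR_conv_of_real)
      moreover have "norm x = ell2_norm (R (coord (S (of_real E) x)))"
        unfolding Scoord by (subst R(2)) (simp_all add: ell2_norm_coord)
      moreover have "\<dots> \<le> C0 * norm (S (of_real E) x)"
        using C0[of "coord (S (of_real E) x)"] by (simp add: ell2_norm_coord)
      moreover have "\<dots> \<le> C * norm (S (of_real E) x)"
        by (intro mult_right_mono) (auto simp: C_def)
      ultimately show ?thesis by simp
    qed
    moreover have "C > 0" by (simp add: C_def)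
    ultimately have "1 / C > 0" "\<forall>x. 1 / C * norm x \<le> norm (?T x - E *\<^sub>R x)"
      by (auto simp: field_simps)
    then have "E \<notin> approx_spec ?T" unfolding not_approx_spec_iff by blast
    with E show False by simp
  qed
  with inv show ?thesis by blast
qed

section \<open>Decay of approximate eigenfunctions in gaps\<close>

abbreviation rmul :: "(int \<Rightarrow> real) \<Rightarrow> l2 \<Rightarrow> l2" where
  "rmul g \<equiv> mulop (\<lambda>n. complex_of_real (g n))"

lemma coord_rmul: "(\<And>n. \<bar>g n\<bar> \<le> C) \<Longrightarrow> coord (rmul g x) n = of_real (g n) * coord x n"
  by (rule coord_mulop[OF bounded_of_real])

lemma norm_rmul_mono:
  assumes "\<And>n. \<bar>w n\<bar> \<le> C" "\<And>n. \<bar>v n\<bar> \<le> \<bar>w n\<bar>"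
  shows "norm (rmul v x) \<le> norm (rmul w x)"
proof -
  have v: "\<bar>v n\<bar> \<le> C" for n using assms order_trans by blast
  have "(norm (rmul v x))\<^sup>2 \<le> (norm (rmul w x))\<^sup>2"
    unfolding norm_l2_square
    by (intro infsum_mono coord_square_summable)
      (auto simp: coord_rmul[OF v] coord_rmul[OF assms(1)] norm_mult intro!: power_mono mult_right_mono assms)
  then show ?thesis by simp
qed

lemma norm_rmul_le_lincomb:
  assumes w: "\<And>n. \<bar>w n\<bar> \<le> C" and w': "\<And>n. \<bar>w' n\<bar> \<le> C'"
    and v: "\<And>n. \<bar>v n\<bar> \<le> a * (w n + w' n)" and "a \<ge> 0"
  shows "norm (rmul v x) \<le> a * (norm (rmul w x) + norm (rmul w' x))"
proof -
  have b: "\<bar>a * (w n + w' n)\<bar> \<le> a * (C + C')" for n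
    unfolding abs_mult using \<open>a \<ge> 0\<close> w[of n] w'[of n] by (intro mult_mono) auto
  have "norm (rmul v x) \<le> norm (rmul (\<lambda>n. a * (w n + w' n)) x)"
    by (intro norm_rmul_mono[OF b] order_trans[OF v abs_ge_self])
  also have "rmul (\<lambda>n. a * (w n + w' n)) x = a *\<^sub>R (rmul w x + rmul w' x)"
    by (rule l2_eqI, simp only: coord_simps coord_rmul[OF b] coord_rmul[OF w] coord_rmul[OF w'])
      (simp add: scaleR_conv_of_real algebra_simps)
  also have "norm \<dots> \<le> a * (norm (rmul w x) + norm (rmul w' x))"
    using \<open>a \<ge> 0\<close> by (simp add: mult_left_mono norm_triangle_ineq)
  finally show ?thesis .
qed

text \<open>The tent \<open>g n = t ^ (h - \<bar>n - c\<bar>) - 1\<close>, continued by \<open>0\<close>, changes by at most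
  \<open>(t - 1) (g n + 1)\<close> between neighbours inside the window and not at all outside.\<close>

definition tent :: "real \<Rightarrow> nat \<Rightarrow> int \<Rightarrow> int \<Rightarrow> real" where
  "tent t h c n = t ^ nat (int h - \<bar>n - c\<bar>) - 1"

definition window :: "nat \<Rightarrow> int \<Rightarrow> int \<Rightarrow> real" where
  "window h c n = (if \<bar>n - c\<bar> \<le> int h then 1 else 0)"

lemma tent_bounds:
  assumes "t \<ge> 1"
  shows "0 \<le> tent t h c n" "tent t h c n \<le> t ^ h * window h c n"
    "\<bar>n - c\<bar> \<ge> int h \<Longrightarrow> tent t h c n = 0"
proof -
  show "0 \<le> tent t h c n" using assms by (simp add: tent_def one_le_power)
  show z: "tent t h c n = 0" if "\<bar>n - c\<bar> \<ge> int h" using that by (simp add: tent_def)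
  show "tent t h c n \<le> t ^ h * window h c n"
  proof (cases "\<bar>n - c\<bar> \<le> int h")
    case True
    have "t ^ nat (int h - \<bar>n - c\<bar>) \<le> t ^ h" using assms by (intro power_increasing) auto
    with True show ?thesis by (simp add: tent_def window_def)
  qed (use z in \<open>simp add: window_def\<close>)
qed

lemma tent_step:
  assumes t: "t \<ge> 1" and nm: "\<bar>n - m\<bar> = 1"
  shows "\<bar>tent t h c m - tent t h c n\<bar> \<le> (t - 1) * (tent t h c m + window h c m)"
proof (cases "\<bar>m - c\<bar> \<le> int h \<and> \<bar>n - c\<bar> \<le> int h")
  case True
  define u v where "u = nat (int h - \<bar>m - c\<bar>)" and "v = nat (int h - \<bar>n - c\<bar>)"
  have "v = u \<or> v = Suc u \<or> u = Suc v" using True nm unfolding u_def v_def by linarith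
  moreover have "t ^ u - t ^ v \<le> (t - 1) * t ^ u" if "u = Suc v"
  proof -
    have "t ^ v \<le> t ^ u" using t that by (intro power_increasing) auto
    then have "(t - 1) * t ^ v \<le> (t - 1) * t ^ u" using t by (intro mult_left_mono) auto
    with that show ?thesis by (simp add: algebra_simps)
  qed
  moreover have "t ^ u \<ge> t ^ v" if "u = Suc v" using t that by (intro power_increasing) auto
  moreover have "t ^ v \<ge> t ^ u" if "v = Suc u" using t that by (intro power_increasing) auto
  ultimately have "\<bar>t ^ u - t ^ v\<bar> \<le> (t - 1) * t ^ u"
    using t by (auto simp: abs_if algebra_simps)
  then show ?thesis using True by (simp add: tent_def window_def u_def v_def)
next
  \<comment> \<open>The tent already vanishes at distance exactly \<open>h\<close> from
    \<open>c\<close>, so a step across the edge of the window changes nothing.\<close>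
  case False
  then have "tent t h c m = 0" "tent t h c n = 0" using nm t by (auto intro!: tent_bounds(3))
  then show ?thesis using t by (simp add: window_def)
qed

text \<open>The Combes-Thomas estimate with a bounded weight. Applying the gap bound of
  \<open>W\<close> to \<open>rmul (tent t h c) x\<close> produces the weighted residual and two
  discrete gradients of the tent. By \<open>tent_step\<close> these are at most \<open>t - 1\<close>
  times the weighted vector plus the local mass, and half of \<open>\<eta>\<close> absorbs
  them.\<close>

lemma gap_decay:
  fixes x :: l2
  assumes \<eta>: "\<eta> > 0" "\<And>x. \<eta> * norm x \<le> norm (schr W x - E *\<^sub>R x)"
    and W: "\<And>n. \<bar>W n\<bar> \<le> M" and V: "\<And>n. \<bar>V n\<bar> \<le> M"
    and agree: "\<And>n. \<bar>n - c\<bar> \<le> int h \<Longrightarrow> V n = W n"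
    and t: "t \<ge> 1" "2 * (t - 1) \<le> \<eta> / 2"
  defines "f \<equiv> schr V x - E *\<^sub>R x"
  shows "tent t h c n * cmod (coord x n)
      \<le> 2 / \<eta> * t ^ h * norm (rmul (window h c) f) + norm (rmul (window h c) x)"
proof -
  let ?g = "tent t h c" and ?w = "window h c"
  have w: "\<bar>?w n\<bar> \<le> 1" for n by (simp add: window_def)
  have th: "t ^ h \<ge> 1" using t by (simp add: one_le_power)
  have g: "\<bar>?g n\<bar> \<le> t ^ h" for n
    using tent_bounds[OF t(1), of h c n] th w[of n] by (auto simp: window_def split: if_splits)
  define d1 d2 where "d1 m = ?g m - ?g (m + 1)" and "d2 m = ?g m - ?g (m - 1)" for m
  have d1: "\<bar>d1 m\<bar> \<le> (t - 1) * (?g m + ?w m)" and d2: "\<bar>d2 m\<bar> \<le> (t - 1) * (?g m + ?w m)" for m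
    unfolding d1_def d2_def using t(1) by (auto intro!: tent_step)
  have b1: "\<bar>d1 m\<bar> \<le> 2 * t ^ h" and b2: "\<bar>d2 m\<bar> \<le> 2 * t ^ h" for m
    unfolding d1_def d2_def using g[of m] g[of "m + 1"] g[of "m - 1"] by linarith+
  have one: "\<And>n::int. \<bar>1::real\<bar> \<le> 1" by simp
  have eq: "schr W (rmul ?g x) - E *\<^sub>R rmul ?g x
      = rmul ?g f + shift (- 1) (rmul d1 x) + shift 1 (rmul d2 x)"
  proof (rule l2_eqI)
    fix n
    \<comment> \<open>The potentials agree on the window and the tent vanishes off it.\<close>
    have VW: "of_real (W n) * (of_real (?g n) * coord x n) = of_real (V n) * (of_real (?g n) * coord x n)"
      using agree[of n] tent_bounds(3)[OF t(1), of h n c] by (cases "\<bar>n - c\<bar> \<le> int h") auto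
    show "coord (schr W (rmul ?g x) - E *\<^sub>R rmul ?g x) n
      = coord (rmul ?g f + shift (- 1) (rmul d1 x) + shift 1 (rmul d2 x)) n"
      by (simp only: f_def schr_def coord_simps coord_shift coord_jacobi[OF one W] coord_jacobi[OF one V]
          coord_rmul[OF g] coord_rmul[OF b1] coord_rmul[OF b2] scaleR_conv_of_real VW)
        (simp add: d1_def d2_def algebra_simps)
  qed
  let ?N = "norm (rmul ?g x)" and ?K = "norm (rmul ?w x)"
  have "norm (rmul ?g f) \<le> t ^ h * (norm (rmul ?w f) + norm (rmul (\<lambda>_. 0) f))"
    using tent_bounds[OF t(1), of h c] th w by (intro norm_rmul_le_lincomb[of ?w 1 _ 0]) auto
  moreover have "rmul (\<lambda>_. 0) f = 0" by (rule l2_eqI) (simp add: coord_mulop)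
  ultimately have gf: "norm (rmul ?g f) \<le> t ^ h * norm (rmul ?w f)" by simp
  have n1: "norm (rmul d1 x) \<le> (t - 1) * (?N + ?K)" and n2: "norm (rmul d2 x) \<le> (t - 1) * (?N + ?K)"
    using t(1) by (auto intro!: norm_rmul_le_lincomb[OF g w] d1 d2)
  have "\<eta> * ?N \<le> norm (rmul ?g f + shift (- 1) (rmul d1 x) + shift 1 (rmul d2 x))"
    using \<eta>(2)[of "rmul ?g x"] unfolding eq .
  also have "\<dots> \<le> norm (rmul ?g f) + norm (rmul d1 x) + norm (rmul d2 x)"
    using norm_triangle_ineq[of "rmul ?g f + shift (- 1) (rmul d1 x)" "shift 1 (rmul d2 x)"]
      norm_triangle_ineq[of "rmul ?g f" "shift (- 1) (rmul d1 x)"] by simp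
  also have "\<dots> \<le> t ^ h * norm (rmul ?w f) + 2 * (t - 1) * (?N + ?K)" using add_mono[OF add_mono[OF gf n1] n2] by (simp add: algebra_simps)
  also have "2 * (t - 1) * (?N + ?K) \<le> \<eta> / 2 * (?N + ?K)" using t(2) by (intro mult_right_mono) auto
  finally have "\<eta> / 2 * ?N \<le> t ^ h * norm (rmul ?w f) + \<eta> / 2 * ?K" by (simp add: algebra_simps)
  then have "?N \<le> 2 / \<eta> * t ^ h * norm (rmul ?w f) + ?K" using \<eta>(1) by (simp add: field_simps)
  moreover have "?g n * cmod (coord x n) \<le> ?N"
    using coord_le_norm[of "rmul ?g x" n] tent_bounds(1)[OF t(1), of h c n]
    by (simp add: coord_rmul[OF g] norm_mult)
  ultimately show ?thesis by linarith
qed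

lemma norm_window_square:
  "(norm (rmul (window h c) x))\<^sup>2 = (\<Sum>k=- int h..int h. (cmod (coord x (c + k)))\<^sup>2)"
proof -
  have b: "\<bar>window h c n\<bar> \<le> 1" for n by (simp add: window_def)
  have "(norm (rmul (window h c) x))\<^sup>2
      = (\<Sum>\<^sub>\<infinity>n. if n \<in> {c - int h..c + int h} then (cmod (coord x n))\<^sup>2 else 0)"
    unfolding norm_l2_square coord_rmul[OF b] by (intro infsum_cong) (auto simp: window_def)
  also have "\<dots> = (\<Sum>\<^sub>\<infinity>n\<in>{c - int h..c + int h}. (cmod (coord x n))\<^sup>2)"
    by (intro infsum_cong_neutral) auto
  also have "\<dots> = (\<Sum>n\<in>{c - int h..c + int h}. (cmod (coord x n))\<^sup>2)" by simp
  also have "\<dots> = (\<Sum>k=- int h..int h. (cmod (coord x (c + k)))\<^sup>2)"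
    by (rule sum.reindex_bij_witness[of _ "\<lambda>k. c + k" "\<lambda>n. n - c"]) auto
  finally show ?thesis .
qed

lemma has_sum_sum:
  fixes f :: "'i \<Rightarrow> 'a \<Rightarrow> real"
  assumes "finite I" "\<And>i. i \<in> I \<Longrightarrow> (f i has_sum s i) A"
  shows "((\<lambda>x. \<Sum>i\<in>I. f i x) has_sum (\<Sum>i\<in>I. s i)) A"
  using assms by (induction I rule: finite_induct) (auto intro: has_sum_add)

text \<open>Double counting: every site lies in exactly \<open>2 * h + 1\<close> windows.\<close>

lemma
  shows window_sum_summable: "(\<lambda>n. \<Sum>k=- int h..int h. (cmod (coord x (n + k)))\<^sup>2) summable_on UNIV"
    and infsum_window_sum: "(\<Sum>\<^sub>\<infinity>n. \<Sum>k=- int h..int h. (cmod (coord x (n + k)))\<^sup>2) = (2 * real h + 1) * (norm x)\<^sup>2"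
proof -
  have s: "(\<lambda>n. (cmod (coord x (n + k)))\<^sup>2) summable_on UNIV" for k
    unfolding summable_on_int_shift[of "\<lambda>n. (cmod (coord x n))\<^sup>2" k] by (rule coord_square_summable)
  have "((\<lambda>n. \<Sum>k=- int h..int h. (cmod (coord x (n + k)))\<^sup>2) has_sum
      (\<Sum>k=- int h..int h. \<Sum>\<^sub>\<infinity>n. (cmod (coord x (n + k)))\<^sup>2)) UNIV"
    by (intro has_sum_sum has_sum_infsum s) simp
  also have "(\<Sum>k=- int h..int h. \<Sum>\<^sub>\<infinity>n. (cmod (coord x (n + k)))\<^sup>2) = (2 * real h + 1) * (norm x)\<^sup>2"
    unfolding infsum_int_shift[of "\<lambda>n. (cmod (coord x n))\<^sup>2"] norm_l2_square by simp
  finally have hs: "((\<lambda>n. \<Sum>k=- int h..int h. (cmod (coord x (n + k)))\<^sup>2) has_sum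
      (2 * real h + 1) * (norm x)\<^sup>2) UNIV" .
  show "(\<lambda>n. \<Sum>k=- int h..int h. (cmod (coord x (n + k)))\<^sup>2) summable_on UNIV"
    using hs by (rule has_sum_imp_summable)
  show "(\<Sum>\<^sub>\<infinity>n. \<Sum>k=- int h..int h. (cmod (coord x (n + k)))\<^sup>2) = (2 * real h + 1) * (norm x)\<^sup>2"
    using hs by (rule infsumI)
qed

text \<open>An index \<open>n\<close> stands for the bond between the sites \<open>n\<close> and
  \<open>n + 1\<close>, as in \<open>jacobi\<close>; removing it therefore involves the values at
  both sites.\<close>

definition cut_bonds :: "int set \<Rightarrow> int \<Rightarrow> real" where
  "cut_bonds Z n = (if n \<in> Z then 0 else 1)"

lemma abs_cut_bonds: "\<bar>cut_bonds Z n\<bar> \<le> 1" by (simp add: cut_bonds_def)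

text \<open>Cutting the bond at \<open>c\<close> alters the image of \<open>x\<close> by its values
  at \<open>c\<close> and \<open>c + 1\<close> only. \<open>gap_decay\<close> bounds these by the
  mass of \<open>x\<close> in the window around \<open>c\<close>, up to the residual; summing
  squares over all window centres costs the factor \<open>2 * h + 1\<close> under the root.\<close>

lemma cut_approx:
  assumes \<eta>: "\<eta> > 0" and t: "t > 1" "2 * (t - 1) \<le> \<eta> / 2" and h: "h \<ge> 2"
    and V: "\<And>n. \<bar>V n\<bar> \<le> M"
    and Z: "\<And>c. c \<in> Z \<Longrightarrow> \<exists>W. (\<forall>n. \<bar>W n\<bar> \<le> M) \<and> (\<forall>x. \<eta> * norm x \<le> norm (schr W x - E *\<^sub>R x)) \<and>
      (\<forall>n. \<bar>n - c\<bar> \<le> int h \<longrightarrow> V n = W n)"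
    and E: "E \<in> approx_spec (schr V)"
  obtains x where "x \<noteq> 0"
    "norm (jacobi (cut_bonds Z) V x - E *\<^sub>R x) \<le> (4 * sqrt (2 * (2 * real h + 1)) / (t ^ (h - 1) - 1)) * norm x"
proof -
  have one: "\<And>n::int. \<bar>1::real\<bar> \<le> 1" by simp
  define D where "D = t ^ (h - 1) - 1"
  have D: "D > 0" using t(1) h by (simp add: D_def)
  \<comment> \<open>\<open>A\<close> and \<open>B\<close> arise by squaring the conclusion of
    \<open>gap_decay\<close> and dividing by the square of \<open>D\<close>, the lower bound of the
    tent at both ends of the cut bond: \<open>A\<close> multiplies the residual, \<open>B\<close>
    the local mass.\<close>
  define B where "B = 2 / D\<^sup>2"
  define X where "X = 2 / \<eta> * t ^ h"
  define A where "A = 2 * X\<^sup>2 / D\<^sup>2"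
  have B: "B > 0" using D by (simp add: B_def)
  have A: "A > 0" using D \<eta> t by (simp add: A_def X_def)
  define R where "R = sqrt ((2 * real h + 1) * B)"
  have R: "R > 0" using B by (simp add: R_def)
  \<comment> \<open>Since \<open>E\<close> lies in the approximate spectrum, the relative residual
    can be prescribed; here it is small enough to offset the large factor \<open>A\<close>, which
    contains a power of \<open>t ^ h\<close>.\<close>
  define \<tau> where "\<tau> = min R (sqrt (B / A))"
  have \<tau>: "\<tau> > 0" "\<tau> \<le> R" using R A B by (auto simp: \<tau>_def)
  have "\<tau>\<^sup>2 \<le> (sqrt (B / A))\<^sup>2" using \<tau>(1) by (intro power_mono) (auto simp: \<tau>_def)
  then have A\<tau>: "A * \<tau>\<^sup>2 \<le> B" using A B by (simp add: field_simps)
  obtain x where x: "x \<noteq> 0" "norm (schr V x - E *\<^sub>R x) \<le> \<tau> * norm x"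
    using E \<tau>(1) unfolding approx_spec_def by blast
  define f where "f = schr V x - E *\<^sub>R x"
  have loc: "(cmod (coord x n))\<^sup>2 \<le> A * (norm (rmul (window h c) f))\<^sup>2 + B * (norm (rmul (window h c) x))\<^sup>2"
    if c: "c \<in> Z" and n: "n \<in> {c, c + 1}" for c n
  proof -
    obtain W where W: "\<And>n. \<bar>W n\<bar> \<le> M" "\<And>x. \<eta> * norm x \<le> norm (schr W x - E *\<^sub>R x)"
      "\<And>n. \<bar>n - c\<bar> \<le> int h \<Longrightarrow> V n = W n" using Z[OF c] by blast
    let ?a = "X * norm (rmul (window h c) f)" and ?b = "norm (rmul (window h c) x)"
    have "h - 1 \<le> nat (int h - \<bar>n - c\<bar>)" using n by auto
    then have "D \<le> tent t h c n"
      unfolding D_def tent_def using t(1) by (intro diff_right_mono power_increasing) auto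
    then have "D * cmod (coord x n) \<le> tent t h c n * cmod (coord x n)" by (intro mult_right_mono) auto
    also have "\<dots> \<le> ?a + ?b"
      unfolding f_def X_def using t by (intro gap_decay[OF \<eta> W(2) W(1) V W(3)]) auto
    finally have "(D * cmod (coord x n))\<^sup>2 \<le> (?a + ?b)\<^sup>2" using D by (intro power_mono) auto
    also have "\<dots> \<le> 2 * ?a\<^sup>2 + 2 * ?b\<^sup>2"
      using zero_le_power2[of "?a - ?b"] by (simp add: power2_eq_square algebra_simps)
    finally have "(cmod (coord x n))\<^sup>2 \<le> (2 * ?a\<^sup>2 + 2 * ?b\<^sup>2) / D\<^sup>2"
      using D by (simp add: power_mult_distrib field_simps)
    then show ?thesis by (simp add: A_def B_def power_mult_distrib add_divide_distrib)
  qed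
  define z where "z n = (if n \<in> Z then 1 else 0::real)" for n
  have z: "\<bar>z n\<bar> \<le> 1" "\<bar>z (n - 1)\<bar> \<le> 1" for n by (auto simp: z_def)
  have fx: "norm f \<le> \<tau> * norm x" using x(2) by (simp add: f_def)
  have sum: "(\<Sum>\<^sub>\<infinity>n. A * (norm (rmul (window h n) f))\<^sup>2 + B * (norm (rmul (window h n) x))\<^sup>2)
      = (2 * real h + 1) * (A * (norm f)\<^sup>2 + B * (norm x)\<^sup>2)"
    and summ: "(\<lambda>n. A * (norm (rmul (window h n) f))\<^sup>2 + B * (norm (rmul (window h n) x))\<^sup>2) summable_on UNIV"
    unfolding norm_window_square
     apply (subst infsum_add; (intro summable_on_cmult_right window_sum_summable)?)
     apply (simp add: infsum_cmult_right' infsum_window_sum algebra_simps)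
    by (intro summable_on_add summable_on_cmult_right window_sum_summable)
  have tot: "(2 * real h + 1) * (A * (norm f)\<^sup>2 + B * (norm x)\<^sup>2) \<le> 2 * (R * norm x)\<^sup>2"
  proof -
    have "A * (norm f)\<^sup>2 \<le> A * (\<tau> * norm x)\<^sup>2" using fx A by (intro mult_left_mono power_mono) auto
    also have "\<dots> \<le> B * (norm x)\<^sup>2" using A\<tau> by (simp add: power_mult_distrib mult_right_mono flip: mult.assoc)
    finally have "(2 * real h + 1) * (A * (norm f)\<^sup>2 + B * (norm x)\<^sup>2) \<le> (2 * real h + 1) * (2 * B * (norm x)\<^sup>2)"
      by (intro mult_left_mono) auto
    also have "\<dots> = 2 * (R * norm x)\<^sup>2" using B by (simp add: R_def power_mult_distrib)
    finally show ?thesis .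
  qed
  \<comment> \<open>Rounding the square root of 2 up to \<open>3 / 2\<close> lets the residual and
    the two cut terms add up to the constant 4.\<close>
  have le32: "y \<le> 3 / 2 * (R * norm x)" if "y\<^sup>2 \<le> 2 * (R * norm x)\<^sup>2" for y
  proof (rule power2_le_imp_le)
    have "2 * (R * norm x)\<^sup>2 \<le> 9 / 4 * (R * norm x)\<^sup>2" by (intro mult_right_mono) auto
    also have "\<dots> = (3 / 2 * (R * norm x))\<^sup>2" by (simp add: power2_eq_square)
    finally show "y\<^sup>2 \<le> (3 / 2 * (R * norm x))\<^sup>2" using that by linarith
  qed (use R in simp)
  have bound: "norm y \<le> 3 / 2 * (R * norm x)"
    if y: "\<And>n. (cmod (coord y n))\<^sup>2
      \<le> A * (norm (rmul (window h n) f))\<^sup>2 + B * (norm (rmul (window h n) x))\<^sup>2" for y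
  proof (rule le32, rule order_trans[OF _ tot])
    show "(norm y)\<^sup>2 \<le> (2 * real h + 1) * (A * (norm f)\<^sup>2 + B * (norm x)\<^sup>2)"
      unfolding sum[symmetric] norm_l2_square[of y]
      by (intro infsum_mono coord_square_summable summ y)
  qed
  have n1: "norm (rmul z x) \<le> 3 / 2 * (R * norm x)"
  proof (rule bound)
    fix n
    show "(cmod (coord (rmul z x) n))\<^sup>2
      \<le> A * (norm (rmul (window h n) f))\<^sup>2 + B * (norm (rmul (window h n) x))\<^sup>2"
      using loc[of n n] A B unfolding coord_rmul[OF z(1)] by (cases "n \<in> Z") (auto simp: z_def)
  qed
  have "norm (shift 1 (rmul (\<lambda>n. z (n - 1)) x)) \<le> 3 / 2 * (R * norm x)"
  proof (rule bound)
    fix n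
    show "(cmod (coord (shift 1 (rmul (\<lambda>n. z (n - 1)) x)) n))\<^sup>2
      \<le> A * (norm (rmul (window h n) f))\<^sup>2 + B * (norm (rmul (window h n) x))\<^sup>2"
      using loc[of n "n + 1"] A B unfolding coord_shift coord_rmul[OF z(2)]
      by (cases "n \<in> Z") (auto simp: z_def)
  qed
  then have n2: "norm (rmul (\<lambda>n. z (n - 1)) x) \<le> 3 / 2 * (R * norm x)" by simp
  have "jacobi (cut_bonds Z) V x - E *\<^sub>R x = f - (shift (- 1) (rmul z x) + shift 1 (rmul (\<lambda>n. z (n - 1)) x))"
    by (rule l2_eqI, simp only: f_def schr_def coord_simps coord_shift coord_jacobi[OF one V]
        coord_jacobi[OF abs_cut_bonds V] coord_rmul[OF z(1)] coord_rmul[OF z(2)])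
      (simp add: cut_bonds_def z_def algebra_simps)
  also have "norm \<dots> \<le> norm f + (norm (rmul z x) + norm (rmul (\<lambda>n. z (n - 1)) x))"
    by (intro order_trans[OF norm_triangle_ineq4] add_left_mono order_trans[OF norm_triangle_ineq]) simp
  also have "\<dots> \<le> 4 * (R * norm x)"
    using n1 n2 fx mult_right_mono[OF \<tau>(2) norm_ge_zero[of x]] by linarith
  also have "4 * (R * norm x) = (4 * sqrt (2 * (2 * real h + 1)) / (t ^ (h - 1) - 1)) * norm x"
    using D unfolding D_def[symmetric] by (simp add: R_def B_def real_sqrt_mult real_sqrt_divide)
  finally show ?thesis using x(1) that by blast
qed

section \<open>Spectra of chains of finite pieces\<close>

text \<open>The Dirichlet solution: \<open>poly (dirichlet v i) E\<close> solves the eigenvalue equation with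
  potential \<open>v\<close> and the boundary values \<open>0\<close> at \<open>0\<close> and \<open>1\<close> at \<open>1\<close>.\<close>

fun dirichlet :: "(nat \<Rightarrow> real) \<Rightarrow> nat \<Rightarrow> real poly" where
  "dirichlet v 0 = 0"
| "dirichlet v (Suc 0) = 1"
| "dirichlet v (Suc (Suc i)) = [:- v (Suc i), 1:] * dirichlet v (Suc i) - dirichlet v i"

lemma dirichlet_monic: "degree (dirichlet v (Suc i)) \<le> i \<and> coeff (dirichlet v (Suc i)) i = 1"
proof (induction i rule: less_induct)
  case (less i)
  consider "i = 0" | "i = 1" | j where "i = Suc (Suc j)" by (metis One_nat_def not0_implies_Suc)
  then show ?case
  proof cases
    case 3
    define P Q where "P = dirichlet v (Suc (Suc j))" and "Q = dirichlet v (Suc j)"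
    have eq: "dirichlet v (Suc i) = [:- v (Suc (Suc j)), 1:] * P - Q"
      by (simp only: 3 dirichlet.simps P_def Q_def)
    have P: "degree P \<le> Suc j" "coeff P (Suc j) = 1" using less[of "Suc j"] 3 by (auto simp: P_def)
    have Q: "degree Q \<le> j" using less[of j] 3 by (auto simp: Q_def)
    have "degree ([:- v (Suc (Suc j)), 1:] * P) \<le> Suc (Suc j)"
      using degree_mult_le[of "[:- v (Suc (Suc j)), 1:]" P] P by simp
    then have "degree (dirichlet v (Suc i)) \<le> i"
      unfolding eq using Q 3 by (intro degree_diff_le) auto
    moreover have "coeff P (Suc (Suc j)) = 0" "coeff Q (Suc (Suc j)) = 0"
      using P Q by (auto intro!: coeff_eq_0)
    then have "coeff (dirichlet v (Suc i)) i = 1"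
      unfolding eq using P 3 by simp
    ultimately show ?thesis by simp
  qed simp_all
qed

text \<open>\<open>dirichlet v (Suc p)\<close> is the characteristic polynomial of the block of
  \<open>p\<close> sites, so a degree counts the eigenvalues of the block, whatever the
  potential.\<close>

lemma card_dirichlet_roots:
  "finite {E. poly (dirichlet v (Suc p)) E = 0}" "card {E. poly (dirichlet v (Suc p)) E = 0} \<le> p"
proof -
  have "dirichlet v (Suc p) \<noteq> 0" using dirichlet_monic[of v p] by auto
  then show "finite {E. poly (dirichlet v (Suc p)) E = 0}" "card {E. poly (dirichlet v (Suc p)) E = 0} \<le> p"
    using poly_roots_finite[of "dirichlet v (Suc p)"] card_poly_roots_bound[of "dirichlet v (Suc p)"]
      dirichlet_monic[of v p] by auto
qed

text \<open>A solution with source \<open>F\<close> is compared with the multiple of the homogeneous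
  solution having the same start. The error obeys the same recursion from zero data, and a step
  enlarges it at most by \<open>2 + \<bar>E\<bar> + M\<close>: one unit for the source, one for the
  value two steps back, the rest for the coefficient. For \<open>p = 0\<close> nothing makes
  \<open>S\<close> nonnegative, whence the disjunct.\<close>

lemma dirichlet_stable:
  fixes \<phi> :: "nat \<Rightarrow> complex"
  assumes rec: "\<And>i. 1 \<le> i \<Longrightarrow> i \<le> p \<Longrightarrow> \<phi> (Suc i) = F i + of_real (E - v i) * \<phi> i - \<phi> (i - 1)"
    and \<phi>0: "\<phi> 0 = 0" and v: "\<And>i. \<bar>v i\<bar> \<le> M" and S: "\<And>i. 1 \<le> i \<Longrightarrow> i \<le> p \<Longrightarrow> cmod (F i) \<le> S"
    and i: "i \<le> Suc p"
  shows "cmod (\<phi> i - \<phi> 1 * of_real (poly (dirichlet v i) E)) \<le> (2 + \<bar>E\<bar> + M) ^ i * S \<or> p = 0"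
proof (cases "p = 0")
  case False
  let ?K = "2 + \<bar>E\<bar> + M"
  have M: "0 \<le> M" using v[of 0] by linarith
  have S0: "0 \<le> S" using S[of 1] False norm_ge_zero order_trans by (metis One_nat_def Suc_leI neq0_conv le_refl)
  have K: "?K \<ge> 1" using M by simp
  let ?e = "\<lambda>i. \<phi> i - \<phi> 1 * of_real (poly (dirichlet v i) E)"
  have "i \<le> Suc p \<Longrightarrow> cmod (?e i) \<le> ?K ^ i * S" for i
  proof (induction i rule: less_induct)
    case (less i)
    consider "i = 0" | "i = 1" | j where "i = Suc (Suc j)" by (metis One_nat_def not0_implies_Suc)
    then show ?case
    proof cases
      case 3
      have e: "?e i = F (Suc j) + of_real (E - v (Suc j)) * ?e (Suc j) - ?e j"
        using rec[of "Suc j"] less.prems 3 by (simp add: algebra_simps)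
      have "cmod (?e i) \<le> cmod (F (Suc j)) + \<bar>E - v (Suc j)\<bar> * cmod (?e (Suc j)) + cmod (?e j)"
      proof -
        have "cmod (a + b - d) \<le> cmod a + cmod b + cmod d" for a b d
          using norm_triangle_ineq4[of "a + b" d] norm_triangle_ineq[of a b] by linarith
        then show ?thesis unfolding e by (metis norm_mult norm_of_real)
      qed
      also have "\<dots> \<le> S + (\<bar>E\<bar> + M) * (?K ^ Suc j * S) + ?K ^ j * S"
        using less.IH[of "Suc j"] less.IH[of j] less.prems 3 S[of "Suc j"] v[of "Suc j"] M
        by (intro add_mono mult_mono) auto
      also have "\<dots> \<le> ?K ^ Suc j * S + (\<bar>E\<bar> + M) * (?K ^ Suc j * S) + ?K ^ Suc j * S"
      proof -
        have "1 * S \<le> ?K ^ Suc j * S" using K S0 by (intro mult_right_mono one_le_power) auto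
        moreover have "?K ^ j * S \<le> ?K ^ Suc j * S" using K S0 by (intro mult_right_mono power_increasing) auto
        ultimately show ?thesis by linarith
      qed
      also have "\<dots> = ?K ^ i * S" by (simp add: 3 algebra_simps)
      finally show ?thesis .
    qed (use S0 \<phi>0 K in auto)
  qed
  with i show ?thesis by blast
qed simp

text \<open>If \<open>E\<close> is no root, the Dirichlet condition at the right end bounds the
  first value of a block by the source, and hence all its values by the residual. Periodicity gives
  all blocks the same potential, so one constant serves everywhere and \<open>E\<close> is outside
  the approximate spectrum.\<close>

lemma approx_spec_cut_subset:
  assumes p: "p \<ge> 1" and V: "\<And>n. \<bar>V n\<bar> \<le> M" and per: "\<And>n. V (n + int p) = V n"
  shows "approx_spec (jacobi (cut_bonds {n. (n - c) mod int p = 0}) V)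
    \<subseteq> {E. poly (dirichlet (\<lambda>i. V (c + int i)) (Suc p)) E = 0}"
proof
  fix E
  let ?Z = "{n. (n - c) mod int p = 0}"
  let ?J = "jacobi (cut_bonds ?Z) V"
  define v where "v i = V (c + int i)" for i
  let ?u = "\<lambda>i. poly (dirichlet v i) E"
  assume E: "E \<in> approx_spec ?J"
  have "?u (Suc p) = 0"
  proof (rule ccontr)
    assume u: "?u (Suc p) \<noteq> 0"
    define K where "K = (2 + \<bar>E\<bar> + M) ^ Suc p"
    have M: "0 \<le> M" using V[of 0] by linarith
    have K: "K \<ge> 1" using M unfolding K_def by (intro one_le_power) simp
    define C where "C = (\<Sum>i\<le>p. \<bar>?u i\<bar>) * K / \<bar>?u (Suc p)\<bar> + K"
    have C: "C > 0" using K by (auto simp: C_def intro!: add_nonneg_pos sum_nonneg divide_nonneg_nonneg mult_nonneg_nonneg)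
    have perm: "V (n + int p * m) = V n" for n m
    proof (induction m rule: int_induct[where k = 0])
      case (step1 i)
      then show ?case using per[of "n + int p * i"] by (simp add: algebra_simps)
    next
      case (step2 i)
      then show ?case using per[of "n + int p * (i - 1)"] by (simp add: algebra_simps)
    qed simp
    have point: "cmod (coord x n) \<le> C * (\<Sum>k=- int p..int p. cmod (coord (?J x - E *\<^sub>R x) (n + k)))" for x n
    proof -
      define f where "f = ?J x - E *\<^sub>R x"
      \<comment> \<open>\<open>b\<close> is the last cut bond to the left of \<open>n\<close>; its
        block consists of the sites \<open>b + 1\<close> to \<open>b + p\<close>, and
        \<open>i0\<close> is the place of \<open>n\<close> in it.\<close>
      define b where "b = c + int p * ((n - 1 - c) div int p)"
      define i0 where "i0 = Suc (nat ((n - 1 - c) mod int p))"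
      have md: "0 \<le> (n - 1 - c) mod int p" "(n - 1 - c) mod int p < int p" using p by auto
      have i0: "1 \<le> i0" "i0 \<le> p" "n = b + int i0"
      proof -
        show "1 \<le> i0" by (simp add: i0_def)
        show "i0 \<le> p" using md by (simp add: i0_def)
        have "n - 1 - c = int p * ((n - 1 - c) div int p) + (n - 1 - c) mod int p" by simp
        then show "n = b + int i0" using md unfolding b_def i0_def by simp
      qed
      have bZ: "b + int i \<in> ?Z \<longleftrightarrow> i = 0 \<or> i = p" if "i \<le> p" for i
      proof -
        have "(b + int i - c) mod int p = int i mod int p" by (simp add: b_def)
        then show ?thesis using that p by (cases "i = p") auto
      qed
      have Vb: "V (b + int i) = v i" for i
        using perm[of "c + int i" "(n - 1 - c) div int p"] by (simp add: b_def v_def algebra_simps)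
      \<comment> \<open>Extending by \<open>0\<close> beyond the block is consistent with the
        equation because both end bonds are cut; it supplies the two Dirichlet conditions.\<close>
      define \<phi> where "\<phi> i = (if 1 \<le> i \<and> i \<le> p then coord x (b + int i) else 0)" for i
      define S where "S = (\<Sum>k=- int p..int p. cmod (coord f (n + k)))"
      have rec: "\<phi> (Suc i) = coord f (b + int i) + of_real (E - v i) * \<phi> i - \<phi> (i - 1)" if i: "1 \<le> i" "i \<le> p" for i
      proof -
        have "coord f (b + int i) = of_real (cut_bonds ?Z (b + int i - 1)) * coord x (b + int i - 1)
            + of_real (cut_bonds ?Z (b + int i)) * coord x (b + int i + 1) + of_real (v i - E) * coord x (b + int i)"
          by (simp add: f_def coord_jacobi[OF abs_cut_bonds V] Vb scaleR_conv_of_real algebra_simps)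
        also have "of_real (cut_bonds ?Z (b + int i - 1)) * coord x (b + int i - 1) = \<phi> (i - 1)"
        proof -
          have eq: "b + int i - 1 = b + int (i - 1)" using i by simp
          have ct: "cut_bonds ?Z (b + int (i - 1)) = (if i = 1 then 0 else 1)"
            using bZ[of "i - 1"] i unfolding cut_bonds_def by auto
          show ?thesis unfolding eq ct using i by (auto simp: \<phi>_def)
        qed
        also have "of_real (cut_bonds ?Z (b + int i)) * coord x (b + int i + 1) = \<phi> (Suc i)"
        proof -
          have "cut_bonds ?Z (b + int i) = (if i = p then 0 else 1)" using bZ[of i] i unfolding cut_bonds_def by auto
          then show ?thesis using i by (simp add: \<phi>_def add.commute add.left_commute)
        qed
        finally show ?thesis using i by (simp add: \<phi>_def algebra_simps)
      qed
      have FS: "cmod (coord f (b + int i)) \<le> S" if i: "1 \<le> i" "i \<le> p" for i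
      proof -
        have "cmod (coord f (n + (b + int i - n))) \<le> S"
          unfolding S_def using i i0 by (intro member_le_sum) auto
        then show ?thesis by simp
      qed
      have S0: "0 \<le> S" unfolding S_def by (intro sum_nonneg) simp
      have stab: "cmod (\<phi> i - \<phi> 1 * of_real (?u i)) \<le> K * S" if "i \<le> Suc p" for i
      proof -
        have "cmod (\<phi> i - \<phi> 1 * of_real (?u i)) \<le> (2 + \<bar>E\<bar> + M) ^ i * S"
          using dirichlet_stable[of p \<phi> "\<lambda>i. coord f (b + int i)" E v M S i] rec FS that p V
          by (auto simp: v_def \<phi>_def)
        also have "\<dots> \<le> K * S" unfolding K_def using that M S0 by (intro mult_right_mono power_increasing) auto
        finally show ?thesis .
      qed
      have "cmod (\<phi> 1) * \<bar>?u (Suc p)\<bar> \<le> K * S"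
        using stab[of "Suc p"] by (simp add: \<phi>_def norm_mult)
      then have \<phi>1: "cmod (\<phi> 1) \<le> K * S / \<bar>?u (Suc p)\<bar>" using u by (simp add: field_simps)
      have "cmod (\<phi> i0) \<le> cmod (\<phi> 1 * of_real (?u i0)) + cmod (\<phi> i0 - \<phi> 1 * of_real (?u i0))"
        by (metis add.commute diff_add_cancel norm_triangle_ineq)
      also have "\<dots> \<le> K * S / \<bar>?u (Suc p)\<bar> * (\<Sum>i\<le>p. \<bar>?u i\<bar>) + K * S"
      proof (intro add_mono stab)
        have "\<bar>?u i0\<bar> \<le> (\<Sum>i\<le>p. \<bar>?u i\<bar>)" using i0 by (intro member_le_sum) auto
        then show "cmod (\<phi> 1 * of_real (?u i0)) \<le> K * S / \<bar>?u (Suc p)\<bar> * (\<Sum>i\<le>p. \<bar>?u i\<bar>)"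
          unfolding norm_mult using \<phi>1 K S0 by (intro mult_mono) auto
      qed (use i0 in simp)
      also have "\<dots> = C * S" by (simp add: C_def algebra_simps)
      finally show ?thesis using i0 by (simp add: \<phi>_def S_def f_def)
    qed
    \<comment> \<open>One factor \<open>2 * p + 1\<close> under the square comes from Cauchy-Schwarz
      on the window, the other from double counting.\<close>
    have "norm x \<le> C * (2 * real p + 1) * norm (?J x - E *\<^sub>R x)" for x
    proof -
      let ?f = "?J x - E *\<^sub>R x"
      have "(norm x)\<^sup>2 \<le> (\<Sum>\<^sub>\<infinity>n. C\<^sup>2 * (2 * real p + 1) * (\<Sum>k=- int p..int p. (cmod (coord ?f (n + k)))\<^sup>2))"
        unfolding norm_l2_square[of x]
      proof (intro infsum_mono coord_square_summable summable_on_cmult_right window_sum_summable)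
        fix n
        have "(cmod (coord x n))\<^sup>2 \<le> (C * (\<Sum>k=- int p..int p. cmod (coord ?f (n + k))))\<^sup>2"
          by (intro power_mono point) simp
        also have "\<dots> \<le> C\<^sup>2 * ((\<Sum>k=- int p..int p. (cmod (coord ?f (n + k)))\<^sup>2) * real (card {- int p..int p}))"
          unfolding power_mult_distrib by (intro mult_left_mono sum_squared_le_sum_of_squares) auto
        finally show "(cmod (coord x n))\<^sup>2 \<le> C\<^sup>2 * (2 * real p + 1) * (\<Sum>k=- int p..int p. (cmod (coord ?f (n + k)))\<^sup>2)"
          by (simp add: algebra_simps)
      qed
      also have "\<dots> = (C * (2 * real p + 1) * norm ?f)\<^sup>2"
        unfolding infsum_cmult_right' infsum_window_sum by (simp add: power2_eq_square algebra_simps)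
      finally show ?thesis by (rule power2_le_imp_le) (use C in simp)
    qed
    moreover have "C * (2 * real p + 1) > 0" using C by simp
    ultimately have "1 / (C * (2 * real p + 1)) > 0"
      "\<forall>x. 1 / (C * (2 * real p + 1)) * norm x \<le> norm (?J x - E *\<^sub>R x)"
      by (auto simp: field_simps)
    then have "E \<notin> approx_spec ?J" unfolding not_approx_spec_iff by blast
    with E show False by simp
  qed
  then show "E \<in> {E. poly (dirichlet (\<lambda>i. V (c + int i)) (Suc p)) E = 0}" by (simp add: v_def[abs_def])
qed

section \<open>Concatenations of periodic potentials\<close>

text \<open>One cut per period \<open>2 * m * P * L\<close> leaves pieces with at most that many
  eigenvalues, and there are \<open>m\<close> choices of the block to cut. The radius is
  exponentially small in \<open>P * L\<close>, so a large \<open>L\<close> makes the sum small for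
  each fixed \<open>s > 0\<close>.\<close>

lemma block_cover:
  fixes V :: "nat \<Rightarrow> int \<Rightarrow> real"
  assumes m: "m \<ge> 1" and P: "P \<ge> 1" and s: "s > 0" and \<epsilon>: "\<epsilon> > 0" and \<eta>: "\<eta> > 0"
    and V: "\<And>i n. i < m \<Longrightarrow> \<bar>V i n\<bar> \<le> M" and per: "\<And>i n. i < m \<Longrightarrow> V i (n + int P) = V i n"
    and gap: "\<And>E. E \<in> C \<Longrightarrow> \<exists>i<m. \<forall>x. \<eta> * norm x \<le> norm (schr (V i) x - E *\<^sub>R x)"
  obtains L S r where "L \<ge> 1" "finite S" "r > 0" "real (card S) * r powr s < \<epsilon>"
    "approx_spec (schr (\<lambda>n. V (nat (((n - 1) div int (2 * P * L)) mod int m)) n)) \<inter> C \<subseteq> (\<Union>F\<in>S. ball F r)"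
proof -
  \<comment> \<open>The largest base that \<open>cut_approx\<close> admits for this
    \<open>\<eta>\<close>.\<close>
  define t where "t = 1 + \<eta> / 4"
  define a where "a = ln t"
  have t: "t > 1" "2 * (t - 1) \<le> \<eta> / 2" using \<eta> by (auto simp: t_def)
  then have a: "a > 0" by (simp add: a_def)
  have ta: "t ^ j = exp (a * real j)" for j
    using t by (simp add: a_def exp_of_nat_mult[symmetric] mult.commute flip: exp_of_nat_mult)
      (metis exp_ln exp_of_nat_mult less_trans zero_less_one)
  \<comment> \<open>Twice the error of \<open>cut_approx\<close> as a function of
    \<open>x = P * L\<close>, with \<open>h = x - 1\<close>; doubling allows open balls later
    on.\<close>
  define \<rho> where "\<rho> x = 2 * (4 * sqrt (2 * (2 * (x - 1) + 1)) / (exp (a * (x - 2)) - 1))" for x :: real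
  have "((\<lambda>x. x * \<rho> x powr s) \<longlongrightarrow> 0) at_top"
    unfolding \<rho>_def using a s by real_asymp
  then have lim: "((\<lambda>x. (2 * real m ^ 2) * (x * \<rho> x powr s)) \<longlongrightarrow> 0) at_top"
    by (rule tendsto_mult_right_zero)
  have "filterlim (\<lambda>L. real (P * L)) at_top sequentially"
    using P by real_asymp
  from filterlim_compose[OF lim this]
  have "\<forall>\<^sub>F L in sequentially. (2 * real m ^ 2) * (real (P * L) * \<rho> (real (P * L)) powr s) < \<epsilon>"
    using \<epsilon> by (auto dest: order_tendstoD(2))
  then obtain L0 where L0: "\<And>L. L \<ge> L0 \<Longrightarrow> (2 * real m ^ 2) * (real (P * L) * \<rho> (real (P * L)) powr s) < \<epsilon>"
    unfolding eventually_sequentially by blast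
  define L where "L = max L0 3"
  have L: "L \<ge> 3" "(2 * real m ^ 2) * (real (P * L) * \<rho> (real (P * L)) powr s) < \<epsilon>"
    using L0[of L] by (auto simp: L_def)
  have PL: "P * L \<ge> 3" using P L(1) mult_le_mono[of 1 P 3 L] by simp
  define l where "l = 2 * P * L"
  \<comment> \<open>A window of radius \<open>h\<close> about the centre of a block reaches from its
    first site to its last but one, so it stays inside; \<open>L \<ge> 3\<close> gives
    \<open>h \<ge> 2\<close>.\<close>
  define h where "h = P * L - 1"
  have h: "h \<ge> 2" "real h = real (P * L) - 1" "real (h - 1) = real (P * L) - 2"
    using PL by (auto simp: h_def of_nat_diff simp flip: of_nat_mult)
  define W where "W n = V (nat (((n - 1) div int l) mod int m)) n" for n
  have idx: "nat (z mod int m) < m" for z using m by (simp add: nat_less_iff)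
  have W: "\<bar>W n\<bar> \<le> M" for n unfolding W_def using V[OF idx] by blast
  have perm: "V i (n + int P * int j) = V i n" if "i < m" for i n j
  proof (induction j)
    case (Suc j)
    then show ?case using per[OF that, of "n + int P * int j"] by (simp add: algebra_simps)
  qed simp
  define p where "p = m * l"
  have l: "l > 0" using P L(1) by (simp add: l_def)
  have p: "p \<ge> 1" using m l by (simp add: p_def)
  have Wper: "W (n + int p) = W n" for n
  proof -
    have "(n + int p - 1) div int l = (n - 1) div int l + int m"
    proof -
      have eq: "n + int p - 1 = (n - 1) + int m * int l" by (simp add: p_def)
      show ?thesis unfolding eq using l by (subst div_mult_self1) auto
    qed
    then have same: "nat (((n + int p - 1) div int l) mod int m) = nat (((n - 1) div int l) mod int m)" by simp
    have pP: "int p = int P * int (m * 2 * L)" by (simp add: p_def l_def)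
    show ?thesis unfolding W_def same unfolding pP by (rule perm[OF idx])
  qed
  define c where "c i = int i * int l + int (P * L)" for i
  \<comment> \<open>For an energy in the gap of \<open>V i\<close> the cuts lie in the copies of
    block \<open>i\<close>; the union over \<open>i\<close> makes the set of centres independent of
    the energy.\<close>
  define S where "S = (\<Union>i<m. {E. poly (dirichlet (\<lambda>j. W (c i + int j)) (Suc p)) E = 0})"
  have fin: "finite S" unfolding S_def using card_dirichlet_roots(1) by blast
  have "card S \<le> (\<Sum>i<m. card {E. poly (dirichlet (\<lambda>j. W (c i + int j)) (Suc p)) E = 0})"
    unfolding S_def by (rule card_UN_le) simp
  also have "\<dots> \<le> (\<Sum>i<m. p)" by (intro sum_mono card_dirichlet_roots(2))
  finally have card: "card S \<le> m * p" by simp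
  define \<theta> where "\<theta> = 4 * sqrt (2 * (2 * real h + 1)) / (t ^ (h - 1) - 1)"
  have \<theta>: "\<theta> > 0" using t(1) h(1) by (simp add: \<theta>_def)
  have \<theta>\<rho>: "2 * \<theta> = \<rho> (real (P * L))" unfolding \<theta>_def \<rho>_def ta h(3) by (simp add: h(2))
  have "real (card S) * (2 * \<theta>) powr s \<le> real (m * p) * (2 * \<theta>) powr s"
    using card by (intro mult_right_mono) (auto simp flip: of_nat_mult)
  also have "\<dots> < \<epsilon>"
    using L(2) unfolding \<theta>\<rho> by (simp add: p_def l_def power2_eq_square algebra_simps)
  finally have small: "real (card S) * (2 * \<theta>) powr s < \<epsilon>" .
  have "approx_spec (schr W) \<inter> C \<subseteq> (\<Union>F\<in>S. ball F (2 * \<theta>))"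
  proof
    fix E assume E: "E \<in> approx_spec (schr W) \<inter> C"
    then obtain i where i: "i < m" "\<And>x. \<eta> * norm x \<le> norm (schr (V i) x - E *\<^sub>R x)"
      using gap by blast
    let ?Z = "{n. (n - c i) mod int p = 0}"
    have agree: "W n = V i n" if c': "c' \<in> ?Z" and n: "\<bar>n - c'\<bar> \<le> int h" for c' n
    proof -
      have "int p dvd c' - c i" using c' by (simp add: mod_eq_0_iff_dvd)
      then obtain j where "c' - c i = int p * j" by (rule dvdE)
      then have j: "c' = c i + int p * j" by simp
      let ?b = "int i + int m * j"
      have "c' = ?b * int l + int (P * L)" by (simp add: j c_def p_def algebra_simps)
      then have "?b * int l \<le> n - 1" "n - 1 < ?b * int l + int l"
        using n PL unfolding h_def l_def by linarith+
      then have "(n - 1) div int l = ?b" by (intro int_div_pos_eq[where r = "n - 1 - ?b * int l"]) auto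
      then show ?thesis using i(1) by (simp add: W_def)
    qed
    obtain x where x: "x \<noteq> 0" "norm (jacobi (cut_bonds ?Z) W x - E *\<^sub>R x) \<le> \<theta> * norm x"
    proof (rule cut_approx[OF \<eta> t h(1) W, of ?Z E])
      show "\<exists>W'. (\<forall>n. \<bar>W' n\<bar> \<le> M) \<and> (\<forall>x. \<eta> * norm x \<le> norm (schr W' x - E *\<^sub>R x)) \<and>
          (\<forall>n. \<bar>n - c'\<bar> \<le> int h \<longrightarrow> W n = W' n)" if "c' \<in> ?Z" for c'
        using agree[OF that] i V[OF i(1)] by (intro exI[of _ "V i"]) auto
    qed (use E in \<open>auto simp: \<theta>_def\<close>)
    obtain E' where E': "E' \<in> approx_spec (jacobi (cut_bonds ?Z) W)" "\<bar>E - E'\<bar> \<le> \<theta>"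
      using approx_spec_near[OF bounded_linear_jacobi[OF abs_cut_bonds W] inner_jacobi[OF abs_cut_bonds W] x]
      by blast
    have "E' \<in> S" using approx_spec_cut_subset[where V = W and c = "c i", OF p W Wper] E'(1) i(1) unfolding S_def by blast
    moreover have "E \<in> ball E' (2 * \<theta>)" using E'(2) \<theta> by (simp add: dist_real_def abs_minus_commute)
    ultimately show "E \<in> (\<Union>F\<in>S. ball F (2 * \<theta>))" by blast
  qed
  moreover have "W = (\<lambda>n. V (nat (((n - 1) div int (2 * P * L)) mod int m)) n)"
    by (simp add: W_def[abs_def] l_def)
  ultimately show ?thesis using that[of L S "2 * \<theta>"] L(1) fin \<theta> small by simp
qed

section \<open>Sets of zero Hausdorff dimension\<close>

text \<open>The intervals are open so that a cover of a compact spectrum also covers all nearby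
  spectra; the radii are positive so that they can be recovered from
  \<open>r i powr s\<close>.\<close>

definition thin :: "real \<Rightarrow> real \<Rightarrow> real set \<Rightarrow> bool" where
  "thin s \<epsilon> A \<longleftrightarrow> (\<exists>a r. (\<forall>i::nat. r i > 0) \<and> summable (\<lambda>i. r i powr s) \<and>
     (\<Sum>i. r i powr s) < \<epsilon> \<and> A \<subseteq> (\<Union>i. ball (a i) (r i)))"

lemma countable_imp_thin:
  assumes "countable S" "s > 0" "\<epsilon> > 0"
  shows "thin s \<epsilon> S"
proof -
  obtain a :: "nat \<Rightarrow> real" where a: "S \<subseteq> range a"
    using range_from_nat_into[OF _ assms(1)] by (cases "S = {}") auto
  \<comment> \<open>Prescribes \<open>r i powr s\<close> as a geometric sequence with sum
    \<open>\<epsilon> / 2\<close>.\<close>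
  define r where "r i = (\<epsilon> / 4 * (1 / 2) ^ i) powr (1 / s)" for i :: nat
  have rs: "r i powr s = \<epsilon> / 4 * (1 / 2) ^ i" for i
    using assms by (simp add: r_def powr_powr)
  have "(\<lambda>i. \<epsilon> / 4 * (1 / 2) ^ i) sums (\<epsilon> / 4 * (1 / (1 - 1 / 2)))"
    by (intro sums_mult geometric_sums) simp
  then have sums: "(\<lambda>i. r i powr s) sums (\<epsilon> / 2)" by (simp add: rs)
  have r: "r i > 0" for i using assms by (simp add: r_def)
  have "range a \<subseteq> (\<Union>i. ball (a i) (r i))"
  proof safe
    fix i
    have "a i \<in> ball (a i) (r i)" using r by simp
    then show "a i \<in> (\<Union>i. ball (a i) (r i))" by blast
  qed
  with a show ?thesis unfolding thin_def using sums r assms(3)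
    by (intro exI[of _ a] exI[of _ r]) (auto simp: sums_iff)
qed

lemma thin_append:
  fixes S :: "real set"
  assumes r: "\<And>i::nat. r i > 0" "summable (\<lambda>i. r i powr s)" "(\<Sum>i. r i powr s) < \<epsilon>1"
    and S: "finite S" "\<rho> > 0" "real (card S) * \<rho> powr s < \<epsilon>2"
    and A: "A \<subseteq> (\<Union>i. ball (a i) (r i)) \<union> (\<Union>F\<in>S. ball F \<rho>)"
  shows "thin s (\<epsilon>1 + \<epsilon>2) A"
proof -
  let ?k = "card S"
  obtain f where f: "bij_betw f {0..<?k} S" using ex_bij_betw_nat_finite[OF S(1)] by blast
  define a' where "a' i = (if i < ?k then f i else a (i - ?k))" for i
  define r' where "r' i = (if i < ?k then \<rho> else r (i - ?k))" for i
  have r': "r' i > 0" for i using r S by (simp add: r'_def)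
  have shifted: "(\<lambda>i. r' (i + ?k) powr s) = (\<lambda>i. r i powr s)" by (simp add: r'_def)
  have sm: "summable (\<lambda>i. r' i powr s)"
    using r(2) unfolding shifted[symmetric] by (subst (asm) summable_iff_shift)
  have "(\<Sum>i. r' i powr s) = (\<Sum>i. r i powr s) + (\<Sum>i<?k. r' i powr s)"
    unfolding suminf_split_initial_segment[OF sm, of ?k] shifted ..
  also have "(\<Sum>i<?k. r' i powr s) = real ?k * \<rho> powr s" by (simp add: r'_def)
  finally have "(\<Sum>i. r' i powr s) < \<epsilon>1 + \<epsilon>2" using r(3) S(3) by simp
  moreover have "A \<subseteq> (\<Union>i. ball (a' i) (r' i))"
  proof
    fix x assume "x \<in> A"
    then consider i where "x \<in> ball (a i) (r i)" | F where "F \<in> S" "x \<in> ball F \<rho>" using A by blast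
    then show "x \<in> (\<Union>i. ball (a' i) (r' i))"
    proof cases
      case 1
      then have "x \<in> ball (a' (i + ?k)) (r' (i + ?k))" by (simp add: a'_def r'_def)
      then show ?thesis by blast
    next
      case 2
      then obtain i where "i < ?k" "f i = F"
        using bij_betw_imp_surj_on[OF f] by (metis atLeastLessThan_iff imageE)
      then have "x \<in> ball (a' i) (r' i)" using 2 by (simp add: a'_def r'_def)
      then show ?thesis by blast
    qed
  qed
  ultimately show ?thesis unfolding thin_def using r' sm by blast
qed

text \<open>Each term is at most the sum, so every radius is at most
  \<open>(1 / real N) powr real N\<close> and in particular at most 1; raising the exponent then
  only decreases the powers. One cover thus serves all \<open>s \<ge> 1 / N\<close>.\<close>

lemma thin_radius:
  assumes r: "\<And>i::nat. r i > 0" "summable (\<lambda>i. r i powr (1 / real N))" "(\<Sum>i. r i powr (1 / real N)) < 1 / real N"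
    and N: "N \<ge> 1"
  shows "r i \<le> 1 / real N" "s \<ge> 1 / real N \<Longrightarrow> r i powr s \<le> r i powr (1 / real N)"
proof -
  have "r i powr (1 / real N) \<le> (\<Sum>i. r i powr (1 / real N))"
    using sum_le_suminf[OF r(2), of "{i}"] by simp
  then have le: "r i powr (1 / real N) \<le> 1 / real N" using r(3) by linarith
  have "r i = (r i powr (1 / real N)) powr real N" using r(1)[of i] N by (simp add: powr_powr)
  also have "\<dots> \<le> (1 / real N) powr real N" using le by (intro powr_mono2) auto
  also have "\<dots> \<le> (1 / real N) powr 1" using N by (intro powr_mono') auto
  finally show ri: "r i \<le> 1 / real N" using N by simp
  also have "\<dots> \<le> 1" using N by simp
  finally show "s \<ge> 1 / real N \<Longrightarrow> r i powr s \<le> r i powr (1 / real N)"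
    using r(1)[of i] by (intro powr_mono') auto
qed

lemma thin_hausdorff_dim:
  assumes thin: "\<And>n. thin (1 / real (Suc n)) (1 / real (Suc n)) K"
  shows "hausdorff_dim K = 0"
proof -
  have "hausdorff_premeasure s \<delta> K = 0" if s: "s > 0" and \<delta>: "\<delta> > 0" for s \<delta>
  proof -
    have "hausdorff_premeasure s \<delta> K \<le> 0 + ennreal e" if e: "e > 0" for e
    proof -
      \<comment> \<open>The three bounds make the exponent \<open>1 / N\<close> at most
        \<open>s\<close>, absorb the factor \<open>2 powr s\<close> between radius and diameter, and
        bring the diameters below \<open>\<delta>\<close>.\<close>
      obtain n where n: "real n \<ge> max (1 / s) (max (2 powr s / e) (2 / \<delta>))" using real_arch_simple by blast
      define N where "N = Suc n"
      have N: "N \<ge> 1" "1 / real N \<le> s" "2 powr s * (1 / real N) \<le> e" "2 * (1 / real N) \<le> \<delta>"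
        using n s e \<delta> by (auto simp: N_def field_simps)
      obtain a r where r: "\<And>i::nat. r i > 0" "summable (\<lambda>i. r i powr (1 / real N))"
        "(\<Sum>i. r i powr (1 / real N)) < 1 / real N" and K: "K \<subseteq> (\<Union>i. ball (a i) (r i))"
        using thin[of n] unfolding thin_def N_def by blast
      note rad = thin_radius[OF r N(1)]
      have "hausdorff_premeasure s \<delta> K \<le> (\<Sum>i. diam_pow s (ball (a i) (r i)))"
        unfolding hausdorff_premeasure_def
      proof (rule INF_lower, intro CollectI conjI K allI)
        fix i
        show "bounded (ball (a i) (r i))" by simp
        show "diameter (ball (a i) (r i)) \<le> \<delta>"
          using rad(1)[of i] N(4) r(1)[of i] by (simp add: diameter_ball)
      qed
      also have "\<dots> = (\<Sum>i. ennreal (2 powr s * r i powr s))"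
      proof (rule suminf_cong)
        fix i
        have "ball (a i) (r i) \<noteq> {}" using r(1)[of i] by auto
        then show "diam_pow s (ball (a i) (r i)) = ennreal (2 powr s * r i powr s)"
          using r(1)[of i] s by (simp add: diam_pow_def diameter_ball powr_mult)
      qed
      also have "\<dots> \<le> (\<Sum>i. ennreal (2 powr s * r i powr (1 / real N)))"
        using rad(2)[OF N(2)] by (intro suminf_le ennreal_leI mult_left_mono) auto
      also have "\<dots> = ennreal (\<Sum>i. 2 powr s * r i powr (1 / real N))"
        by (intro suminf_ennreal2 summable_mult r) simp
      also have "(\<Sum>i. 2 powr s * r i powr (1 / real N)) = 2 powr s * (\<Sum>i. r i powr (1 / real N))"
        by (rule suminf_mult[OF r(2)])
      also have "ennreal \<dots> \<le> ennreal e"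
        using r(3) N(3) by (intro ennreal_leI order_trans[OF mult_left_mono N(3)]) auto
      finally show ?thesis by simp
    qed
    then show ?thesis by (metis ennreal_le_epsilon le_zero_eq)
  qed
  then have "hausdorff_measure s K = 0" if "s > 0" for s
    using that unfolding hausdorff_measure_def by (simp add: SUP_eq_const) 
  then have "hausdorff_dim K \<le> 0 + ennreal s" if "s > 0" for s
    unfolding hausdorff_dim_def using that by (simp, intro INF_lower) auto
  then show ?thesis by (metis ennreal_le_epsilon le_zero_eq)
qed

text \<open>With exponent 1 in \<open>thin_radius\<close> the cover has total length below
  \<open>2 / N\<close>, too short for an interval of length \<open>2 * e\<close>.\<close>

lemma thin_interior:
  assumes thin: "\<And>n. thin (1 / real (Suc n)) (1 / real (Suc n)) K"
  shows "interior K = {}"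
proof (rule ccontr)
  assume "interior K \<noteq> {}"
  then obtain x e where e: "e > 0" "ball x e \<subseteq> K" using mem_interior by blast
  obtain n where n: "real n \<ge> 1 / e" using real_arch_simple by blast
  define N where "N = Suc n"
  have N: "N \<ge> 1" "1 / real N < e" using n e(1) by (auto simp: N_def field_simps)
  obtain a r where r: "\<And>i::nat. r i > 0" "summable (\<lambda>i. r i powr (1 / real N))"
    "(\<Sum>i. r i powr (1 / real N)) < 1 / real N" and K: "K \<subseteq> (\<Union>i. ball (a i) (r i))"
    using thin[of n] unfolding thin_def N_def by blast
  have ball: "emeasure lborel (ball y d) = ennreal (2 * d)" if "d > 0" for y d :: real
    using that by (simp add: ball_eq_greaterThanLessThan)
  have r1: "r i \<le> r i powr (1 / real N)" for i
    using thin_radius(2)[OF r N(1), of 1 i] N(1) r(1)[of i] by simp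
  have "ennreal (2 * e) = emeasure lborel (ball x e)" using ball e(1) by simp
  also have "\<dots> \<le> emeasure lborel (\<Union>i. ball (a i) (r i))" using K e(2) by (intro emeasure_mono) auto
  also have "\<dots> \<le> (\<Sum>i. emeasure lborel (ball (a i) (r i)))"
    by (intro emeasure_subadditive_countably) auto
  also have "\<dots> = (\<Sum>i. ennreal (2 * r i))" by (simp add: ball r(1))
  also have "\<dots> \<le> (\<Sum>i. ennreal (2 * r i powr (1 / real N)))"
    using r1 by (intro suminf_le ennreal_leI) auto
  also have "\<dots> = ennreal (\<Sum>i. 2 * r i powr (1 / real N))"
    by (intro suminf_ennreal2 summable_mult r) simp
  also have "(\<Sum>i. 2 * r i powr (1 / real N)) = 2 * (\<Sum>i. r i powr (1 / real N))"
    by (rule suminf_mult[OF r(2)])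
  finally have "2 * e \<le> 2 * (\<Sum>i. r i powr (1 / real N))"
    using r(2) by (subst (asm) ennreal_le_iff) (auto intro!: suminf_nonneg)
  then show False using r(3) N(2) by linarith
qed

section \<open>Absence of isolated spectral points\<close>

lemma schr_eigen_rec:
  assumes V: "\<And>n. \<bar>V n\<bar> \<le> M" and y: "schr V y - E *\<^sub>R y = 0"
  shows "coord y (n + 1) = of_real (E - V n) * coord y n - coord y (n - 1)"
proof -
  have one: "\<And>n::int. \<bar>1::real\<bar> \<le> 1" by simp
  have "coord (schr V y - E *\<^sub>R y) n = 0" using y by simp
  then show ?thesis
    by (simp add: schr_def coord_jacobi[OF one V] scaleR_conv_of_real algebra_simps)
qed

text \<open>The Wronskian is constant and summable, hence \<open>0\<close>.\<close>

lemma eigenspace_one_dim: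
  assumes V: "\<And>n. \<bar>V n\<bar> \<le> M" and y: "schr V y - E *\<^sub>R y = 0" and z: "schr V z - E *\<^sub>R z = 0"
    and "y \<noteq> 0"
  obtains c where "z = mulop (\<lambda>_. c) y"
proof -
  note ry = schr_eigen_rec[OF V y] and rz = schr_eigen_rec[OF V z]
  define w where "w n = coord y (n + 1) * coord z n - coord y n * coord z (n + 1)" for n
  have step: "w n = w (n - 1)" for n
  proof -
    have "w n = coord y n * coord z (n - 1) - coord y (n - 1) * coord z n"
      unfolding w_def ry[of n] rz[of n] by (simp add: algebra_simps)
    then show ?thesis by (simp add: w_def)
  qed
  have wc: "w n = w 0" for n
  proof (induction n rule: int_induct[where k = 0])
    case (step1 i) then show ?case using step[of "i + 1"] by simp
  next
    case (step2 i) then show ?case using step[of i] by simp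
  qed simp
  have wle: "cmod (w n) \<le> (cmod (coord y (n + 1)))\<^sup>2 + (cmod (coord z n))\<^sup>2
      + (cmod (coord y n))\<^sup>2 + (cmod (coord z (n + 1)))\<^sup>2" for n
  proof -
    have p: "u * v \<le> u\<^sup>2 + v\<^sup>2" if "u \<ge> 0" "v \<ge> 0" for u v :: real
      using sum_squares_bound[of u v] mult_nonneg_nonneg[OF that] by linarith
    have "cmod (w n) \<le> cmod (coord y (n + 1)) * cmod (coord z n) + cmod (coord y n) * cmod (coord z (n + 1))"
      unfolding w_def norm_mult[symmetric] by (rule norm_triangle_ineq4)
    then show ?thesis
      using p[of "cmod (coord y (n + 1))" "cmod (coord z n)"] p[of "cmod (coord y n)" "cmod (coord z (n + 1))"]
      by simp
  qed
  have bnd: "real k * cmod (w 0) \<le> 2 * (norm y)\<^sup>2 + 2 * (norm z)\<^sup>2" for k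
  proof -
    have "real k * cmod (w 0) = (\<Sum>n\<in>{0..<int k}. cmod (w 0))" by simp
    also have "\<dots> = (\<Sum>n\<in>{0..<int k}. cmod (w n))"
      by (intro sum.cong refl arg_cong[where f = cmod] wc[symmetric])
    also have "\<dots> \<le> (\<Sum>n\<in>{0..<int k}. (cmod (coord (shift 1 y) n))\<^sup>2 + (cmod (coord z n))\<^sup>2
      + (cmod (coord y n))\<^sup>2 + (cmod (coord (shift 1 z) n))\<^sup>2)"
      using wle by (intro sum_mono) simp
    also have "\<dots> \<le> (norm (shift 1 y))\<^sup>2 + (norm z)\<^sup>2 + (norm y)\<^sup>2 + (norm (shift 1 z))\<^sup>2"
      unfolding sum.distrib by (intro add_mono sum_coord_le_norm) auto
    finally show ?thesis by simp
  qed
  have "w 0 = 0"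
  proof (rule ccontr)
    assume "w 0 \<noteq> 0"
    then obtain k :: nat where "real k * cmod (w 0) > 2 * (norm y)\<^sup>2 + 2 * (norm z)\<^sup>2"
      using reals_Archimedean3[of "cmod (w 0)"] by auto
    with bnd[of k] show False by simp
  qed
  then have w0: "w n = 0" for n using wc[of n] by (rule trans[rotated])
  obtain n1 where n1: "coord y n1 \<noteq> 0" using \<open>y \<noteq> 0\<close> l2_eqI[of y 0] by auto
  define c where "c = coord z n1 / coord y n1"
  \<comment> \<open>The vanishing Wronskian at \<open>n1\<close> makes \<open>u\<close> vanish at
    two neighbouring sites, and the recursion spreads this in both directions.\<close>
  define u where "u n = coord z n - c * coord y n" for n
  have ru: "u (n + 1) = of_real (E - V n) * u n - u (n - 1)" for n
    unfolding u_def ry[of n] rz[of n] by (simp add: algebra_simps)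
  have u01: "u n1 = 0" "u (n1 + 1) = 0"
    using n1 w0[of n1] by (auto simp: u_def c_def w_def field_simps)
  have "u n = 0 \<and> u (n + 1) = 0" for n
  proof (induction n rule: int_induct[where k = n1])
    case base then show ?case using u01 by simp
  next
    case (step1 i) then show ?case using ru[of "i + 1"] by simp
  next
    case (step2 i)
    then have "u i = 0" "u (i + 1) = 0" by auto
    then show ?case using ru[of i] by simp
  qed
  then have "z = mulop (\<lambda>_. c) y" by (intro l2_eqI) (simp add: coord_mulop u_def)
  then show ?thesis using that by blast
qed

text \<open>At an isolated point \<open>E\<close> there is an eigenvector \<open>y\<close>, and every translate of \<open>y\<close> by an almost
  period is close to a multiple of \<open>y\<close>; so \<open>y\<close> does not decay.\<close>

lemma almost_periodic_no_isolated:
  assumes V: "\<And>n. \<bar>V n\<bar> \<le> M"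
    and ap: "\<And>\<delta>. \<delta> > 0 \<Longrightarrow> \<exists>q\<ge>1. \<forall>j::nat. \<forall>n. \<bar>V n - V (n + int q * int j)\<bar> \<le> \<delta>"
  shows "\<not> E isolated_in approx_spec (schr V)"
proof
  assume "E isolated_in approx_spec (schr V)"
  then obtain e where E: "E \<in> approx_spec (schr V)" and e: "e > 0"
    "\<And>F. F \<in> approx_spec (schr V) \<Longrightarrow> dist E F < e \<Longrightarrow> F = E"
    unfolding isolated_in_dist_Ex_iff by blast
  have one: "\<And>n::int. \<bar>1::real\<bar> \<le> 1" by simp
  have T: "bounded_linear (schr V)" "\<And>x y. schr V x \<bullet> y = x \<bullet> schr V y"
    unfolding schr_def using bounded_linear_jacobi[OF one V] inner_jacobi[OF one V] by auto
  define B where "B x = schr V x - E *\<^sub>R x" for x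
  have B: "bounded_linear B" unfolding B_def by (rule bounded_linear_shift[OF T(1)])
  have Bsym: "B x \<bullet> y = x \<bullet> B y" for x y by (simp add: B_def inner_diff_left inner_diff_right T(2))
  have "approx_spec (schr V) \<inter> {E - 2 * (e / 2)<..<E + 2 * (e / 2)} \<subseteq> {E}"
    using e(2) by (auto simp: dist_real_def abs_less_iff)
  from isolated_approx_spec_bound[OF T _ this] e(1)
  have "2 * (e / 2) * norm (B x) \<le> norm (B (B x))" for x by (simp add: B_def)
  then obtain C where C: "C > 0" "\<And>x. \<exists>y. B y = 0 \<and> norm (x - y) \<le> C * norm (B x)"
    using kernel_near[OF B Bsym, of "2 * (e / 2)"] e(1) by auto
  \<comment> \<open>The tolerance puts a kernel vector within \<open>norm x / 2\<close> of
    \<open>x\<close>, so it is nonzero.\<close>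
  obtain x where x: "x \<noteq> 0" "norm (B x) \<le> 1 / (2 * C) * norm x"
    using E C(1) unfolding approx_spec_def B_def by (auto dest!: spec[of _ "1 / (2 * C)"])
  obtain y where y: "B y = 0" "norm (x - y) \<le> C * norm (B x)" using C(2) by blast
  have "C * norm (B x) \<le> norm x / 2" using x(2) C(1) by (simp add: field_simps)
  moreover have "norm x > 0" using x(1) by simp
  ultimately have "norm (x - y) < norm x" using y(2) by linarith
  then have "y \<noteq> 0" by auto
  then obtain n0 where n0: "coord y n0 \<noteq> 0" using l2_eqI[of y 0] by auto
  \<comment> \<open>Chosen so that the bound \<open>C * \<delta> * norm y\<close> for the distance
    of a translate from the kernel is a quarter of the modulus of \<open>y\<close> at
    \<open>n0\<close>.\<close>
  define \<delta> where "\<delta> = cmod (coord y n0) / (4 * C * norm y)"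
  have "\<delta> > 0" using n0 C(1) \<open>y \<noteq> 0\<close> by (simp add: \<delta>_def)
  from ap[OF this] obtain q :: nat where q: "q \<ge> 1" "\<And>j n. \<bar>V n - V (n + int q * int j)\<bar> \<le> \<delta>"
    by blast
  \<comment> \<open>One quarter is lost in the size of the factor \<open>c\<close> and one quarter
    in the value at \<open>n0\<close>, so half remains. All multiples of \<open>q\<close> are almost
    periods with the same \<open>\<delta>\<close>, so this happens at infinitely many sites.\<close>
  have big: "cmod (coord y n0) / 2 \<le> cmod (coord y (n0 + int q * int j))" for j
  proof -
    let ?k = "int q * int j"
    let ?y = "shift ?k y"
    have bd: "\<bar>V n - V (n + ?k)\<bar> \<le> \<delta>" for n using q(2) by blast
    have "B ?y = B ?y - shift ?k (B y)" by (simp add: y(1) linear_simps(3)[OF bounded_linear_shift_l2])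
    also have "\<dots> = rmul (\<lambda>n. V n - V (n + ?k)) ?y"
      by (rule l2_eqI, simp only: B_def schr_def coord_simps coord_shift coord_jacobi[OF one V] coord_rmul[OF bd])
        (simp add: algebra_simps)
    finally have "B ?y = rmul (\<lambda>n. V n - V (n + ?k)) ?y" .
    then have By: "norm (B ?y) \<le> \<delta> * norm ?y"
      using norm_mulop_le[of "\<lambda>n. complex_of_real (V n - V (n + ?k))" \<delta> ?y] bd by (metis norm_of_real real_norm_def)
    obtain z where z: "B z = 0" "norm (?y - z) \<le> C * norm (B ?y)" using C(2) by blast
    have "C * norm (B ?y) \<le> C * (\<delta> * norm ?y)" using C(1) By by (intro mult_left_mono) auto
    also have "\<dots> = cmod (coord y n0) / 4" using C(1) \<open>y \<noteq> 0\<close> by (simp add: \<delta>_def)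
    finally have yz: "norm (?y - z) \<le> cmod (coord y n0) / 4" using z(2) by linarith
    obtain c where c: "z = mulop (\<lambda>_. c) y"
      by (rule eigenspace_one_dim[OF V y(1)[unfolded B_def] z(1)[unfolded B_def] \<open>y \<noteq> 0\<close>])
    have "norm y \<le> norm z + norm (?y - z)"
      using norm_triangle_ineq[of z "?y - z"] by simp
    also have "norm z \<le> cmod c * norm y" unfolding c by (rule norm_mulop_le) simp
    finally have "norm y * (3 / 4) \<le> cmod c * norm y"
      using yz coord_le_norm[of y n0] by linarith
    then have "3 / 4 \<le> cmod c" using \<open>y \<noteq> 0\<close> by (simp add: mult.commute)
    then have "3 / 4 * cmod (coord y n0) \<le> cmod c * cmod (coord y n0)" by (intro mult_right_mono) auto
    also have "\<dots> = cmod (coord z n0)" by (simp add: c coord_mulop norm_mult)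
    also have "\<dots> \<le> cmod (coord ?y n0) + cmod (coord (?y - z) n0)"
      using norm_triangle_ineq4[of "coord ?y n0" "coord (?y - z) n0"] by simp
    also have "\<dots> \<le> cmod (coord ?y n0) + cmod (coord y n0) / 4"
      using coord_le_norm[of "?y - z" n0] yz by linarith
    finally show ?thesis by simp
  qed
  have "real k * (cmod (coord y n0) / 2)\<^sup>2 \<le> (norm y)\<^sup>2" for k
  proof -
    let ?f = "\<lambda>j. n0 + int q * int j"
    have inj: "inj_on ?f {..<k}" using q(1) by (auto simp: inj_on_def)
    have "real k * (cmod (coord y n0) / 2)\<^sup>2 = (\<Sum>j<k. (cmod (coord y n0) / 2)\<^sup>2)" by simp
    also have "\<dots> \<le> (\<Sum>j<k. (cmod (coord y (?f j)))\<^sup>2)" by (intro sum_mono power_mono big) simp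
    also have "\<dots> = (\<Sum>n\<in>?f ` {..<k}. (cmod (coord y n))\<^sup>2)" by (simp add: sum.reindex[OF inj])
    also have "\<dots> \<le> (norm y)\<^sup>2" by (rule sum_coord_le_norm) simp
    finally show ?thesis .
  qed
  moreover obtain k :: nat where "real k * (cmod (coord y n0) / 2)\<^sup>2 > (norm y)\<^sup>2"
    using reals_Archimedean3[of "(cmod (coord y n0) / 2)\<^sup>2"] n0 by auto
  ultimately show False by (metis not_le)
qed

text \<open>An approximate eigenvector for \<open>W\<close> is one for \<open>V\<close> with
  slightly larger error, so \<open>approx_spec_near\<close> finds a point of the spectrum of
  \<open>V\<close> within that error. Compactness provides a uniform margin \<open>e\<close> inside
  \<open>U\<close>, and two quarters of it stay below \<open>e\<close>.\<close>

lemma approx_spec_upper_semicont: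
  assumes V: "\<And>n. \<bar>V n\<bar> \<le> M" and U: "open U" "approx_spec (schr V) \<subseteq> U"
  obtains \<delta> where "\<delta> > 0"
    "\<And>W M'. (\<And>n. \<bar>W n\<bar> \<le> M') \<Longrightarrow> (\<And>n. \<bar>V n - W n\<bar> \<le> \<delta>) \<Longrightarrow> approx_spec (schr W) \<subseteq> U"
proof -
  have one: "\<And>n::int. \<bar>1::real\<bar> \<le> 1" by simp
  have T: "bounded_linear (schr V)" "\<And>x y. schr V x \<bullet> y = x \<bullet> schr V y"
    unfolding schr_def using bounded_linear_jacobi[OF one V] inner_jacobi[OF one V] by auto
  obtain e where e: "e > 0" "(\<Union>E\<in>approx_spec (schr V). ball E e) \<subseteq> U"
    using compact_subset_open_imp_ball_epsilon_subset[OF compact_approx_spec[OF T(1)] U] by blast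
  have "approx_spec (schr W) \<subseteq> U" if W: "\<And>n. \<bar>W n\<bar> \<le> M'" and VW: "\<And>n. \<bar>V n - W n\<bar> \<le> e / 4" for W M'
  proof
    fix E assume "E \<in> approx_spec (schr W)"
    then obtain x where x: "x \<noteq> 0" "norm (schr W x - E *\<^sub>R x) \<le> e / 4 * norm x"
      using e(1) unfolding approx_spec_def by (auto dest!: spec[of _ "e / 4"])
    have "norm (schr V x - schr W x) \<le> e / 4 * norm x"
      unfolding schr_def by (rule norm_jacobi_diff_le[OF one V W VW])
    then have "norm (schr V x - E *\<^sub>R x) \<le> e / 2 * norm x"
      using norm_triangle_ineq[of "schr V x - schr W x" "schr W x - E *\<^sub>R x"] x(2) by simp
    then obtain E' where "E' \<in> approx_spec (schr V)" "\<bar>E - E'\<bar> \<le> e / 2"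
      using approx_spec_near[OF T x(1)] by blast
    then have "E \<in> ball E' e" using e(1) unfolding mem_ball dist_real_def by linarith
    then show "E \<in> U" using e(2) \<open>E' \<in> approx_spec (schr V)\<close> by blast
  qed
  then show ?thesis using that[of "e / 4"] e(1) by auto
qed

section \<open>Limit-periodic sequences\<close>

lemma is_norm_sum_le:
  assumes "is_norm N" "finite I"
  shows "N (\<Sum>i\<in>I. f i) \<le> (\<Sum>i\<in>I. N (f i))"
  using assms(2)
proof (induction I rule: finite_induct)
  case empty
  have "N 0 = 0" using assms(1) by (auto simp: is_norm_def)
  then show ?case by simp
next
  case (insert i I)
  have "N (f i + (\<Sum>i\<in>I. f i)) \<le> N (f i) + N (\<Sum>i\<in>I. f i)"
    using assms(1) unfolding is_norm_def by blast
  then show ?case using insert by simp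
qed

lemma is_norm_equivalent:
  fixes N :: "real ^ 'k::finite \<Rightarrow> real"
  assumes N: "is_norm N"
  obtains C K where "C > 0" "K > 0" "\<And>v. norm v \<le> C * N v" "\<And>v. N v \<le> K * norm v"
proof -
  have pos: "N v \<ge> 0" and zero: "N v = 0 \<longleftrightarrow> v = 0" and scale: "N (c *\<^sub>R v) = \<bar>c\<bar> * N v"
    and tri: "N (v + w) \<le> N v + N w" for v w c
    using N unfolding is_norm_def by blast+
  define K where "K = (\<Sum>i\<in>UNIV. N (axis i 1)) + 1"
  have K: "K > 0" unfolding K_def using pos by (intro add_nonneg_pos sum_nonneg) auto
  have NK: "N v \<le> K * norm v" for v
  proof -
    have "v = (\<Sum>i\<in>UNIV. (v $ i) *\<^sub>R axis i 1)"
      using basis_expansion[of v] by (simp add: scalar_mult_eq_scaleR)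
    then have "N v \<le> (\<Sum>i\<in>UNIV. N ((v $ i) *\<^sub>R axis i 1))"
      using is_norm_sum_le[OF N, of UNIV "\<lambda>i. (v $ i) *\<^sub>R axis i 1"] by simp
    also have "\<dots> \<le> (\<Sum>i\<in>UNIV. norm v * N (axis i 1))"
      unfolding scale by (intro sum_mono mult_right_mono component_le_norm_cart pos)
    also have "\<dots> \<le> K * norm v" by (simp add: K_def sum_distrib_left[symmetric] algebra_simps)
    finally show ?thesis .
  qed
  have "continuous_on (sphere 0 1) N"
  proof (rule continuous_on_subset[OF _ subset_UNIV], rule lipschitz_on_continuous_on[of K], rule lipschitz_onI)
    fix v w
    have "N v \<le> N (v - w) + N w" "N w \<le> N (w - v) + N v" using tri[of "v - w" w] tri[of "w - v" v] by auto
    moreover have "N (v - w) \<le> K * dist v w" "N (w - v) \<le> K * dist v w"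
      using NK[of "v - w"] NK[of "w - v"] by (auto simp: dist_norm norm_minus_commute)
    ultimately show "dist (N v) (N w) \<le> K * dist v w" by (simp add: dist_real_def abs_le_iff)
  qed (use K in simp)
  moreover have "sphere (0 :: real ^ 'k) 1 \<noteq> {}"
  proof -
    have "axis (SOME i. True) 1 \<in> sphere (0 :: real ^ 'k) 1" by (simp add: norm_axis_1)
    then show ?thesis by blast
  qed
  ultimately obtain u where u: "u \<in> sphere (0 :: real ^ 'k) 1" "\<And>v. v \<in> sphere 0 1 \<Longrightarrow> N u \<le> N v"
    using continuous_attains_inf[OF compact_sphere] by metis
  have Nu: "N u > 0" using u(1) pos[of u] zero[of u] by (auto simp: less_le)
  have "norm v \<le> 1 / N u * N v" for v
  proof (cases "v = 0")
    case False
    have "N u \<le> N ((1 / norm v) *\<^sub>R v)" using False by (intro u(2)) simp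
    then show ?thesis using False Nu unfolding scale by (simp add: field_simps)
  qed (use pos[of 0] Nu in simp)
  then show ?thesis using that[of "1 / N u" K] K NK Nu by auto
qed

lemma is_norm_lower_bound:
  fixes N :: "real ^ 'k::finite \<Rightarrow> real"
  assumes "is_norm N"
  shows "\<exists>C>0. \<forall>v. norm v \<le> C * N v"
  by (rule is_norm_equivalent[OF assms]) blast

lemma norm_metric_mcomplete:
  fixes N :: "real ^ 'k::finite \<Rightarrow> real"
  assumes N: "is_norm N" and Y: "closed Y"
  shows "Metric_space.mcomplete Y (\<lambda>v w. N (v - w))"
proof -
  interpret Metric_space Y "\<lambda>v w. N (v - w)" by (rule is_norm_Metric_space[OF N])
  obtain C K where C: "C > 0" "K > 0" "\<And>v. norm v \<le> C * N v" "\<And>v. N v \<le> K * norm v"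
    using is_norm_equivalent[OF N] by blast
  show ?thesis
    unfolding mcomplete_def
  proof (intro allI impI)
    fix \<sigma> assume "MCauchy \<sigma>"
    then have \<sigma>: "range \<sigma> \<subseteq> Y" "\<And>\<epsilon>. \<epsilon> > 0 \<Longrightarrow> \<exists>M. \<forall>n n'. M \<le> n \<longrightarrow> M \<le> n' \<longrightarrow> N (\<sigma> n - \<sigma> n') < \<epsilon>"
      by (auto simp: MCauchy_def)
    have "Cauchy \<sigma>"
    proof (rule metric_CauchyI)
      fix e :: real assume e: "e > 0"
      obtain M where M: "\<And>n n'. M \<le> n \<Longrightarrow> M \<le> n' \<Longrightarrow> N (\<sigma> n - \<sigma> n') < e / C"
        using \<sigma>(2)[of "e / C"] e C(1) by auto
      have "dist (\<sigma> m) (\<sigma> n) < e" if "m \<ge> M" "n \<ge> M" for m n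
        using M[OF that] C(3)[of "\<sigma> m - \<sigma> n"] C(1) by (simp add: dist_norm field_simps)
      then show "\<exists>M. \<forall>m\<ge>M. \<forall>n\<ge>M. dist (\<sigma> m) (\<sigma> n) < e" by blast
    qed
    then obtain l where l: "\<sigma> \<longlonglongrightarrow> l" using Cauchy_convergent convergent_def by blast
    have lY: "l \<in> Y" using closed_sequentially[OF Y] \<sigma>(1) l by blast
    have "limitin mtopology \<sigma> l sequentially"
      unfolding limitin_metric
    proof (intro conjI lY allI impI)
      fix e :: real assume e: "e > 0"
      have "\<forall>\<^sub>F n in sequentially. dist (\<sigma> n) l < e / K"
        using l e C(2) by (intro tendstoD) auto
      then show "\<forall>\<^sub>F n in sequentially. \<sigma> n \<in> Y \<and> N (\<sigma> n - l) < e"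
      proof eventually_elim
        case (elim n)
        then show ?case using C(4)[of "\<sigma> n - l"] C(2) \<sigma>(1) by (auto simp: dist_norm field_simps)
      qed
    qed
    then show "\<exists>l. limitin mtopology \<sigma> l sequentially" by blast
  qed
qed

text \<open>Each point has an isolating set in a countable basis, and different points have
  different ones; accumulation outside \<open>S\<close> is allowed.\<close>

lemma discrete_imp_countable:
  fixes S :: "'a::second_countable_topology set"
  assumes "discrete S"
  shows "countable S"
proof -
  obtain B :: "'a set set" where B: "countable B" "topological_basis B"
    using ex_countable_basis by blast
  have "\<exists>b\<in>B. b \<inter> S = {x}" if x: "x \<in> S" for x
  proof -
    obtain T where T: "open T" "T \<inter> S = {x}" using discreteD[OF assms x] unfolding isolated_in_def by blast
    then obtain b where "b \<in> B" "x \<in> b" "b \<subseteq> T" using topological_basisE[OF B(2) T(1)] by blast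
    then show ?thesis using T(2) x by blast
  qed
  then obtain f where f: "\<And>x. x \<in> S \<Longrightarrow> f x \<in> B \<and> f x \<inter> S = {x}" by metis
  have "countable (f ` S)" using f B(1) by (meson countable_subset image_subsetI)
  moreover have "inj_on f S" using f by (metis inj_onI the_elem_eq)
  ultimately show ?thesis using countable_image_inj_on by blast
qed

lemma periodic_mult:
  fixes f :: "int \<Rightarrow> 'a"
  assumes "\<And>j. f (j + int q) = f j"
  shows "f (j + int q * int m) = f j"
proof (induction m)
  case (Suc m)
  then show ?case using assms[of "j + int q * int m"] by (simp add: algebra_simps)
qed simp

lemma Per_periodize:
  assumes "y \<in> Per Y"
  obtains x where "x \<in> words Y" "periodize x = y"
proof -
  obtain q :: nat where y: "range y \<subseteq> Y" "q \<ge> 1" and q: "\<And>j. y (j + int q) = y j"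
    using assms by (auto simp: Per_def)
  define x where "x = map (\<lambda>i. y (int i + 1)) [0..<q]"
  have len: "length x = q" by (simp add: x_def)
  have "periodize x j = y j" for j
  proof -
    define i where "i = nat ((j - 1) mod int q)"
    have i: "i < q" "int i = (j - 1) mod int q" using y(2) by (auto simp: i_def nat_less_iff)
    have per: "y (a + int q * b) = y a" for a b
    proof (cases "b \<ge> 0")
      case True
      then show ?thesis using periodic_mult[of y q a "nat b"] q by simp
    next
      case False
      then show ?thesis using periodic_mult[of y q "a + int q * b" "nat (- b)"] q by simp
    qed
    have "periodize x j = y (int i + 1)" using i(1) by (simp add: periodize_def len i_def[symmetric] x_def)
    also have "\<dots> = y (int i + 1 + int q * ((j - 1) div int q))" by (rule per[symmetric])
    also have "int i + 1 + int q * ((j - 1) div int q) = j" unfolding i(2) by simp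
    finally show ?thesis .
  qed
  moreover have "x \<in> words Y" using y by (auto simp: words_def x_def)
  ultimately show ?thesis using that by blast
qed

lemma interleave_periodic:
  fixes y :: "int \<Rightarrow> real ^ 'k::{finite,linorder}"
  assumes "\<And>j. y (j + int q) = y j"
  shows "interleave y (n + int (CARD('k) * q)) = interleave y n"
proof -
  have eq: "n + int (CARD('k) * q) - 1 = (n - 1) + int q * int CARD('k)" by simp
  have "CARD('k) \<noteq> 0" by simp
  then have "(n + int (CARD('k) * q) - 1) div int CARD('k) = (n - 1) div int CARD('k) + int q"
    "(n + int (CARD('k) * q) - 1) mod int CARD('k) = (n - 1) mod int CARD('k)"
    unfolding eq by (subst div_mult_self1, auto)
  then show ?thesis unfolding interleave_def by (simp only: assms)
qed

lemma interleave_diff_le: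
  fixes y z :: "int \<Rightarrow> real ^ 'k::{finite,linorder}"
  assumes C: "\<And>v :: real ^ 'k::{finite,linorder}. norm v \<le> C * N v" "C \<ge> 0" and b: "\<And>j. N (y j - z j) \<le> b"
  shows "\<bar>interleave y n - interleave z n\<bar> \<le> C * b"
proof -
  let ?j = "(n - 1) div int CARD('k)"
  let ?i = "sorted_list_of_set (UNIV :: 'k set) ! nat ((n - 1) mod int CARD('k))"
  have "\<bar>interleave y n - interleave z n\<bar> = \<bar>(y ?j - z ?j) $ ?i\<bar>" by (simp add: interleave_def)
  also have "\<dots> \<le> norm (y ?j - z ?j)" by (rule component_le_norm_cart)
  also have "\<dots> \<le> C * N (y ?j - z ?j)" by (rule C)
  also have "\<dots> \<le> C * b" using b C(2) by (intro mult_left_mono)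
  finally show ?thesis .
qed

abbreviation energies :: "(int \<Rightarrow> real ^ 'k::{finite,linorder}) \<Rightarrow> real set" where
  "energies y \<equiv> approx_spec (schr (interleave y))"

lemma l2_nontrivial: "\<exists>x::l2. x \<noteq> 0"
proof -
  let ?f = "\<lambda>n::int. if n = 0 then 1 else 0 :: complex"
  have "(\<lambda>n. (cmod (?f n))\<^sup>2) summable_on {0}" by simp
  then have "(\<lambda>n. (cmod (?f n))\<^sup>2) summable_on UNIV"
    by (subst summable_on_cong_neutral[of _ UNIV]) auto
  then have "?f \<in> ell2" by (simp add: ell2_iff)
  then have "coord (l2_of ?f) 0 \<noteq> coord 0 0" by simp
  then show ?thesis by metis
qed

section \<open>Genericity in the space of limit-periodic sequences\<close>

context
  fixes N :: "real ^ 'k::{finite,linorder} \<Rightarrow> real" and Y :: "(real ^ 'k::{finite,linorder}) set"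
  assumes N: "is_norm N"
begin

interpretation Y: Metric_space Y "\<lambda>v w. N (v - w)"
  by (rule is_norm_Metric_space[OF N])

lemma Per_subset_LP: "Per Y \<subseteq> LP N Y"
  unfolding LP_def using Per_subset_seq_metric[OF N, of Y] by (intro closure_of_subset) simp

lemma LP_subset: "LP N Y \<subseteq> mspace (seq_metric N Y)"
  unfolding LP_def using closure_of_subset_topspace by fastforce

lemma Metric_space_LP: "Metric_space (LP N Y) (mdist (seq_metric N Y))"
  using Metric_space.subspace[OF Metric_space_mspace_mdist LP_subset] .

lemma mtopology_LP_metric:
  "mtopology_of (LP_metric N Y) = Metric_space.mtopology (LP N Y) (mdist (seq_metric N Y))"
  using LP_subset by (simp add: mtopology_of_def LP_metric_def inf_absorb1)

lemma mcomplete_LP: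
  assumes "closed Y"
  shows "Metric_space.mcomplete (LP N Y) (mdist (seq_metric N Y))"
proof -
  have "mcomplete_of (seq_metric N Y)"
    using Y.mcomplete_funspace[OF norm_metric_mcomplete[OF N assms], of UNIV]
    by (simp add: seq_metric_def Y.Self_def)
  then have "Metric_space.mcomplete (mspace (seq_metric N Y)) (mdist (seq_metric N Y))"
    by (simp add: mcomplete_of_def)
  moreover interpret Submetric "mspace (seq_metric N Y)" "mdist (seq_metric N Y)" "LP N Y"
    using LP_subset by (simp add: Submetric_def Submetric_axioms_def)
  have "closedin mtopology (LP N Y)"
    unfolding LP_def mtopology_of_def by simp
  ultimately show ?thesis by (intro closedin_mcomplete_imp_mcomplete)
qed

lemma seq_metric_le_iff:
  assumes "y \<in> LP N Y" "z \<in> LP N Y"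
  shows "mdist (seq_metric N Y) y z \<le> a \<longleftrightarrow> (\<forall>j. N (y j - z j) \<le> a)"
  using assms LP_subset unfolding seq_metric_def
  by (subst funspace_mdist_le) (auto simp: subset_iff)

lemma LP_interleave_bounded:
  assumes y: "y \<in> LP N Y"
  obtains M where "\<And>n. \<bar>interleave y n\<bar> \<le> M"
proof -
  obtain C where C: "C > 0" "\<And>v. norm v \<le> C * N v" using is_norm_lower_bound[OF N] by blast
  have "y \<in> mspace (funspace UNIV (metric (Y, \<lambda>v w. N (v - w))))"
    using y LP_subset by (auto simp: seq_metric_def)
  then obtain c B where B: "\<And>j. N (c - y j) \<le> B"
    using funspace_imp_bounded[of y UNIV "metric (Y, \<lambda>v w. N (v - w))"] by auto
  have "\<bar>interleave y n\<bar> \<le> norm c + C * B" for n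
  proof -
    have "\<bar>interleave (\<lambda>_. c) n - interleave y n\<bar> \<le> C * B"
      using C B by (intro interleave_diff_le[where N = N]) auto
    moreover have "\<bar>interleave (\<lambda>_. c) n\<bar> \<le> norm c"
      unfolding interleave_def by (rule component_le_norm_cart)
    ultimately show ?thesis by linarith
  qed
  then show ?thesis using that by blast
qed

lemma spec_H_LP:
  assumes "y \<in> LP N Y"
  shows "spec_H y = complex_of_real ` energies y"
  using LP_interleave_bounded[OF assms] op_spectrum_schroedinger unfolding spec_H_def by metis

lemma LP_near_periodic:
  assumes "y \<in> LP N Y" "\<epsilon> > 0"
  obtains x where "x \<in> Per Y" "mdist (seq_metric N Y) y x < \<epsilon>"
proof -
  interpret M: Metric_space "mspace (seq_metric N Y)" "mdist (seq_metric N Y)"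
    by (rule Metric_space_mspace_mdist)
  show ?thesis
    using assms that unfolding LP_def mtopology_of_def M.metric_closure_of by auto
qed

lemma LP_cantor:
  assumes y: "y \<in> LP N Y" and thin: "\<And>n. thin (1 / real (Suc n)) (1 / real (Suc n)) (energies y)"
  shows "cantor_set (energies y)"
proof -
  let ?V = "interleave y"
  obtain M where M: "\<And>n. \<bar>?V n\<bar> \<le> M" using LP_interleave_bounded[OF y] by blast
  obtain C where C: "C > 0" "\<And>v. norm v \<le> C * N v" using is_norm_lower_bound[OF N] by blast
  have one: "\<And>n::int. \<bar>1::real\<bar> \<le> 1" by simp
  have T: "bounded_linear (schr ?V)" "\<And>x y. schr ?V x \<bullet> y = x \<bullet> schr ?V y"
    unfolding schr_def using bounded_linear_jacobi[OF one M] inner_jacobi[OF one M] by auto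
  obtain x :: l2 where "x \<noteq> 0" using l2_nontrivial by blast
  then have "energies y \<noteq> {}" by (rule approx_spec_nonempty[OF T])
  moreover have "compact (energies y)" by (rule compact_approx_spec[OF T(1)])
  moreover have "\<not> E isolated_in energies y" for E
  proof (rule almost_periodic_no_isolated[OF M])
    fix \<delta> :: real assume \<delta>: "\<delta> > 0"
    \<comment> \<open>The potential and its translate both lie within \<open>\<delta> / 2\<close> of
      the same periodic value, whatever multiple of the period is used.\<close>
    obtain x where x: "x \<in> Per Y" "mdist (seq_metric N Y) y x < \<delta> / (2 * C)"
      using LP_near_periodic[OF y, of "\<delta> / (2 * C)"] \<delta> C(1) by auto
    obtain q :: nat where q: "q \<ge> 1" "\<And>j. x (j + int q) = x j" using x(1) by (auto simp: Per_def)
    have "N (y j - x j) \<le> \<delta> / (2 * C)" for j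
      using seq_metric_le_iff[OF y subsetD[OF Per_subset_LP x(1)], of "\<delta> / (2 * C)"] x(2) by auto
    then have "\<bar>?V n - interleave x n\<bar> \<le> C * (\<delta> / (2 * C))" for n
      using C by (intro interleave_diff_le[where N = N]) auto
    then have d: "\<bar>?V n - interleave x n\<bar> \<le> \<delta> / 2" for n using C(1) by simp
    have p: "interleave x (n + int (CARD('k) * q) * int j) = interleave x n" for n j
      by (rule periodic_mult, rule interleave_periodic, rule q(2))
    have "\<bar>?V n - ?V (n + int (CARD('k) * q) * int j)\<bar> \<le> \<delta>" for n j
      using d[of n] d[of "n + int (CARD('k) * q) * int j"] p[of n j] by linarith
    moreover have "CARD('k) * q \<ge> 1" using q(1) by (simp add: Suc_le_eq)
    ultimately show "\<exists>q\<ge>1. \<forall>j::nat. \<forall>n. \<bar>?V n - ?V (n + int q * int j)\<bar> \<le> \<delta>" by blast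
  qed
  ultimately show ?thesis using thin_interior[OF thin] by (simp add: cantor_set_def)
qed

text \<open>The cover witnessing \<open>thin\<close> for \<open>y\<close> is an open set around
  \<open>energies y\<close>; by \<open>approx_spec_upper_semicont\<close> the same intervals serve
  every nearby sequence.\<close>

lemma openin_thin_spectrum:
  "openin (mtopology_of (LP_metric N Y)) {y \<in> LP N Y. thin s \<epsilon> (energies y)}"
proof -
  interpret L: Metric_space "LP N Y" "mdist (seq_metric N Y)" by (rule Metric_space_LP)
  obtain C where C: "C > 0" "\<And>v. norm v \<le> C * N v" using is_norm_lower_bound[OF N] by blast
  show ?thesis
    unfolding mtopology_LP_metric L.openin_mtopology
  proof (intro conjI allI impI)
    fix y assume y: "y \<in> {y \<in> LP N Y. thin s \<epsilon> (energies y)}"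
    then obtain a r where r: "\<And>i::nat. r i > 0" "summable (\<lambda>i. r i powr s)" "(\<Sum>i. r i powr s) < \<epsilon>"
      "energies y \<subseteq> (\<Union>i. ball (a i) (r i))" unfolding thin_def by blast
    obtain M where M: "\<And>n. \<bar>interleave y n\<bar> \<le> M" using LP_interleave_bounded y by blast
    obtain \<delta> where \<delta>: "\<delta> > 0" "\<And>W M'. (\<And>n. \<bar>W n\<bar> \<le> M') \<Longrightarrow> (\<And>n. \<bar>interleave y n - W n\<bar> \<le> \<delta>)
        \<Longrightarrow> approx_spec (schr W) \<subseteq> (\<Union>i. ball (a i) (r i))"
      using approx_spec_upper_semicont[OF M _ r(4)] by blast
    have "L.mball y (\<delta> / C) \<subseteq> {y \<in> LP N Y. thin s \<epsilon> (energies y)}"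
    proof
      fix z assume z: "z \<in> L.mball y (\<delta> / C)"
      then have zL: "z \<in> LP N Y" by simp
      have "N (y j - z j) \<le> \<delta> / C" for j
        using z y seq_metric_le_iff[of y z "\<delta> / C"] by auto
      then have "\<bar>interleave y n - interleave z n\<bar> \<le> C * (\<delta> / C)" for n
        using C by (intro interleave_diff_le[where N = N]) auto
      then have "\<bar>interleave y n - interleave z n\<bar> \<le> \<delta>" for n using C(1) by simp
      moreover obtain M' where "\<And>n. \<bar>interleave z n\<bar> \<le> M'" using LP_interleave_bounded[OF zL] by blast
      ultimately have "energies z \<subseteq> (\<Union>i. ball (a i) (r i))" by (intro \<delta>(2)) auto
      then show "z \<in> {y \<in> LP N Y. thin s \<epsilon> (energies y)}" using r zL unfolding thin_def by blast
    qed
    moreover have "\<delta> / C > 0" using \<delta>(1) C(1) by simp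
    ultimately show "\<exists>r>0. L.mball y r \<subseteq> {y \<in> LP N Y. thin s \<epsilon> (energies y)}" by blast
  qed auto
qed

text \<open>The density step: \<open>block_cover\<close> is applied to periodic perturbations that
  are all within \<open>\<beta>\<close> of \<open>periodize x\<close>, so switching between them
  letter by letter stays within \<open>\<beta>\<close> too.\<close>

lemma periodic_thin_approx:
  assumes gap: "gap_rich_with N Y S" and x: "x \<in> words Y" and \<beta>: "\<beta> > 0" and s: "s > 0" and \<epsilon>: "\<epsilon> > 0"
  obtains z where "z \<in> Per Y" "\<And>j. N (periodize x j - z j) \<le> \<beta>" "thin s \<epsilon> (energies z)"
proof -
  have one: "\<And>n::int. \<bar>1::real\<bar> \<le> 1" by simp
  obtain C where C: "C > 0" "\<And>v. norm v \<le> C * N v" using is_norm_lower_bound[OF N] by blast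
  have PL: "periodize w \<in> LP N Y" if "w \<in> words Y" for w
    using periodize_in_Per[OF that] Per_subset_LP by blast
  obtain M0 where M0: "\<And>n. \<bar>interleave (periodize x) n\<bar> \<le> M0" using LP_interleave_bounded[OF PL[OF x]] by blast
  \<comment> \<open>A bound for every sequence within \<open>\<beta>\<close> of
    \<open>periodize x\<close>, so that the energy range is fixed before \<open>z\<close> is
    known.\<close>
  define M where "M = M0 + C * \<beta>"
  define near where "near w \<longleftrightarrow> w \<in> words Y \<and> (\<forall>j. N (periodize x j - periodize w j) \<le> \<beta>)" for w
  have "N 0 = 0" using N unfolding is_norm_def by blast
  then have x_near: "near x" using x \<beta> by (simp add: near_def)
  have bdd: "\<bar>interleave z n\<bar> \<le> M" if "\<And>j. N (periodize x j - z j) \<le> \<beta>" for z n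
  proof -
    have "\<bar>interleave (periodize x) n - interleave z n\<bar> \<le> C * \<beta>"
      using C that by (intro interleave_diff_le[where N = N]) auto
    then show ?thesis using M0[of n] unfolding M_def by linarith
  qed
  have gapE: "\<exists>w \<eta>. near w \<and> \<eta> > 0 \<and> (\<forall>u. \<eta> * norm u \<le> norm (schr (interleave (periodize w)) u - E *\<^sub>R u))"
    if E: "E \<notin> S" for E
  proof -
    obtain w where w: "w \<in> words Y" "word_dist N Y x w < \<beta>" "complex_of_real E \<notin> spec_H (periodize w)"
      using gap E x \<beta> unfolding gap_rich_with_def by blast
    have "\<forall>j. N (periodize x j - periodize w j) \<le> \<beta>"
      using w(2) seq_metric_le_iff[OF PL[OF x] PL[OF w(1)], of \<beta>] by (simp add: word_dist_def)
    moreover have "E \<notin> energies (periodize w)" using w(3) spec_H_LP[OF PL[OF w(1)]] by blast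
    ultimately show ?thesis using w(1) unfolding not_approx_spec_iff near_def by blast
  qed
  then obtain wd \<eta> where wd: "\<And>E. E \<notin> S \<Longrightarrow> near (wd E) \<and> \<eta> E > 0 \<and>
      (\<forall>u. \<eta> E * norm u \<le> norm (schr (interleave (periodize (wd E))) u - E *\<^sub>R u))"
    by metis
  have "countable S" using gap by (auto simp: gap_rich_with_def intro: discrete_imp_countable)
  then have "thin s (\<epsilon> / 2) S" using s \<epsilon> by (intro countable_imp_thin) auto
  then obtain a r where r: "\<And>i::nat. r i > 0" "summable (\<lambda>i. r i powr s)" "(\<Sum>i. r i powr s) < \<epsilon> / 2"
    "S \<subseteq> (\<Union>i. ball (a i) (r i))" unfolding thin_def by blast
  \<comment> \<open>Removing open intervals keeps \<open>D\<close> compact and away from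
    \<open>S\<close>. The radii \<open>\<eta> E / 2\<close> used below leave half of each lower
    bound for nearby energies.\<close>
  define D where "D = cball 0 (2 * 1 + M) - (\<Union>i. ball (a i) (r i))"
  have "compact D" unfolding D_def by (intro compact_diff) auto
  moreover have "D \<subseteq> (\<Union>E\<in>D. ball E (\<eta> E / 2))"
  proof
    fix E assume E: "E \<in> D"
    then have "E \<notin> S" using r(4) by (auto simp: D_def)
    then have "E \<in> ball E (\<eta> E / 2)" using wd by simp
    then show "E \<in> (\<Union>E\<in>D. ball E (\<eta> E / 2))" using E by blast
  qed
  ultimately obtain F where F: "F \<subseteq> D" "finite F" "D \<subseteq> (\<Union>E\<in>F. ball E (\<eta> E / 2))"
    using compactE_image[of D D "\<lambda>E. ball E (\<eta> E / 2)"] by blast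
  have FS: "E \<notin> S" if "E \<in> F" for E using that F(1) r(4) by (auto simp: D_def)
  obtain es where es: "set es = F" using finite_list[OF F(2)] by blast
  \<comment> \<open>The word \<open>x\<close> itself ensures \<open>m \<ge> 1\<close> even when
    \<open>F\<close> is empty; the \<open>1\<close> in \<open>\<eta>0\<close> serves the same
    case.\<close>
  define ws where "ws = x # map wd es"
  define m where "m = length ws"
  define \<eta>0 where "\<eta>0 = Min (insert 1 ((\<lambda>E. \<eta> E / 2) ` F))"
  have \<eta>0: "\<eta>0 > 0" unfolding \<eta>0_def using F(2) wd[OF FS] by simp
  have set_near: "near w" if "w \<in> set ws" for w
    using that x_near wd[OF FS] es by (auto simp: ws_def)
  have ws_near: "near (ws ! i)" if "i < m" for i
    using set_near nth_mem[of i ws] that by (simp add: m_def)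
  \<comment> \<open>A common period of all words, so that blocks whose length is a multiple of it
    can be switched without shifting the phase.\<close>
  define Q where "Q = prod_list (map length ws)"
  have "length w \<ge> 1" if "w \<in> set ws" for w
    using set_near[OF that] by (auto simp: near_def words_def Suc_le_eq)
  then have "0 \<notin> set (map length ws)" by (metis image_iff list.set_map not_one_le_zero)
  then have Q: "Q \<ge> 1" unfolding Q_def using prod_list_zero_iff[of "map length ws"] by (simp add: Suc_le_eq)
  have Qper: "periodize (ws ! i) (j + int Q) = periodize (ws ! i) j" if "i < m" for i j
  proof -
    have "length (ws ! i) dvd Q" unfolding Q_def using that by (intro prod_list_dvd) (auto simp: m_def)
    then obtain c where c: "Q = length (ws ! i) * c" by (rule dvdE)
    have "periodize (ws ! i) (j + int (length (ws ! i)) * int c) = periodize (ws ! i) j"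
    proof (rule periodic_mult)
      fix j
      have "(j + int (length (ws ! i)) - 1) mod int (length (ws ! i)) = (j - 1) mod int (length (ws ! i))"
        by (metis add_diff_eq diff_add_eq mod_add_self2)
      then show "periodize (ws ! i) (j + int (length (ws ! i))) = periodize (ws ! i) j"
        by (simp add: periodize_def)
    qed
    then show ?thesis by (simp add: c)
  qed
  define V where "V i = interleave (periodize (ws ! i))" for i
  have V: "\<bar>V i n\<bar> \<le> M" if "i < m" for i n
    unfolding V_def using ws_near[OF that] by (intro bdd) (simp add: near_def)
  have Vper: "V i (n + int (CARD('k) * Q)) = V i n" if "i < m" for i n
    unfolding V_def by (rule interleave_periodic, rule Qper[OF that])
  have Vgap: "\<exists>i<m. \<forall>u. \<eta>0 * norm u \<le> norm (schr (V i) u - E *\<^sub>R u)" if ED: "E \<in> D" for E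
  proof -
    obtain E0 where E0: "E0 \<in> F" "\<bar>E0 - E\<bar> < \<eta> E0 / 2" using F(3) ED by (auto simp: dist_real_def)
    then obtain i0 where i0: "i0 < length es" "es ! i0 = E0" using es by (metis in_set_conv_nth)
    have i: "Suc i0 < m" "ws ! Suc i0 = wd E0" using i0 by (auto simp: m_def ws_def)
    have "\<eta>0 * norm u \<le> norm (schr (V (Suc i0)) u - E *\<^sub>R u)" for u
    proof -
      let ?T = "schr (V (Suc i0)) u"
      have "\<eta> E0 * norm u \<le> norm (?T - E0 *\<^sub>R u)" using wd[OF FS[OF E0(1)]] by (simp add: V_def i(2))
      also have "?T - E0 *\<^sub>R u = (?T - E *\<^sub>R u) - (E0 - E) *\<^sub>R u" by (simp add: algebra_simps)
      also have "norm \<dots> \<le> norm (?T - E *\<^sub>R u) + \<bar>E0 - E\<bar> * norm u"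
        by (metis norm_triangle_ineq4 norm_scaleR)
      finally have "(\<eta> E0 - \<bar>E0 - E\<bar>) * norm u \<le> norm (?T - E *\<^sub>R u)" by (simp add: algebra_simps)
      moreover have "\<eta>0 \<le> \<eta> E0 - \<bar>E0 - E\<bar>"
      proof -
        have "\<eta>0 \<le> \<eta> E0 / 2" unfolding \<eta>0_def using F(2) E0(1) by (intro Min_le) auto
        then show ?thesis using E0(2) by linarith
      qed
      ultimately show ?thesis by (meson mult_right_mono norm_ge_zero order_trans)
    qed
    with i(1) show ?thesis by blast
  qed
  have "m \<ge> 1" "CARD('k) * Q \<ge> 1" using Q by (auto simp: m_def ws_def Suc_le_eq)
  from block_cover[where V = V and M = M and C = D, OF this s half_gt_zero[OF \<epsilon>] \<eta>0 V Vper Vgap]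
  obtain L R \<rho> where L: "L \<ge> 1" "finite R" "\<rho> > 0" "real (card R) * \<rho> powr s < \<epsilon> / 2"
    and cover: "approx_spec (schr (\<lambda>n. V (nat (((n - 1) div int (2 * (CARD('k) * Q) * L)) mod int m)) n)) \<inter> D
      \<subseteq> (\<Union>F\<in>R. ball F \<rho>)" by blast
  \<comment> \<open>The letter at \<open>j\<close> fills the potential sites \<open>n\<close> with
    \<open>(n - 1) div CARD('k) = j\<close>, so blocks of \<open>2 * Q * L\<close> letters starting
    at \<open>j = 0\<close> match the blocks of \<open>block_cover\<close>, which start at
    \<open>n = 1\<close>.\<close>
  define idx where "idx j = nat ((j div int (2 * Q * L)) mod int m)" for j
  define z where "z j = periodize (ws ! idx j) j" for j
  have idx: "idx j < m" for j using \<open>m \<ge> 1\<close> by (simp add: idx_def nat_less_iff)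
  have zx: "N (periodize x j - z j) \<le> \<beta>" for j using ws_near[OF idx[of j]] by (simp add: near_def z_def)
  have "z (j + int (2 * Q * L * m)) = z j" for j
  proof -
    have eq: "j + int (2 * Q * L * m) = j + int m * int (2 * Q * L)" by simp
    have "idx (j + int (2 * Q * L * m)) = idx j"
      unfolding idx_def eq using Q L(1) by (subst div_mult_self1) auto
    moreover have "periodize (ws ! idx j) (j + int Q * int (2 * L * m)) = periodize (ws ! idx j) j"
      by (rule periodic_mult, rule Qper[OF idx])
    moreover have "int (2 * Q * L * m) = int Q * int (2 * L * m)" by simp
    ultimately show ?thesis unfolding z_def by metis
  qed
  moreover have "z j \<in> Y" for j
    using ws_near[OF idx[of j]] periodize_in_Per[of "ws ! idx j" Y] unfolding near_def z_def Per_def by auto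
  moreover have "2 * Q * L * m \<ge> 1" using Q L(1) \<open>m \<ge> 1\<close> by (simp add: Suc_le_eq)
  ultimately have zPer: "z \<in> Per Y" unfolding Per_def by blast
  have "interleave z = (\<lambda>n. V (nat (((n - 1) div int (2 * (CARD('k) * Q) * L)) mod int m)) n)"
  proof
    fix n
    have "(n - 1) div int CARD('k) div int (2 * Q * L) = (n - 1) div (int CARD('k) * int (2 * Q * L))"
      by (rule zdiv_zmult2_eq[symmetric]) simp
    also have "int CARD('k) * int (2 * Q * L) = int (2 * (CARD('k) * Q) * L)" by simp
    finally show "interleave z n = V (nat (((n - 1) div int (2 * (CARD('k) * Q) * L)) mod int m)) n"
      unfolding interleave_def V_def z_def idx_def by simp
  qed
  then have cover_z: "energies z \<inter> D \<subseteq> (\<Union>F\<in>R. ball F \<rho>)" using cover by simp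
  have "energies z \<subseteq> cball 0 (2 * 1 + M)"
    using approx_spec_norm_le[of "schr (interleave z)" "2 * 1 + M"] norm_jacobi_le[OF one bdd[OF zx]]
    by (auto simp: schr_def)
  then have "energies z \<subseteq> (\<Union>i. ball (a i) (r i)) \<union> (\<Union>F\<in>R. ball F \<rho>)" using cover_z unfolding D_def by blast
  from thin_append[OF r(1-3) L(2-4) this] have "thin s \<epsilon> (energies z)" by simp
  then show ?thesis using that zPer zx by blast
qed

lemma dense_thin_spectrum:
  assumes gap: "gap_rich_with N Y S" and s: "s > 0" and \<epsilon>: "\<epsilon> > 0"
  shows "mtopology_of (LP_metric N Y) closure_of {y \<in> LP N Y. thin s \<epsilon> (energies y)} = LP N Y"
proof -
  interpret L: Metric_space "LP N Y" "mdist (seq_metric N Y)" by (rule Metric_space_LP)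
  have "\<exists>z\<in>{y \<in> LP N Y. thin s \<epsilon> (energies y)}. z \<in> L.mball y e" if y: "y \<in> LP N Y" and e: "e > 0" for y e
  proof -
    obtain x' where x': "x' \<in> Per Y" "mdist (seq_metric N Y) y x' < e / 2"
      by (rule LP_near_periodic[OF y half_gt_zero[OF e]])
    obtain x where x: "x \<in> words Y" "periodize x = x'" using Per_periodize[OF x'(1)] by blast
    obtain z where z: "z \<in> Per Y" "\<And>j. N (x' j - z j) \<le> e / 2" "thin s \<epsilon> (energies z)"
      using periodic_thin_approx[OF gap x(1) half_gt_zero[OF e] s \<epsilon>, unfolded x(2)] by blast
    have L: "x' \<in> LP N Y" "z \<in> LP N Y" using x'(1) z(1) Per_subset_LP by auto
    have "mdist (seq_metric N Y) x' z \<le> e / 2" using seq_metric_le_iff[OF L] z(2) by blast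
    then have "mdist (seq_metric N Y) y z < e" using L.triangle[OF y L] x'(2) by linarith
    then show ?thesis using L z(3) y by auto
  qed
  then show ?thesis unfolding mtopology_LP_metric L.metric_closure_of by blast
qed

end

theorem theorem2p8:
  fixes N :: "real ^ 'k::{finite,linorder} \<Rightarrow> real"
    and Y :: "(real ^ 'k::{finite,linorder}) set"
  assumes "is_norm N" and "gap_rich N Y"
  shows "\<exists>G. gdelta_in (mtopology_of (LP_metric N Y)) G \<and>
    mtopology_of (LP_metric N Y) closure_of G = LP N Y \<and>
    (\<forall>y\<in>G. \<exists>K::real set. spec_H y = complex_of_real ` K \<and> cantor_set K \<and> hausdorff_dim K = 0)"
proof -
  obtain S where S: "gap_rich_with N Y S" using assms(2) by (auto simp: gap_rich_def)
  have closed: "closed Y" using S by (simp add: gap_rich_with_def)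
  interpret L: Metric_space "LP N Y" "mdist (seq_metric N Y)" by (rule Metric_space_LP[OF assms(1)])
  \<comment> \<open>One index suffices for both parameters: by \<open>thin_radius\<close> a small
    exponent controls all larger ones, so countably many sets capture every
    \<open>s > 0\<close>.\<close>
  define G where "G n = {y \<in> LP N Y. thin (1 / real (Suc n)) (1 / real (Suc n)) (energies y)}" for n
  have G: "openin (mtopology_of (LP_metric N Y)) (G n)"
    "mtopology_of (LP_metric N Y) closure_of G n = LP N Y" for n
    unfolding G_def
    by (rule openin_thin_spectrum[OF assms(1)], rule dense_thin_spectrum[OF assms(1) S]) auto
  have "gdelta_in (mtopology_of (LP_metric N Y)) (\<Inter>(range G))"
    using G(1) by (intro gdelta_in_Inter) (auto intro: open_imp_gdelta_in)
  moreover have "mtopology_of (LP_metric N Y) closure_of \<Inter>(range G) = LP N Y"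
    using G unfolding mtopology_LP_metric[OF assms(1)]
    by (intro L.metric_Baire_category mcomplete_LP[OF assms(1) closed]) auto
  moreover have "spec_H y = complex_of_real ` energies y \<and> cantor_set (energies y) \<and> hausdorff_dim (energies y) = 0"
    if "y \<in> \<Inter>(range G)" for y
  proof -
    have y: "y \<in> LP N Y" "\<And>n. thin (1 / real (Suc n)) (1 / real (Suc n)) (energies y)"
      using that by (auto simp: G_def)
    then show ?thesis
      using spec_H_LP[OF assms(1)] LP_cantor[OF assms(1)] thin_hausdorff_dim by blast
  qed
  ultimately show ?thesis by blast
qed

end
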